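(* Let $a_1,a_2,b_1,b_2,d_1,d_2$ be positive integers and let $\Lambda$ be a $2$-graph with vertex set $\Lambda^0=\{u,v,w\}$ such that $|u\Lambda^{e_i}u|=d_i$ and $|u\Lambda^{e_i}v|=a_i$ for $i=1,2$, $|u\Lambda^{e_1}w|=b_1$, $|v\Lambda^{e_2}w|=b_2$, and there are no other edges. Let $r=(r_1,r_2)\in(0,\infty)^2$ be such that $r_i\ge\ln d_i$ for $i=1,2$, $r_i=\ln d_i$ for at least one $i$, and $\{r_1,r_2\}$ are rationally independent. Then $(\mathcal{T}C^*(\Lambda\setminus\{v,w\}),\alpha^r)$ has a unique KMS$_1$ state $\phi$, and $\phi\circ q_{\{v,w\}}$ is the only KMS$_1$ state of $(\mathcal{T}C^*(\Lambda),\alpha^r)$.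
   Context: $\mathbb{N}=\{0,1,2,\dots\}$, and $e_1,e_2$ are the standard generators of $\mathbb{N}^2$. A $2$-graph is a countable category $\Lambda$ with a degree functor $d:\Lambda\to\mathbb{N}^2$ such that whenever $d(\lambda)=m+n$ there are unique $\mu,\nu$ with $\lambda=\mu\nu$, $d(\mu)=m$, $d(\nu)=n$. Elements are called paths; $r(\lambda)$ and $s(\lambda)$ are the codomain and domain; $\mu\nu$ is defined when $s(\mu)=r(\nu)$. $\Lambda^n=d^{-1}(n)$; $\Lambda^0$ is identified with the objects (vertices); paths in $\Lambda^{e_1}\cup\Lambda^{e_2}$ are edges. $z\Lambda^n=\{\lambda\in\Lambda^n:r(\lambda)=z\}$, $z\Lambda^nx=\{\lambda\in z\Lambda^n:s(\lambda)=x\}$. For $r(\mu)=r(\nu)$, $\Lambda^{\min}(\mu,\nu)=\{(\alpha,\beta)\in\Lambda\times\Lambda:\mu\alpha=\nu\beta,\ d(\mu\alpha)=d(\mu)\vee d(\nu)\}$ (empty if $r(\mu)\neq r(\nu)$). The Toeplitz algebra $\mathcal{T}C^*(\Lambda)$ is the universal $C^*$-algebra generated by partial isometries $\{t_\lambda:\lambda\in\Lambda\}$ such that: (T1) $\{t_z:z\in\Lambda^0\}$ are mutually orthogonal projections; (T2) $t_\lambda t_\mu=t_{\lambda\mu}$ if $s(\lambda)=r(\mu)$; (T3) $t_\lambda^*t_\lambda=t_{s(\lambda)}$; (T4) $t_z\ge\sum_{\lambda\in z\Lambda^n}t_\lambda t_\lambda^*$ for $z\in\Lambda^0$, $n\in\mathbb{N}^2$;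 (T5) $t_\mu^*t_\nu=\sum_{(\alpha,\beta)\in\Lambda^{\min}(\mu,\nu)}t_\alpha t_\beta^*$ (empty sums are $0$). The dynamics $\alpha^r:\mathbb{R}\to\operatorname{Aut}\mathcal{T}C^*(\Lambda)$ is given by $\alpha^r_t(t_\mu t_\nu^* )=e^{it\,r\cdot(d(\mu)-d(\nu))}t_\mu t_\nu^*$ (and similarly for $\Lambda\setminus\{v,w\}$). A KMS$_\beta$ state is a state $\phi$ with $\phi(ab)=\phi(b\,\alpha^r_{i\beta}(a))$ for all analytic $a,b$. Rationally independent means linearly independent over $\mathbb{Q}$. $\Lambda\setminus\{v,w\}=\{\mu\in\Lambda:s(\mu)\notin\{v,w\}\}=u\Lambda u$ is the sub-$2$-graph with vertex $u$, and $q_{\{v,w\}}:\mathcal{T}C^*(\Lambda)\to\mathcal{T}C^*(\Lambda\setminus\{v,w\})$ is the surjective homomorphism with $q_{\{v,w\}}(t_\mu)=t_\mu$ if $s(\mu)\notin\{v,w\}$ and $q_{\{v,w\}}(t_\mu)=0$ otherwise; its kernel is the ideal generated by $\{t_v,t_w\}$. *)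

theory Defs
  imports "HOL-Analysis.Analysis" "HOL-Algebra.Algebraic_Closure_Type"
begin

section \<open>C*-algebras\<close>

text \<open>
  The algebras are carrier based and need not be unital, so the field \<open>one\<close> inherited from the
  ring record is not constrained by any axiom below. \<open>ring_of_type_algebra\<close> is the ring structure
  on the whole type of complex numbers.
\<close>

record 'a cstar = "(complex, 'a) module" +
  invol :: "'a \<Rightarrow> 'a"
  cnorm :: "'a \<Rightarrow> real"

text \<open>
  The metric is set to 0 off the carrier only because the locale \<open>Metric_space\<close> requires
  nonnegativity and symmetry on the whole type.
\<close>

definition cstar_dist :: "'a cstar \<Rightarrow> 'a \<Rightarrow> 'a \<Rightarrow> real" where
  "cstar_dist A x y =
     (if x \<in> carrier A \<and> y \<in> carrier A then cnorm A (x \<ominus>\<^bsub>A\<^esub> y) else 0)"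

definition cstar_topology :: "'a cstar \<Rightarrow> 'a topology" where
  "cstar_topology A = Metric_space.mtopology (carrier A) (cstar_dist A)"

locale cstar_algebra = Module.module "ring_of_type_algebra :: complex ring" A
  for A :: "'a cstar" (structure) +
  assumes mult_closed: "\<lbrakk>x \<in> carrier A; y \<in> carrier A\<rbrakk> \<Longrightarrow> x \<otimes> y \<in> carrier A"
    and mult_assoc: "\<lbrakk>x \<in> carrier A; y \<in> carrier A; z \<in> carrier A\<rbrakk>
      \<Longrightarrow> (x \<otimes> y) \<otimes> z = x \<otimes> (y \<otimes> z)"
    and mult_distrib_right: "\<lbrakk>x \<in> carrier A; y \<in> carrier A; z \<in> carrier A\<rbrakk>
      \<Longrightarrow> (x \<oplus> y) \<otimes> z = x \<otimes> z \<oplus> y \<otimes> z"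
    and mult_distrib_left: "\<lbrakk>x \<in> carrier A; y \<in> carrier A; z \<in> carrier A\<rbrakk>
      \<Longrightarrow> x \<otimes> (y \<oplus> z) = x \<otimes> y \<oplus> x \<otimes> z"
    and smult_mult_left: "\<lbrakk>x \<in> carrier A; y \<in> carrier A\<rbrakk>
      \<Longrightarrow> (c \<odot> x) \<otimes> y = c \<odot> (x \<otimes> y)"
    and smult_mult_right: "\<lbrakk>x \<in> carrier A; y \<in> carrier A\<rbrakk>
      \<Longrightarrow> x \<otimes> (c \<odot> y) = c \<odot> (x \<otimes> y)"
    and invol_closed: "x \<in> carrier A \<Longrightarrow> invol A x \<in> carrier A"
    and invol_invol: "x \<in> carrier A \<Longrightarrow> invol A (invol A x) = x"
    and invol_add: "\<lbrakk>x \<in> carrier A; y \<in> carrier A\<rbrakk>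
      \<Longrightarrow> invol A (x \<oplus> y) = invol A x \<oplus> invol A y"
    and invol_smult: "x \<in> carrier A \<Longrightarrow> invol A (c \<odot> x) = cnj c \<odot> invol A x"
    and invol_mult: "\<lbrakk>x \<in> carrier A; y \<in> carrier A\<rbrakk>
      \<Longrightarrow> invol A (x \<otimes> y) = invol A y \<otimes> invol A x"
    and cnorm_nonneg: "x \<in> carrier A \<Longrightarrow> 0 \<le> cnorm A x"
    and cnorm_eq_0: "x \<in> carrier A \<Longrightarrow> cnorm A x = 0 \<longleftrightarrow> x = \<zero>"
    and cnorm_triangle: "\<lbrakk>x \<in> carrier A; y \<in> carrier A\<rbrakk>
      \<Longrightarrow> cnorm A (x \<oplus> y) \<le> cnorm A x + cnorm A y"
    and cnorm_smult: "x \<in> carrier A \<Longrightarrow> cnorm A (c \<odot> x) = cmod c * cnorm A x"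
    and cnorm_mult: "\<lbrakk>x \<in> carrier A; y \<in> carrier A\<rbrakk>
      \<Longrightarrow> cnorm A (x \<otimes> y) \<le> cnorm A x * cnorm A y"
    and cstar_identity: "x \<in> carrier A \<Longrightarrow> cnorm A (invol A x \<otimes> x) = (cnorm A x)\<^sup>2"
    and complete: "Metric_space.mcomplete (carrier A) (cstar_dist A)"

lemma (in cstar_algebra) Metric_space_cstar: "Metric_space (carrier A) (cstar_dist A)"
proof
  let ?R = "ring_of_type_algebra :: complex ring"
  have R: "carrier ?R = UNIV" "add ?R = (+)" "\<one>\<^bsub>?R\<^esub> = 1" "\<zero>\<^bsub>?R\<^esub> = 0"
    by (simp_all add: ring_of_type_algebra_def)
  have swap: "cnorm A (y \<ominus>\<^bsub>A\<^esub> x) = cnorm A (x \<ominus>\<^bsub>A\<^esub> y)"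
    if "x \<in> carrier A" "y \<in> carrier A" for x y
  proof -
    have cl: "x \<ominus>\<^bsub>A\<^esub> y \<in> carrier A" using that by simp
    have "(1 + (-1)) \<odot>\<^bsub>A\<^esub> z = 1 \<odot>\<^bsub>A\<^esub> z \<oplus>\<^bsub>A\<^esub> (-1) \<odot>\<^bsub>A\<^esub> z" if "z \<in> carrier A" for z
      using smult_l_distr[of 1 "-1" z] that by (simp add: R)
    moreover have "0 \<odot>\<^bsub>A\<^esub> z = \<zero>\<^bsub>A\<^esub>" if "z \<in> carrier A" for z
      using smult_l_null[of z] that by (simp add: R)
    moreover have "1 \<odot>\<^bsub>A\<^esub> z = z" if "z \<in> carrier A" for z
      using smult_one[of z] that by (simp add: R)
    moreover have "c \<odot>\<^bsub>A\<^esub> z \<in> carrier A" if "z \<in> carrier A" for z c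
      using smult_closed[of c z] that by (simp add: R)
    ultimately have "(-1) \<odot>\<^bsub>A\<^esub> (x \<ominus>\<^bsub>A\<^esub> y) = \<ominus>\<^bsub>A\<^esub> (x \<ominus>\<^bsub>A\<^esub> y)"
      using cl by (metis M.minus_equality M.a_comm add.right_inverse)
    also have "\<dots> = y \<ominus>\<^bsub>A\<^esub> x"
      using that by (simp add: a_minus_def M.minus_add M.a_comm)
    finally show ?thesis
      using cnorm_smult[OF cl, of "-1"] by simp
  qed
  fix x y z
  show "0 \<le> cstar_dist A x y"
    by (simp add: cstar_dist_def cnorm_nonneg)
  show "cstar_dist A x y = cstar_dist A y x"
    using swap by (simp add: cstar_dist_def)
  show "x \<in> carrier A \<Longrightarrow> y \<in> carrier A \<Longrightarrow> cstar_dist A x y = 0 \<longleftrightarrow> x = y"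
    using M.minus_equality[of x "\<ominus>\<^bsub>A\<^esub> y"]
    by (auto simp: cstar_dist_def cnorm_eq_0 a_minus_def M.r_neg)
  show "cstar_dist A x z \<le> cstar_dist A x y + cstar_dist A y z"
    if "x \<in> carrier A" "y \<in> carrier A" "z \<in> carrier A"
  proof -
    have "x \<ominus>\<^bsub>A\<^esub> z = (x \<ominus>\<^bsub>A\<^esub> y) \<oplus>\<^bsub>A\<^esub> (y \<ominus>\<^bsub>A\<^esub> z)"
      using that by (simp add: a_minus_def M.a_assoc M.r_neg2 M.r_neg1)
    then show ?thesis
      using that cnorm_triangle[of "x \<ominus>\<^bsub>A\<^esub> y" "y \<ominus>\<^bsub>A\<^esub> z"] by (simp add: cstar_dist_def)
  qed
qed

definition cstar_le :: "'a cstar \<Rightarrow> 'a \<Rightarrow> 'a \<Rightarrow> bool" where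
  "cstar_le A x y \<longleftrightarrow> (\<exists>c\<in>carrier A. y \<ominus>\<^bsub>A\<^esub> x = invol A c \<otimes>\<^bsub>A\<^esub> c)"

definition star_hom :: "'a cstar \<Rightarrow> 'b cstar \<Rightarrow> ('a \<Rightarrow> 'b) \<Rightarrow> bool" where
  "star_hom A B h \<longleftrightarrow>
     h \<in> carrier A \<rightarrow> carrier B \<and>
     (\<forall>x\<in>carrier A. \<forall>y\<in>carrier A. h (x \<oplus>\<^bsub>A\<^esub> y) = h x \<oplus>\<^bsub>B\<^esub> h y) \<and>
     (\<forall>c. \<forall>x\<in>carrier A. h (c \<odot>\<^bsub>A\<^esub> x) = c \<odot>\<^bsub>B\<^esub> h x) \<and>
     (\<forall>x\<in>carrier A. \<forall>y\<in>carrier A. h (x \<otimes>\<^bsub>A\<^esub> y) = h x \<otimes>\<^bsub>B\<^esub> h y) \<and>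
     (\<forall>x\<in>carrier A. h (invol A x) = invol B (h x))"

definition cstar_subalgebra :: "'a cstar \<Rightarrow> 'a set \<Rightarrow> bool" where
  "cstar_subalgebra A S \<longleftrightarrow>
     S \<subseteq> carrier A \<and> \<zero>\<^bsub>A\<^esub> \<in> S \<and>
     (\<forall>x\<in>S. \<forall>y\<in>S. x \<oplus>\<^bsub>A\<^esub> y \<in> S) \<and>
     (\<forall>c. \<forall>x\<in>S. c \<odot>\<^bsub>A\<^esub> x \<in> S) \<and>
     (\<forall>x\<in>S. \<forall>y\<in>S. x \<otimes>\<^bsub>A\<^esub> y \<in> S) \<and>
     (\<forall>x\<in>S. invol A x \<in> S) \<and>
     closedin (cstar_topology A) S"

section \<open>States, dynamics and the KMS condition\<close>

text \<open>
  States are extensional (equal to \<open>undefined\<close> off the carrier), so that equality of states is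
  equality of functions on the algebra.
\<close>

definition cstar_state :: "'a cstar \<Rightarrow> ('a \<Rightarrow> complex) \<Rightarrow> bool" where
  "cstar_state A \<phi> \<longleftrightarrow>
     \<phi> \<in> extensional (carrier A) \<and>
     (\<forall>x\<in>carrier A. \<forall>y\<in>carrier A. \<phi> (x \<oplus>\<^bsub>A\<^esub> y) = \<phi> x + \<phi> y) \<and>
     (\<forall>c. \<forall>x\<in>carrier A. \<phi> (c \<odot>\<^bsub>A\<^esub> x) = c * \<phi> x) \<and>
     (\<forall>x\<in>carrier A. \<phi> (invol A x \<otimes>\<^bsub>A\<^esub> x) \<in> \<real>\<^sub>\<ge>\<^sub>0) \<and>
     bdd_above ((\<lambda>x. cmod (\<phi> x)) ` {x \<in> carrier A. cnorm A x \<le> 1}) \<and>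
     (SUP x\<in>{x \<in> carrier A. cnorm A x \<le> 1}. cmod (\<phi> x)) = 1"

definition cstar_dynamics :: "'a cstar \<Rightarrow> (real \<Rightarrow> 'a \<Rightarrow> 'a) \<Rightarrow> bool" where
  "cstar_dynamics A \<alpha> \<longleftrightarrow>
     (\<forall>t. star_hom A A (\<alpha> t) \<and> bij_betw (\<alpha> t) (carrier A) (carrier A)) \<and>
     (\<forall>x\<in>carrier A. \<alpha> 0 x = x) \<and>
     (\<forall>s t. \<forall>x\<in>carrier A. \<alpha> (s + t) x = \<alpha> s (\<alpha> t x)) \<and>
     (\<forall>x\<in>carrier A. continuous_map euclideanreal (cstar_topology A) (\<lambda>t. \<alpha> t x))"

definition entire_into :: "'a cstar \<Rightarrow> (complex \<Rightarrow> 'a) \<Rightarrow> bool" where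
  "entire_into A F \<longleftrightarrow>
     range F \<subseteq> carrier A \<and>
     (\<forall>z. \<exists>D. limitin (cstar_topology A)
        (\<lambda>h. inverse h \<odot>\<^bsub>A\<^esub> (F (z + h) \<ominus>\<^bsub>A\<^esub> F z)) D (at 0))"

text \<open>
  \<open>F\<close> is the entire function extending the orbit of \<open>a\<close>, so \<open>F z\<close> is what is usually written
  \<open>\<alpha>\<^sub>z(a)\<close>; it is unique if it exists.
\<close>

definition analytic_extension ::
    "'a cstar \<Rightarrow> (real \<Rightarrow> 'a \<Rightarrow> 'a) \<Rightarrow> 'a \<Rightarrow> (complex \<Rightarrow> 'a) \<Rightarrow> bool" where
  "analytic_extension A \<alpha> a F \<longleftrightarrow>
     a \<in> carrier A \<and> entire_into A F \<and> (\<forall>t. F (complex_of_real t) = \<alpha> t a)"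

definition analytic_element :: "'a cstar \<Rightarrow> (real \<Rightarrow> 'a \<Rightarrow> 'a) \<Rightarrow> 'a \<Rightarrow> bool" where
  "analytic_element A \<alpha> a \<longleftrightarrow> (\<exists>F. analytic_extension A \<alpha> a F)"

definition kms_state ::
    "'a cstar \<Rightarrow> (real \<Rightarrow> 'a \<Rightarrow> 'a) \<Rightarrow> real \<Rightarrow> ('a \<Rightarrow> complex) \<Rightarrow> bool" where
  "kms_state A \<alpha> \<beta> \<phi> \<longleftrightarrow>
     cstar_state A \<phi> \<and>
     (\<forall>a b F. analytic_extension A \<alpha> a F \<and> analytic_element A \<alpha> b \<longrightarrow>
        \<phi> (a \<otimes>\<^bsub>A\<^esub> b) = \<phi> (b \<otimes>\<^bsub>A\<^esub> F (\<i> * complex_of_real \<beta>)))"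

section \<open>2-graphs\<close>

text \<open>
  Categories are presented by their arrows only, objects being identified with identity arrows:
  \<open>src \<xi>\<close> and \<open>rng \<xi>\<close> are the identities at the domain and the codomain of \<open>\<xi>\<close>, and
  \<open>pcomp \<mu> \<nu>\<close> is meaningful when \<open>src \<mu> = rng \<nu>\<close>. Unique factorisation makes the identity arrows
  precisely the paths of degree 0.
\<close>

record 'p pregraph =
  paths :: "'p set"
  rng :: "'p \<Rightarrow> 'p"
  src :: "'p \<Rightarrow> 'p"
  pcomp :: "'p \<Rightarrow> 'p \<Rightarrow> 'p"
  deg :: "'p \<Rightarrow> nat \<times> nat"

locale two_graph =
  fixes \<Lambda> :: "'p pregraph"
  assumes countable_paths: "countable (paths \<Lambda>)"
    and rng_closed: "\<xi> \<in> paths \<Lambda> \<Longrightarrow> rng \<Lambda> \<xi> \<in> paths \<Lambda>"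
    and src_closed: "\<xi> \<in> paths \<Lambda> \<Longrightarrow> src \<Lambda> \<xi> \<in> paths \<Lambda>"
    and rng_rng: "\<xi> \<in> paths \<Lambda> \<Longrightarrow> rng \<Lambda> (rng \<Lambda> \<xi>) = rng \<Lambda> \<xi>"
    and src_rng: "\<xi> \<in> paths \<Lambda> \<Longrightarrow> src \<Lambda> (rng \<Lambda> \<xi>) = rng \<Lambda> \<xi>"
    and rng_src: "\<xi> \<in> paths \<Lambda> \<Longrightarrow> rng \<Lambda> (src \<Lambda> \<xi>) = src \<Lambda> \<xi>"
    and src_src: "\<xi> \<in> paths \<Lambda> \<Longrightarrow> src \<Lambda> (src \<Lambda> \<xi>) = src \<Lambda> \<xi>"
    and pcomp_closed: "\<lbrakk>\<mu> \<in> paths \<Lambda>; \<nu> \<in> paths \<Lambda>; src \<Lambda> \<mu> = rng \<Lambda> \<nu>\<rbrakk>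
      \<Longrightarrow> pcomp \<Lambda> \<mu> \<nu> \<in> paths \<Lambda>"
    and rng_pcomp: "\<lbrakk>\<mu> \<in> paths \<Lambda>; \<nu> \<in> paths \<Lambda>; src \<Lambda> \<mu> = rng \<Lambda> \<nu>\<rbrakk>
      \<Longrightarrow> rng \<Lambda> (pcomp \<Lambda> \<mu> \<nu>) = rng \<Lambda> \<mu>"
    and src_pcomp: "\<lbrakk>\<mu> \<in> paths \<Lambda>; \<nu> \<in> paths \<Lambda>; src \<Lambda> \<mu> = rng \<Lambda> \<nu>\<rbrakk>
      \<Longrightarrow> src \<Lambda> (pcomp \<Lambda> \<mu> \<nu>) = src \<Lambda> \<nu>"
    and pcomp_assoc: "\<lbrakk>\<xi> \<in> paths \<Lambda>; \<mu> \<in> paths \<Lambda>; \<nu> \<in> paths \<Lambda>;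
        src \<Lambda> \<xi> = rng \<Lambda> \<mu>; src \<Lambda> \<mu> = rng \<Lambda> \<nu>\<rbrakk>
      \<Longrightarrow> pcomp \<Lambda> (pcomp \<Lambda> \<xi> \<mu>) \<nu> = pcomp \<Lambda> \<xi> (pcomp \<Lambda> \<mu> \<nu>)"
    and pcomp_rng: "\<xi> \<in> paths \<Lambda> \<Longrightarrow> pcomp \<Lambda> (rng \<Lambda> \<xi>) \<xi> = \<xi>"
    and pcomp_src: "\<xi> \<in> paths \<Lambda> \<Longrightarrow> pcomp \<Lambda> \<xi> (src \<Lambda> \<xi>) = \<xi>"
    and deg_rng: "\<xi> \<in> paths \<Lambda> \<Longrightarrow> deg \<Lambda> (rng \<Lambda> \<xi>) = 0"
    and deg_src: "\<xi> \<in> paths \<Lambda> \<Longrightarrow> deg \<Lambda> (src \<Lambda> \<xi>) = 0"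
    and deg_pcomp: "\<lbrakk>\<mu> \<in> paths \<Lambda>; \<nu> \<in> paths \<Lambda>; src \<Lambda> \<mu> = rng \<Lambda> \<nu>\<rbrakk>
      \<Longrightarrow> deg \<Lambda> (pcomp \<Lambda> \<mu> \<nu>) = deg \<Lambda> \<mu> + deg \<Lambda> \<nu>"
    and factorisation: "\<lbrakk>\<xi> \<in> paths \<Lambda>; deg \<Lambda> \<xi> = m + n\<rbrakk>
      \<Longrightarrow> \<exists>!p. case p of (\<mu>, \<nu>) \<Rightarrow> \<mu> \<in> paths \<Lambda> \<and> \<nu> \<in> paths \<Lambda> \<and> src \<Lambda> \<mu> = rng \<Lambda> \<nu> \<and>
            \<xi> = pcomp \<Lambda> \<mu> \<nu> \<and> deg \<Lambda> \<mu> = m \<and> deg \<Lambda> \<nu> = n"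

abbreviation e1 :: "nat \<times> nat" where "e1 \<equiv> (1, 0)"
abbreviation e2 :: "nat \<times> nat" where "e2 \<equiv> (0, 1)"

definition vertices :: "'p pregraph \<Rightarrow> 'p set" where
  "vertices \<Lambda> = {\<xi> \<in> paths \<Lambda>. deg \<Lambda> \<xi> = 0}"

text \<open>The sets \<open>z\<Lambda>\<^sup>n\<close> and \<open>z\<Lambda>\<^sup>nx\<close>.\<close>

definition paths_at :: "'p pregraph \<Rightarrow> 'p \<Rightarrow> nat \<times> nat \<Rightarrow> 'p set" where
  "paths_at \<Lambda> z n = {\<xi> \<in> paths \<Lambda>. deg \<Lambda> \<xi> = n \<and> rng \<Lambda> \<xi> = z}"

definition paths_between :: "'p pregraph \<Rightarrow> 'p \<Rightarrow> nat \<times> nat \<Rightarrow> 'p \<Rightarrow> 'p set" where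
  "paths_between \<Lambda> z n x = {\<xi> \<in> paths_at \<Lambda> z n. src \<Lambda> \<xi> = x}"

text \<open>\<open>sup\<close> on \<open>nat \<times> nat\<close> is the coordinatewise maximum.\<close>

definition min_ext :: "'p pregraph \<Rightarrow> 'p \<Rightarrow> 'p \<Rightarrow> ('p \<times> 'p) set" where
  "min_ext \<Lambda> \<mu> \<nu> = {(\<alpha>, \<beta>). rng \<Lambda> \<mu> = rng \<Lambda> \<nu> \<and>
     \<alpha> \<in> paths \<Lambda> \<and> \<beta> \<in> paths \<Lambda> \<and> src \<Lambda> \<mu> = rng \<Lambda> \<alpha> \<and> src \<Lambda> \<nu> = rng \<Lambda> \<beta> \<and>
     pcomp \<Lambda> \<mu> \<alpha> = pcomp \<Lambda> \<nu> \<beta> \<and>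
     deg \<Lambda> (pcomp \<Lambda> \<mu> \<alpha>) = sup (deg \<Lambda> \<mu>) (deg \<Lambda> \<nu>)}"

definition graph_minus :: "'p pregraph \<Rightarrow> 'p set \<Rightarrow> 'p pregraph" where
  "graph_minus \<Lambda> V = \<Lambda>\<lparr>paths := {\<mu> \<in> paths \<Lambda>. src \<Lambda> \<mu> \<notin> V}\<rparr>"

section \<open>Toeplitz algebras\<close>

text \<open>
  The last two clauses use \<open>finsum\<close>s, which are meaningful for finite index sets; for a
  2-graph with finitely many edges into each vertex all of them are finite.
\<close>

definition toeplitz_family :: "'p pregraph \<Rightarrow> 'a cstar \<Rightarrow> ('p \<Rightarrow> 'a) \<Rightarrow> bool" where
  "toeplitz_family \<Lambda> A t \<longleftrightarrow>
     (\<forall>\<xi>\<in>paths \<Lambda>. t \<xi> \<in> carrier A \<and> t \<xi> \<otimes>\<^bsub>A\<^esub> invol A (t \<xi>) \<otimes>\<^bsub>A\<^esub> t \<xi> = t \<xi>) \<and>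
     (\<forall>z\<in>vertices \<Lambda>. t z \<otimes>\<^bsub>A\<^esub> t z = t z \<and> invol A (t z) = t z) \<and>
     (\<forall>y\<in>vertices \<Lambda>. \<forall>z\<in>vertices \<Lambda>. y \<noteq> z \<longrightarrow> t y \<otimes>\<^bsub>A\<^esub> t z = \<zero>\<^bsub>A\<^esub>) \<and>
     (\<forall>\<xi>\<in>paths \<Lambda>. \<forall>\<mu>\<in>paths \<Lambda>. src \<Lambda> \<xi> = rng \<Lambda> \<mu> \<longrightarrow>
        t \<xi> \<otimes>\<^bsub>A\<^esub> t \<mu> = t (pcomp \<Lambda> \<xi> \<mu>)) \<and>
     (\<forall>\<xi>\<in>paths \<Lambda>. invol A (t \<xi>) \<otimes>\<^bsub>A\<^esub> t \<xi> = t (src \<Lambda> \<xi>)) \<and>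
     (\<forall>z\<in>vertices \<Lambda>. \<forall>n.
        cstar_le A (\<Oplus>\<^bsub>A\<^esub>\<xi>\<in>paths_at \<Lambda> z n. t \<xi> \<otimes>\<^bsub>A\<^esub> invol A (t \<xi>)) (t z)) \<and>
     (\<forall>\<mu>\<in>paths \<Lambda>. \<forall>\<nu>\<in>paths \<Lambda>. invol A (t \<mu>) \<otimes>\<^bsub>A\<^esub> t \<nu> =
        (\<Oplus>\<^bsub>A\<^esub>p\<in>min_ext \<Lambda> \<mu> \<nu>. t (fst p) \<otimes>\<^bsub>A\<^esub> invol A (t (snd p))))"

text \<open>
  \<open>A\<close> with the family \<open>t\<close> is the universal C*-algebra generated by a Toeplitz family of \<open>\<Lambda>\<close>.
  HOL cannot quantify over types inside a formula, so the universal property tests against the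
  C*-algebras with carrier in one fixed type. This loses nothing: as \<open>\<Lambda>\<close> is countable, a Toeplitz
  family generates a separable C*-algebra, and every separable C*-algebra is isomorphic to an algebra
  of operators on \<open>\<ell>\<^sup>2(\<nat>)\<close>, whose elements can be taken in the type \<open>test_carrier\<close>. The algebra
  \<open>A\<close> itself may live in any type. The homomorphism is unique because \<open>t\<close> generates \<open>A\<close>.
\<close>

type_synonym test_carrier = "(nat \<Rightarrow> complex) \<Rightarrow> (nat \<Rightarrow> complex)"

definition toeplitz_algebra :: "'p pregraph \<Rightarrow> 'a cstar \<Rightarrow> ('p \<Rightarrow> 'a) \<Rightarrow> bool" where
  "toeplitz_algebra \<Lambda> A t \<longleftrightarrow>
     cstar_algebra A \<and> toeplitz_family \<Lambda> A t \<and>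
     (\<forall>S. cstar_subalgebra A S \<and> t ` paths \<Lambda> \<subseteq> S \<longrightarrow> S = carrier A) \<and>
     (\<forall>(B :: test_carrier cstar) T. cstar_algebra B \<and> toeplitz_family \<Lambda> B T \<longrightarrow>
        (\<exists>h. star_hom A B h \<and> (\<forall>\<xi>\<in>paths \<Lambda>. h (t \<xi>) = T \<xi>)))"

definition toeplitz_dynamics ::
    "'p pregraph \<Rightarrow> 'a cstar \<Rightarrow> ('p \<Rightarrow> 'a) \<Rightarrow> real \<times> real \<Rightarrow> (real \<Rightarrow> 'a \<Rightarrow> 'a) \<Rightarrow> bool" where
  "toeplitz_dynamics \<Lambda> A t r \<alpha> \<longleftrightarrow>
     cstar_dynamics A \<alpha> \<and>
     (\<forall>x. \<forall>\<mu>\<in>paths \<Lambda>. \<forall>\<nu>\<in>paths \<Lambda>.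
        \<alpha> x (t \<mu> \<otimes>\<^bsub>A\<^esub> invol A (t \<nu>)) =
        exp (\<i> * complex_of_real (x *
          (fst r * (real (fst (deg \<Lambda> \<mu>)) - real (fst (deg \<Lambda> \<nu>))) +
           snd r * (real (snd (deg \<Lambda> \<mu>)) - real (snd (deg \<Lambda> \<nu>))))))
        \<odot>\<^bsub>A\<^esub> (t \<mu> \<otimes>\<^bsub>A\<^esub> invol A (t \<nu>)))"

text \<open>The canonical surjection onto the Toeplitz algebra of \<open>\<Lambda> \<setminus> V\<close>, where \<open>(B, T)\<close> is the latter.\<close>

definition toeplitz_quotient_map ::
    "'p pregraph \<Rightarrow> 'p set \<Rightarrow> 'a cstar \<Rightarrow> ('p \<Rightarrow> 'a) \<Rightarrow> 'b cstar \<Rightarrow> ('p \<Rightarrow> 'b) \<Rightarrow> ('a \<Rightarrow> 'b) \<Rightarrow> bool"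
  where
  "toeplitz_quotient_map \<Lambda> V A t B T q \<longleftrightarrow>
     star_hom A B q \<and> q ` carrier A = carrier B \<and>
     (\<forall>\<mu>\<in>paths \<Lambda>. q (t \<mu>) = (if src \<Lambda> \<mu> \<notin> V then T \<mu> else \<zero>\<^bsub>B\<^esub>))"

text \<open>Stated for the pair \<open>x, y\<close> rather than the set \<open>{x, y}\<close>, so that \<open>x = y\<close> is excluded.\<close>

definition rationally_independent :: "real \<Rightarrow> real \<Rightarrow> bool" where
  "rationally_independent x y \<longleftrightarrow>
     (\<forall>p q :: rat. of_rat p * x + of_rat q * y = 0 \<longrightarrow> p = 0 \<and> q = 0)"

end

theory Submission
  imports Defs "HOL-Complex_Analysis.Complex_Analysis"
begin

text \<open>
  Let \<open>\<phi>\<close> be a KMS\<open>\<^sub>1\<close> state and \<open>m\<^sub>z = \<phi>(t\<^sub>z)\<close>. Moving first \<open>t\<^sub>\<mu>\<close> and then \<open>t\<^sub>\<nu>\<^sup>*\<close> around in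
  \<open>\<phi>(t\<^sub>\<mu>t\<^sub>\<nu>\<^sup>*)\<close> multiplies this number by \<open>exp(r\<cdot>(d(\<nu>) - d(\<mu>)))\<close>. As \<open>r\<^sub>1, r\<^sub>2\<close> are rationally
  independent it vanishes unless \<open>d(\<mu>) = d(\<nu>)\<close>, and then (T5) and (T3) leave
  \<open>\<phi>(t\<^sub>\<mu>t\<^sub>\<nu>\<^sup>*) = \<delta>\<^sub>\<mu>\<^sub>\<nu> exp(-r\<cdot>d(\<mu>)) m\<^sub>s\<^sub>(\<^sub>\<mu>\<^sub>)\<close> (\<open>kms_state_gen\<close>). The elements \<open>t\<^sub>\<mu>t\<^sub>\<nu>\<^sup>*\<close> span a dense
  subspace, so \<open>\<phi>\<close> is determined by the numbers \<open>m\<^sub>z\<close>. Applying \<open>\<phi>\<close> to (T4) bounds \<open>m\<^sub>z\<close> below by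
  \<open>exp(-r\<cdot>n)\<close> times the sum of the masses at the sources of \<open>z\<Lambda>\<^sup>n\<close> (\<open>kms_state_subinvariant\<close>). If
  \<open>r\<^sub>i = ln d\<^sub>i\<close>, the \<open>d\<^sub>i\<close> loops at \<open>u\<close> already account for all of \<open>m\<^sub>u\<close>, so the \<open>a\<^sub>i > 0\<close> edges from
  \<open>v\<close> force \<open>m\<^sub>v = 0\<close>; the inequality at \<open>v\<close> for \<open>n = e\<^sub>2\<close> then gives \<open>m\<^sub>w = 0\<close>. Hence both algebras
  have at most one KMS\<open>\<^sub>1\<close> state, with \<open>m\<^sub>u = 1\<close>.

  For existence, a positive functional with the values above is automatically KMS. On the elements
  \<open>t\<^sub>\<mu>t\<^sub>\<nu>\<^sup>*\<close> this is a bijection between two sets of minimal common extensions (\<open>min_ext_swap\<close>). For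
  an arbitrary analytic \<open>a\<close> with entire extension \<open>F\<close> of its orbit, invariance of the functional
  makes \<open>\<phi>(F(z) t\<^sub>\<mu>t\<^sub>\<nu>\<^sup>*)\<close> an explicit exponential for real \<open>z\<close>, hence for all \<open>z\<close> by the identity
  theorem, and \<open>z = \<i>\<close> gives the KMS condition (\<open>kms_condition\<close>). It remains to find one such
  functional on the algebra of the one-vertex graph \<open>\<Lambda> \<setminus> {v, w}\<close>, since composing it with \<open>q\<close>
  gives one on \<open>\<T>C\<^sup>*(\<Lambda>)\<close>. It is a limit of averages of vector states of the path space
  representation on \<open>\<ell>\<^sup>2\<close> (\<open>exists_critical_state\<close>): the degree of the path is distributed
  as a pair of truncated geometric variables with ratios \<open>d\<^sub>i exp(-r\<^sub>i)\<close>, and the path is uniform among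
  those of its degree. The truncation is what makes the ratio 1, where the geometric distribution
  itself does not exist, no different from the others; on each \<open>t\<^sub>\<mu>t\<^sub>\<nu>\<^sup>*\<close> the averages are eventually
  constant.

  Two tools serve both halves. Positive functionals on a unital C*-algebra are bounded
  (\<open>positive_functional_bounded\<close>), so that functionals of the form \<open>\<phi> \<circ> h\<close> with a star homomorphism
  \<open>h\<close> are under control. Density of the span is used through
  \<open>convergent_on_gens_convergent\<close>: uniformly bounded functionals that converge on every
  \<open>t\<^sub>\<mu>t\<^sub>\<nu>\<^sup>*\<close> converge everywhere.
\<close>

section \<open>Arithmetic in C*-algebras\<close>

context cstar_algebra
begin

lemma scalar_ring_simps:
  "carrier (ring_of_type_algebra :: complex ring) = UNIV"
  "x \<oplus>\<^bsub>ring_of_type_algebra\<^esub> y = x + (y::complex)"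
  "x \<otimes>\<^bsub>ring_of_type_algebra\<^esub> y = x * (y::complex)"
  "\<zero>\<^bsub>ring_of_type_algebra\<^esub> = (0::complex)"
  "\<one>\<^bsub>ring_of_type_algebra\<^esub> = (1::complex)"
  by (simp_all add: ring_of_type_algebra_def)

lemma smult_in_carrier [simp, intro]: "x \<in> carrier A \<Longrightarrow> c \<odot> x \<in> carrier A"
  using smult_closed by (simp add: scalar_ring_simps)

lemma smult_add_left: "x \<in> carrier A \<Longrightarrow> (c + d) \<odot> x = c \<odot> x \<oplus> d \<odot> x"
  using smult_l_distr[of c d x] by (simp add: scalar_ring_simps)

lemma smult_add_right:
  "\<lbrakk>x \<in> carrier A; y \<in> carrier A\<rbrakk> \<Longrightarrow> c \<odot> (x \<oplus> y) = c \<odot> x \<oplus> c \<odot> y"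
  using smult_r_distr[of c x y] by (simp add: scalar_ring_simps)

lemma smult_smult: "x \<in> carrier A \<Longrightarrow> c \<odot> (d \<odot> x) = (c * d) \<odot> x"
  using smult_assoc1[of c d x] by (simp add: scalar_ring_simps)

lemma one_smult [simp]: "x \<in> carrier A \<Longrightarrow> 1 \<odot> x = x"
  using smult_one[of x] by (simp add: scalar_ring_simps)

lemma zero_smult [simp]: "x \<in> carrier A \<Longrightarrow> 0 \<odot> x = \<zero>"
  using smult_l_null[of x] by (simp add: scalar_ring_simps)

lemma smult_zero [simp]: "c \<odot> \<zero> = \<zero>"
  using smult_r_null[of c] by (simp add: scalar_ring_simps)

lemma neg_one_smult: "x \<in> carrier A \<Longrightarrow> (-1) \<odot> x = \<ominus> x"
  using smult_add_left[of x "1" "-1"] M.minus_equality[of "(-1) \<odot> x" x]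
  by (simp add: M.a_comm)

lemma minus_eq_smult: "\<lbrakk>x \<in> carrier A; y \<in> carrier A\<rbrakk> \<Longrightarrow> x \<ominus> y = x \<oplus> (-1) \<odot> y"
  by (simp add: a_minus_def neg_one_smult)

lemmas closed_simps [simp, intro] = mult_closed invol_closed

lemma mult_zero_right [simp]: "x \<in> carrier A \<Longrightarrow> x \<otimes> \<zero> = \<zero>"
  using smult_mult_right[of x \<zero> 0] by simp

lemma mult_zero_left [simp]: "x \<in> carrier A \<Longrightarrow> \<zero> \<otimes> x = \<zero>"
  using smult_mult_left[of \<zero> x 0] by simp

lemma invol_zero [simp]: "invol A \<zero> = \<zero>"
  using invol_smult[of \<zero> 0] by simp

lemma mult_minus_right:
  "\<lbrakk>x \<in> carrier A; y \<in> carrier A; z \<in> carrier A\<rbrakk> \<Longrightarrow> x \<otimes> (y \<ominus> z) = x \<otimes> y \<ominus> x \<otimes> z"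
  by (simp add: minus_eq_smult mult_distrib_left smult_mult_right)

lemma mult_minus_left:
  "\<lbrakk>x \<in> carrier A; y \<in> carrier A; z \<in> carrier A\<rbrakk> \<Longrightarrow> (y \<ominus> z) \<otimes> x = y \<otimes> x \<ominus> z \<otimes> x"
  by (simp add: minus_eq_smult mult_distrib_right smult_mult_left)

lemma invol_minus:
  "\<lbrakk>x \<in> carrier A; y \<in> carrier A\<rbrakk> \<Longrightarrow> invol A (x \<ominus> y) = invol A x \<ominus> invol A y"
  by (simp add: minus_eq_smult invol_add invol_smult)

lemma cnorm_zero [simp]: "cnorm A \<zero> = 0"
  using cnorm_eq_0 by simp

lemma cnorm_minus_commute:
  "\<lbrakk>x \<in> carrier A; y \<in> carrier A\<rbrakk> \<Longrightarrow> cnorm A (x \<ominus> y) = cnorm A (y \<ominus> x)"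
  using Metric_space.commute[OF Metric_space_cstar, of x y] by (simp add: cstar_dist_def)

lemma cnorm_minus_triangle:
  "\<lbrakk>x \<in> carrier A; y \<in> carrier A; z \<in> carrier A\<rbrakk>
    \<Longrightarrow> cnorm A (x \<ominus> z) \<le> cnorm A (x \<ominus> y) + cnorm A (y \<ominus> z)"
  using Metric_space.triangle[OF Metric_space_cstar, of x y z] by (simp add: cstar_dist_def)

lemma cnorm_minus_eq_0:
  "\<lbrakk>x \<in> carrier A; y \<in> carrier A\<rbrakk> \<Longrightarrow> cnorm A (x \<ominus> y) = 0 \<longleftrightarrow> x = y"
  using Metric_space.zero[OF Metric_space_cstar, of x y] by (simp add: cstar_dist_def)

lemma cnorm_le_add_diff:
  "\<lbrakk>x \<in> carrier A; y \<in> carrier A\<rbrakk> \<Longrightarrow> cnorm A x \<le> cnorm A y + cnorm A (x \<ominus> y)"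
proof -
  assume xy: "x \<in> carrier A" "y \<in> carrier A"
  have "x = y \<oplus> (x \<ominus> y)"
    using xy by (simp add: a_minus_def M.a_ac M.r_neg)
  then show ?thesis
    using cnorm_triangle[of y "x \<ominus> y"] xy by simp
qed

text \<open>
  The C*-identity and submultiplicativity give \<open>\<parallel>x\<parallel>\<^sup>2 \<le> \<parallel>x\<^sup>*\<parallel>\<parallel>x\<parallel>\<close>; the reverse inequality is the same for
  \<open>x\<^sup>*\<close>.
\<close>

lemma cnorm_invol: "x \<in> carrier A \<Longrightarrow> cnorm A (invol A x) = cnorm A x"
proof -
  have le: "cnorm A y \<le> cnorm A (invol A y)" if y: "y \<in> carrier A" for y
  proof -
    have "(cnorm A y)\<^sup>2 \<le> cnorm A (invol A y) * cnorm A y"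
      using cstar_identity[OF y] cnorm_mult[of "invol A y" y] y by simp
    then show ?thesis
      using cnorm_nonneg[OF y] cnorm_nonneg[of "invol A y"] y
      by (cases "cnorm A y = 0") (auto simp: power2_eq_square)
  qed
  show "x \<in> carrier A \<Longrightarrow> ?thesis"
    using le[of x] le[of "invol A x"] by (simp add: invol_invol)
qed

lemma closedinI:
  assumes "S \<subseteq> carrier A"
    and "\<And>x. \<lbrakk>x \<in> carrier A; \<And>\<epsilon>. 0 < \<epsilon> \<Longrightarrow> \<exists>y\<in>S. cnorm A (x \<ominus> y) < \<epsilon>\<rbrakk> \<Longrightarrow> x \<in> S"
  shows "closedin (cstar_topology A) S"
proof -
  have "\<exists>r>0. disjnt S (Metric_space.mball (carrier A) (cstar_dist A) x r)"
    if x: "x \<in> carrier A - S" for x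
  proof -
    obtain \<epsilon> where e: "0 < \<epsilon>" "\<And>y. y \<in> S \<Longrightarrow> \<not> cnorm A (x \<ominus> y) < \<epsilon>"
      using assms(2)[of x] x by blast
    then have "disjnt S (Metric_space.mball (carrier A) (cstar_dist A) x \<epsilon>)"
      using assms(1) x
      by (auto simp: disjnt_iff Metric_space.in_mball[OF Metric_space_cstar] cstar_dist_def)
    with e show ?thesis by blast
  qed
  then show ?thesis
    using assms(1) by (simp add: cstar_topology_def Metric_space.closedin_metric[OF Metric_space_cstar])
qed

text \<open>
  A closed subset is a complete metric space in its own right, so Banach's theorem applies to it.
\<close>

lemma contraction_fixed_point:
  assumes S: "closedin (cstar_topology A) S" "S \<noteq> {}"
    and f: "f \<in> S \<rightarrow> S"
    and k: "k < 1" "\<And>x y. \<lbrakk>x \<in> S; y \<in> S\<rbrakk> \<Longrightarrow> cnorm A (f x \<ominus> f y) \<le> k * cnorm A (x \<ominus> y)"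
  obtains x where "x \<in> S" "f x = x"
proof -
  interpret MS: Metric_space "carrier A" "cstar_dist A" by (rule Metric_space_cstar)
  have sub: "S \<subseteq> carrier A"
    using S by (simp add: cstar_topology_def MS.closedin_metric)
  interpret Submetric "carrier A" "cstar_dist A" S
    by unfold_locales (rule sub)
  have "sub.mcomplete"
    using S complete by (intro closedin_mcomplete_imp_mcomplete) (simp_all add: cstar_topology_def)
  moreover have "cstar_dist A (f x) (f y) \<le> k * cstar_dist A x y" if "x \<in> S" "y \<in> S" for x y
  proof -
    have "f x \<in> S" "f y \<in> S" using f that by auto
    then show ?thesis
      using k(2)[OF that] sub that by (auto simp: cstar_dist_def)
  qed
  ultimately show ?thesis
    using sub.Banach_fixedpoint_thm[of f k] S(2) f k(1) that by blast
qed

end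

section \<open>Positive functionals\<close>

definition linear_functional :: "'a cstar \<Rightarrow> ('a \<Rightarrow> complex) \<Rightarrow> bool" where
  "linear_functional A f \<longleftrightarrow>
     (\<forall>x\<in>carrier A. \<forall>y\<in>carrier A. f (x \<oplus>\<^bsub>A\<^esub> y) = f x + f y) \<and>
     (\<forall>c. \<forall>x\<in>carrier A. f (c \<odot>\<^bsub>A\<^esub> x) = c * f x)"

definition positive_functional :: "'a cstar \<Rightarrow> ('a \<Rightarrow> complex) \<Rightarrow> bool" where
  "positive_functional A f \<longleftrightarrow>
     linear_functional A f \<and> (\<forall>x\<in>carrier A. f (invol A x \<otimes>\<^bsub>A\<^esub> x) \<in> \<real>\<^sub>\<ge>\<^sub>0)"

definition bounded_functional :: "'a cstar \<Rightarrow> real \<Rightarrow> ('a \<Rightarrow> complex) \<Rightarrow> bool" where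
  "bounded_functional A K f \<longleftrightarrow>
     linear_functional A f \<and> 0 \<le> K \<and> (\<forall>x\<in>carrier A. cmod (f x) \<le> K * cnorm A x)"

lemma linear_functional_add:
  "\<lbrakk>linear_functional A f; x \<in> carrier A; y \<in> carrier A\<rbrakk> \<Longrightarrow> f (x \<oplus>\<^bsub>A\<^esub> y) = f x + f y"
  by (simp add: linear_functional_def)

lemma linear_functional_smult:
  "\<lbrakk>linear_functional A f; x \<in> carrier A\<rbrakk> \<Longrightarrow> f (c \<odot>\<^bsub>A\<^esub> x) = c * f x"
  by (simp add: linear_functional_def)

lemma (in cstar_algebra) linear_functional_minus:
  "\<lbrakk>linear_functional A f; x \<in> carrier A; y \<in> carrier A\<rbrakk> \<Longrightarrow> f (x \<ominus> y) = f x - f y"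
  by (simp add: minus_eq_smult linear_functional_add linear_functional_smult)

lemma (in cstar_algebra) linear_functional_zero: "linear_functional A f \<Longrightarrow> f \<zero> = 0"
  using linear_functional_smult[of A f \<zero> 0] by simp

lemma (in cstar_algebra) linear_functional_finsum:
  assumes "linear_functional A f" "finite I" "g \<in> I \<rightarrow> carrier A"
  shows "f (\<Oplus>i\<in>I. g i) = (\<Sum>i\<in>I. f (g i))"
  using assms(2,3)
proof (induction I)
  case empty
  then show ?case by (simp add: linear_functional_zero[OF assms(1)])
next
  case (insert i I)
  then have "g i \<in> carrier A" "g \<in> I \<rightarrow> carrier A" by auto
  with insert show ?case
    by (simp add: linear_functional_add[OF assms(1)])
qed

text \<open>
  The field \<open>one\<close> of the record is unconstrained, so the unit is a separate parameter \<open>e\<close>.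
\<close>

locale unital_cstar_algebra = cstar_algebra +
  fixes e
  assumes unit_closed [simp, intro]: "e \<in> carrier A"
    and unit_left [simp]: "x \<in> carrier A \<Longrightarrow> e \<otimes> x = x"
    and unit_right [simp]: "x \<in> carrier A \<Longrightarrow> x \<otimes> e = x"
begin

lemma invol_unit [simp]: "invol A e = e"
proof -
  have "invol A e = invol A e \<otimes> e" by simp
  also have "\<dots> = invol A (invol A e \<otimes> e)"
    by (subst invol_mult) (simp_all add: invol_invol)
  also have "\<dots> = e" by (simp add: invol_invol)
  finally show ?thesis .
qed

lemma cnorm_unit_le: "cnorm A e \<le> 1"
proof -
  have "(cnorm A e)\<^sup>2 = cnorm A e"
    using cstar_identity[of e] by simp
  then show ?thesis by (auto simp: power2_eq_square)
qed

text \<open>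
  Positivity at \<open>x + c e\<close>, expanded. Varying the scalar \<open>c\<close> yields compatibility with the involution
  and the Cauchy--Schwarz inequality; \<open>c = -1\<close> yields boundedness.
\<close>

lemma positive_functional_shift:
  assumes f: "positive_functional A f" and x: "x \<in> carrier A"
  shows "f (invol A x \<otimes> x) + c * f (invol A x) + cnj c * f x + cnj c * c * f e \<in> \<real>\<^sub>\<ge>\<^sub>0"
proof -
  have lin: "linear_functional A f" using f by (simp add: positive_functional_def)
  let ?y = "x \<oplus> c \<odot> e"
  have "f (invol A ?y \<otimes> ?y) \<in> \<real>\<^sub>\<ge>\<^sub>0"
    using f x by (simp add: positive_functional_def)
  also have "f (invol A ?y \<otimes> ?y) = f (invol A x \<otimes> x) + c * f (invol A x) + cnj c * f x + cnj c * c * f e"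
    using x
    by (simp add: invol_add invol_smult mult_distrib_left mult_distrib_right smult_mult_left
        smult_mult_right linear_functional_add[OF lin] linear_functional_smult[OF lin] algebra_simps)
  finally show ?thesis .
qed

lemma positive_functional_unit: "positive_functional A f \<Longrightarrow> f e \<in> \<real>\<^sub>\<ge>\<^sub>0"
  unfolding positive_functional_def using unit_closed invol_unit unit_left by metis

text \<open>
  The expansion above has to be real for \<open>c = 1\<close> and for \<open>c = \<i>\<close>, which are two real linear equations for
  \<open>f(x\<^sup>*)\<close>.
\<close>

lemma positive_functional_invol:
  assumes f: "positive_functional A f" and x: "x \<in> carrier A"
  shows "f (invol A x) = cnj (f x)"
proof -
  have sq: "f (invol A x \<otimes> x) \<in> \<real>\<^sub>\<ge>\<^sub>0" using f x by (simp add: positive_functional_def)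
  have one: "f e \<in> \<real>\<^sub>\<ge>\<^sub>0" using f by (rule positive_functional_unit)
  show ?thesis
    using sq one positive_functional_shift[OF f x, of 1] positive_functional_shift[OF f x, of \<i>]
    by (auto simp: complex_nonneg_Reals_iff complex_eq_iff)
qed

lemma positive_functional_Cauchy_Schwarz:
  assumes f: "positive_functional A f" and x: "x \<in> carrier A"
  shows "(cmod (f x))\<^sup>2 \<le> Re (f e) * Re (f (invol A x \<otimes> x))"
proof -
  define p where "p = Re (f e)"
  define s where "s = Re (f (invol A x \<otimes> x))"
  define n where "n = (cmod (f x))\<^sup>2"
  have p: "f e = of_real p" "0 \<le> p"
    using positive_functional_unit[OF f] by (auto simp: p_def complex_nonneg_Reals_iff complex_eq_iff)
  have s: "f (invol A x \<otimes> x) = of_real s" "0 \<le> s"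
    using f x by (auto simp: positive_functional_def s_def complex_nonneg_Reals_iff complex_eq_iff)
  have n: "f x * cnj (f x) = of_real n"
    by (simp only: n_def complex_norm_square)
  \<comment> \<open>The quadratic in \<open>k\<close> obtained from \<open>x - k f(x) e\<close> is nonnegative.\<close>
  have quad: "0 \<le> s - 2 * k * n + k\<^sup>2 * n * p" for k :: real
  proof -
    have "f (invol A x \<otimes> x) + (- of_real k * f x) * f (invol A x) + cnj (- of_real k * f x) * f x
        + cnj (- of_real k * f x) * (- of_real k * f x) * f e \<in> \<real>\<^sub>\<ge>\<^sub>0"
      by (rule positive_functional_shift[OF f x])
    also have "f (invol A x \<otimes> x) + (- of_real k * f x) * f (invol A x) + cnj (- of_real k * f x) * f x
        + cnj (- of_real k * f x) * (- of_real k * f x) * f e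
        = of_real s - 2 * of_real k * (f x * cnj (f x)) + of_real k ^ 2 * (f x * cnj (f x)) * of_real p"
      by (simp add: positive_functional_invol[OF f x] p s algebra_simps power2_eq_square)
    also have "\<dots> = of_real (s - 2 * k * n + k\<^sup>2 * n * p)"
      by (simp add: n)
    finally show ?thesis by (simp only: nonneg_Reals_of_real_iff)
  qed
  have "n \<le> p * s"
  proof (cases "p = 0")
    case True
    \<comment> \<open>Now the quadratic is linear in \<open>k\<close>, hence negative for large \<open>k\<close> unless \<open>n = 0\<close>.\<close>
    have "n \<le> 0"
    proof (rule ccontr)
      assume "\<not> n \<le> 0"
      then show False
        using quad[of "(s + 1) / n"] True s(2) by simp
    qed
    with True show ?thesis by simp
  next
    case False
    have "p * (s - 2 * (1 / p) * n + (1 / p)\<^sup>2 * n * p) = p * s - n"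
      using False by (simp add: field_simps power2_eq_square)
    then show ?thesis
      using quad[of "1 / p"] p(2) by (metis diff_ge_0_iff_ge mult_nonneg_nonneg)
  qed
  then show ?thesis by (simp add: n_def p_def s_def)
qed


text \<open>
  A fixed point \<open>y\<close> of \<open>y \<mapsto> (h + y\<^sup>2)/2\<close> satisfies \<open>(1 - y)\<^sup>2 = 1 - h\<close>, so this provides a square root of
  \<open>1 - h\<close>. By \<open>y\<^sup>2 - z\<^sup>2 = y(y - z) + (y - z)z\<close> the map is a contraction with constant \<open>\<parallel>h\<parallel>\<close> on the
  selfadjoint elements of norm at most \<open>\<parallel>h\<parallel>\<close>.
\<close>

lemma square_root_fixed_point:
  assumes h: "h \<in> carrier A" "invol A h = h" "cnorm A h < 1"
  obtains y where "y \<in> carrier A" "invol A y = y" "y = (1/2) \<odot> (h \<oplus> y \<otimes> y)"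
proof -
  define k where "k = cnorm A h"
  define S where "S = {y \<in> carrier A. invol A y = y \<and> cnorm A y \<le> k}"
  define f where "f y = (1/2) \<odot> (h \<oplus> y \<otimes> y)" for y
  have k: "0 \<le> k" "k < 1" using h cnorm_nonneg by (auto simp: k_def)
  have "closedin (cstar_topology A) S"
  proof (rule closedinI)
    show "S \<subseteq> carrier A" by (auto simp: S_def)
    fix x assume x: "x \<in> carrier A" and approx: "\<And>\<epsilon>. 0 < \<epsilon> \<Longrightarrow> \<exists>y\<in>S. cnorm A (x \<ominus> y) < \<epsilon>"
    have "cnorm A x \<le> k + \<epsilon>" if e: "0 < \<epsilon>" for \<epsilon>
    proof -
      obtain y where "y \<in> S" "cnorm A (x \<ominus> y) < \<epsilon>" using approx[OF e] by blast
      then show ?thesis using cnorm_le_add_diff[OF x, of y] by (auto simp: S_def)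
    qed
    then have "cnorm A x \<le> k" by (rule field_le_epsilon)
    moreover have "cnorm A (invol A x \<ominus> x) \<le> 0 + \<epsilon>" if e: "0 < \<epsilon>" for \<epsilon>
    proof -
      obtain y where y: "y \<in> S" "cnorm A (x \<ominus> y) < \<epsilon> / 2" using approx[of "\<epsilon> / 2"] e by auto
      then have yc: "y \<in> carrier A" "invol A y = y" by (auto simp: S_def)
      have "cnorm A (invol A x \<ominus> y) = cnorm A (x \<ominus> y)"
        using cnorm_invol[of "x \<ominus> y"] x yc by (simp add: invol_minus)
      then show ?thesis
        using cnorm_minus_triangle[of "invol A x" y x] cnorm_minus_commute[of y x] x y yc by simp
    qed
    then have "cnorm A (invol A x \<ominus> x) \<le> 0" by (rule field_le_epsilon)
    then have "invol A x = x"
      using cnorm_minus_eq_0[of "invol A x" x] cnorm_nonneg[of "invol A x \<ominus> x"] x by simp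
    ultimately show "x \<in> S" using x by (simp add: S_def)
  qed
  moreover have "S \<noteq> {}" using h by (auto simp: S_def k_def)
  moreover have "f \<in> S \<rightarrow> S"
  proof
    fix y assume "y \<in> S"
    then have y: "y \<in> carrier A" "invol A y = y" "cnorm A y \<le> k" by (auto simp: S_def)
    have "cnorm A (y \<otimes> y) \<le> k * k"
      using cnorm_mult[OF y(1) y(1)] mult_mono[OF y(3) y(3)] cnorm_nonneg[OF y(1)] k by simp
    also have "\<dots> \<le> k" using k by (simp add: mult_left_le)
    finally have "cnorm A (h \<oplus> y \<otimes> y) \<le> k + k"
      using cnorm_triangle[of h "y \<otimes> y"] h y by (simp add: k_def)
    then show "f y \<in> S"
      using y h by (simp add: S_def f_def invol_smult invol_add invol_mult cnorm_smult)
  qed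
  moreover have "cnorm A (f x \<ominus> f y) \<le> k * cnorm A (x \<ominus> y)" if xy: "x \<in> S" "y \<in> S" for x y
  proof -
    have x: "x \<in> carrier A" "cnorm A x \<le> k" and y: "y \<in> carrier A" "cnorm A y \<le> k"
      using xy by (auto simp: S_def)
    have "f x \<ominus> f y = (1/2) \<odot> (x \<otimes> (x \<ominus> y) \<oplus> (x \<ominus> y) \<otimes> y)"
    proof -
      have "x \<otimes> (x \<ominus> y) \<oplus> (x \<ominus> y) \<otimes> y = (x \<otimes> x \<ominus> x \<otimes> y) \<oplus> (x \<otimes> y \<ominus> y \<otimes> y)"
        using x y by (simp add: mult_minus_left mult_minus_right)
      also have "\<dots> = x \<otimes> x \<oplus> \<ominus> (y \<otimes> y)"
        using x y by (simp add: a_minus_def M.a_assoc M.r_neg1)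
      also have "\<dots> = (h \<oplus> x \<otimes> x) \<ominus> (h \<oplus> y \<otimes> y)"
        using x y h by (simp add: a_minus_def M.minus_add M.a_ac M.r_neg1 M.r_neg2)
      finally have eq: "(h \<oplus> x \<otimes> x) \<ominus> (h \<oplus> y \<otimes> y) = x \<otimes> (x \<ominus> y) \<oplus> (x \<ominus> y) \<otimes> y" ..
      have "f x \<ominus> f y = (1/2) \<odot> ((h \<oplus> x \<otimes> x) \<ominus> (h \<oplus> y \<otimes> y))"
        using x y h by (simp add: f_def minus_eq_smult smult_add_right smult_smult)
      then show ?thesis by (simp only: eq)
    qed
    also have "cnorm A \<dots> \<le> (cnorm A (x \<otimes> (x \<ominus> y)) + cnorm A ((x \<ominus> y) \<otimes> y)) / 2"
      using x y cnorm_triangle[of "x \<otimes> (x \<ominus> y)" "(x \<ominus> y) \<otimes> y"] by (simp add: cnorm_smult)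
    also have "\<dots> \<le> (k * cnorm A (x \<ominus> y) + k * cnorm A (x \<ominus> y)) / 2"
    proof -
      have d: "x \<ominus> y \<in> carrier A" "0 \<le> cnorm A (x \<ominus> y)" using x y cnorm_nonneg by auto
      have "cnorm A (x \<otimes> (x \<ominus> y)) \<le> k * cnorm A (x \<ominus> y)"
        using cnorm_mult[OF x(1) d(1)] mult_right_mono[OF x(2) d(2)] by simp
      moreover have "cnorm A ((x \<ominus> y) \<otimes> y) \<le> k * cnorm A (x \<ominus> y)"
        using cnorm_mult[OF d(1) y(1)] mult_right_mono[OF y(2) d(2)] by (simp add: mult.commute)
      ultimately show ?thesis by simp
    qed
    finally show ?thesis by simp
  qed
  ultimately obtain y where "y \<in> S" "f y = y"
    using contraction_fixed_point[of S f k] k(2) by blast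
  then show thesis using that[of y] by (auto simp: S_def f_def)
qed

text \<open>
  With \<open>y\<close> as above, \<open>f(e) - f(h) = f((e - y)\<^sup>*(e - y)) \<ge> 0\<close>.
\<close>

lemma positive_functional_selfadjoint_bound:
  assumes f: "positive_functional A f" and h: "h \<in> carrier A" "invol A h = h" "cnorm A h < 1"
  shows "Re (f h) \<le> Re (f e)"
proof -
  have lin: "linear_functional A f" using f by (simp add: positive_functional_def)
  obtain y where y: "y \<in> carrier A" "invol A y = y" "y = (1/2) \<odot> (h \<oplus> y \<otimes> y)"
    using square_root_fixed_point[OF h] .
  have "f y = (f h + f (y \<otimes> y)) / 2"
    using arg_cong[OF y(3), of f] y(1) h
    by (simp add: linear_functional_add[OF lin] linear_functional_smult[OF lin])
  moreover have "f (invol A y \<otimes> y) + (-1) * f (invol A y) + cnj (-1) * f y + cnj (-1) * (-1) * f e \<in> \<real>\<^sub>\<ge>\<^sub>0"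
    by (rule positive_functional_shift[OF f y(1)])
  ultimately have "f e - f h \<in> \<real>\<^sub>\<ge>\<^sub>0" using y(2) by (simp add: field_simps)
  then show ?thesis by (simp add: complex_nonneg_Reals_iff)
qed

text \<open>
  Scaling into the open unit ball gives \<open>f(h) \<le> f(e)\<parallel>h\<parallel>\<close> for selfadjoint \<open>h\<close>, and Cauchy--Schwarz reduces
  the general case to \<open>h = x\<^sup>*x\<close>. Positivity is inherited by \<open>f \<circ> h\<close> for a star homomorphism \<open>h\<close>, and
  with it boundedness.
\<close>

lemma positive_functional_bounded:
  assumes f: "positive_functional A f"
  shows "bounded_functional A (Re (f e)) f"
proof -
  have lin: "linear_functional A f" using f by (simp add: positive_functional_def)
  have p: "0 \<le> Re (f e)"
    using positive_functional_unit[OF f] by (simp add: complex_nonneg_Reals_iff)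
  have sa: "Re (f h) \<le> Re (f e) * cnorm A h" if h: "h \<in> carrier A" "invol A h = h" for h
  proof (rule field_le_epsilon)
    fix \<epsilon> :: real assume "0 < \<epsilon>"
    define \<delta> where "\<delta> = \<epsilon> / (Re (f e) + 1)"
    have \<delta>: "0 < \<delta>" "Re (f e) * \<delta> \<le> \<epsilon>" using \<open>0 < \<epsilon>\<close> p by (auto simp: \<delta>_def field_simps)
    define c where "c = cnorm A h + \<delta>"
    have c: "0 < c" "cnorm A h < c" using \<delta> cnorm_nonneg[OF h(1)] by (auto simp: c_def)
    have "Re (f (of_real (1 / c) \<odot> h)) \<le> Re (f e)"
      using h c by (intro positive_functional_selfadjoint_bound[OF f])
        (auto simp: invol_smult cnorm_smult field_simps norm_divide)
    also have "f (of_real (1 / c) \<odot> h) = of_real (1 / c) * f h"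
      using h by (simp only: linear_functional_smult[OF lin])
    finally have "Re (f h) \<le> Re (f e) * c" using c by (simp add: field_simps)
    then show "Re (f h) \<le> Re (f e) * cnorm A h + \<epsilon>" using \<delta> by (simp add: c_def algebra_simps)
  qed
  have "cmod (f x) \<le> Re (f e) * cnorm A x" if x: "x \<in> carrier A" for x
  proof -
    have "(cmod (f x))\<^sup>2 \<le> Re (f e) * Re (f (invol A x \<otimes> x))"
      by (rule positive_functional_Cauchy_Schwarz[OF f x])
    also have "\<dots> \<le> Re (f e) * (Re (f e) * cnorm A (invol A x \<otimes> x))"
      using x p by (intro mult_left_mono sa) (auto simp: invol_mult invol_invol)
    also have "\<dots> = (Re (f e) * cnorm A x)\<^sup>2"
      using x by (simp add: cstar_identity power2_eq_square)
    finally show ?thesis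
      using p cnorm_nonneg[OF x] by (simp add: power2_le_iff_abs_le)
  qed
  then show ?thesis using lin p by (simp add: bounded_functional_def)
qed

lemma cstar_state_positive: "cstar_state A f \<Longrightarrow> positive_functional A f"
  by (simp add: cstar_state_def positive_functional_def linear_functional_def)

text \<open>
  The supremum of \<open>|f|\<close> over the unit ball is at most \<open>f(e)\<close> by the previous bound, and \<open>e\<close> lies in the
  unit ball.
\<close>

lemma cstar_state_unit:
  assumes f: "cstar_state A f"
  shows "f e = 1"
proof -
  have pos: "positive_functional A f" by (rule cstar_state_positive[OF f])
  define U where "U = {x \<in> carrier A. cnorm A x \<le> 1}"
  have sup: "(SUP x\<in>U. cmod (f x)) = 1" "bdd_above ((\<lambda>x. cmod (f x)) ` U)"
    using f by (simp_all add: cstar_state_def U_def)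
  have p: "f e = of_real (Re (f e))" "0 \<le> Re (f e)"
    using positive_functional_unit[OF pos] by (auto simp: complex_nonneg_Reals_iff complex_eq_iff)
  have e: "e \<in> U" using cnorm_unit_le by (simp add: U_def)
  have "cmod (f e) \<le> 1" using cSUP_upper[OF e sup(2)] sup(1) by simp
  moreover have "1 \<le> Re (f e)"
  proof -
    have "cmod (f x) \<le> Re (f e)" if "x \<in> U" for x
    proof -
      have "cmod (f x) \<le> Re (f e) * cnorm A x"
        using positive_functional_bounded[OF pos] that by (simp add: bounded_functional_def U_def)
      also have "\<dots> \<le> Re (f e) * 1" using that p(2) by (intro mult_left_mono) (auto simp: U_def)
      finally show ?thesis by simp
    qed
    then show ?thesis using cSUP_least[of U "\<lambda>x. cmod (f x)" "Re (f e)"] e sup(1) by fastforce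
  qed
  ultimately have "Re (f e) = 1" using complex_Re_le_cmod[of "f e"] by linarith
  then show ?thesis using p(1) by simp
qed

lemma cstar_stateI:
  assumes f: "positive_functional A f" "f e = 1" "f \<in> extensional (carrier A)"
  shows "cstar_state A f"
proof -
  define U where "U = {x \<in> carrier A. cnorm A x \<le> 1}"
  have le: "cmod (f x) \<le> 1" if "x \<in> U" for x
    using positive_functional_bounded[OF f(1)] f(2) that by (fastforce simp: bounded_functional_def U_def)
  have e: "e \<in> U" using cnorm_unit_le by (simp add: U_def)
  have bdd: "bdd_above ((\<lambda>x. cmod (f x)) ` U)" using le by (auto simp: bdd_above_def)
  have "(SUP x\<in>U. cmod (f x)) = 1"
  proof (rule antisym)
    show "(SUP x\<in>U. cmod (f x)) \<le> 1" using e le by (intro cSUP_least) auto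
    show "1 \<le> (SUP x\<in>U. cmod (f x))" using cSUP_upper[OF e bdd] f(2) by simp
  qed
  then show ?thesis
    using f bdd by (simp add: cstar_state_def positive_functional_def linear_functional_def U_def)
qed

end

lemma (in cstar_algebra) positive_functional_star_hom:
  assumes f: "positive_functional B f" and h: "star_hom A B h"
  shows "positive_functional A (\<lambda>x. f (h x))"
proof -
  have hc: "h x \<in> carrier B" if "x \<in> carrier A" for x using h that by (auto simp: star_hom_def)
  have "f (h (invol A x \<otimes> x)) \<in> \<real>\<^sub>\<ge>\<^sub>0" if "x \<in> carrier A" for x
  proof -
    have "h (invol A x \<otimes> x) = invol B (h x) \<otimes>\<^bsub>B\<^esub> h x"
      using h that by (simp add: star_hom_def)
    then show ?thesis using f hc[OF that] by (simp add: positive_functional_def)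
  qed
  then show ?thesis
    using f h hc by (simp add: positive_functional_def linear_functional_def star_hom_def)
qed

lemma (in cstar_algebra) positive_functional_sum:
  assumes f: "\<And>i. i \<in> I \<Longrightarrow> positive_functional A (f i)" and c: "\<And>i. i \<in> I \<Longrightarrow> 0 \<le> c i"
  shows "positive_functional A (\<lambda>x. \<Sum>i\<in>I. complex_of_real (c i) * f i x)"
proof -
  have "(\<Sum>i\<in>I. complex_of_real (c i) * f i (invol A x \<otimes> x)) \<in> \<real>\<^sub>\<ge>\<^sub>0" if "x \<in> carrier A" for x
    using f c that
    by (auto simp: positive_functional_def complex_nonneg_Reals_iff intro!: sum_nonneg sum.neutral)
  moreover have "linear_functional A (\<lambda>x. \<Sum>i\<in>I. complex_of_real (c i) * f i x)"
    using f by (simp add: positive_functional_def linear_functional_def sum.distrib[symmetric]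
        sum_distrib_left distrib_left mult.left_commute)
  ultimately show ?thesis by (simp add: positive_functional_def)
qed

section \<open>Combinatorics of 2-graphs\<close>

context two_graph
begin

lemma rng_in_vertices: "\<xi> \<in> paths \<Lambda> \<Longrightarrow> rng \<Lambda> \<xi> \<in> vertices \<Lambda>"
  by (simp add: vertices_def rng_closed deg_rng)

lemma src_in_vertices: "\<xi> \<in> paths \<Lambda> \<Longrightarrow> src \<Lambda> \<xi> \<in> vertices \<Lambda>"
  by (simp add: vertices_def src_closed deg_src)

text \<open>
  Both pairs factorise the same path, and their second components also have equal degrees.
\<close>

lemma pcomp_cancel:
  assumes "\<mu> \<in> paths \<Lambda>" "\<nu> \<in> paths \<Lambda>" "src \<Lambda> \<mu> = rng \<Lambda> \<nu>"
    and "\<mu>' \<in> paths \<Lambda>" "\<nu>' \<in> paths \<Lambda>" "src \<Lambda> \<mu>' = rng \<Lambda> \<nu>'"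
    and eq: "pcomp \<Lambda> \<mu> \<nu> = pcomp \<Lambda> \<mu>' \<nu>'" and deg: "deg \<Lambda> \<mu> = deg \<Lambda> \<mu>'"
  shows "\<mu> = \<mu>' \<and> \<nu> = \<nu>'"
proof -
  have d: "deg \<Lambda> (pcomp \<Lambda> \<mu> \<nu>) = deg \<Lambda> \<mu> + deg \<Lambda> \<nu>"
    "deg \<Lambda> (pcomp \<Lambda> \<mu>' \<nu>') = deg \<Lambda> \<mu>' + deg \<Lambda> \<nu>'"
    using assms(1-6) by (simp_all add: deg_pcomp)
  then have "deg \<Lambda> \<nu> = deg \<Lambda> \<nu>'" using eq deg by (metis add_left_cancel)
  moreover have "\<exists>!p. case p of (\<mu>'', \<nu>'') \<Rightarrow> \<mu>'' \<in> paths \<Lambda> \<and> \<nu>'' \<in> paths \<Lambda> \<and>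
      src \<Lambda> \<mu>'' = rng \<Lambda> \<nu>'' \<and> pcomp \<Lambda> \<mu> \<nu> = pcomp \<Lambda> \<mu>'' \<nu>'' \<and>
      deg \<Lambda> \<mu>'' = deg \<Lambda> \<mu> \<and> deg \<Lambda> \<nu>'' = deg \<Lambda> \<nu>"
    using assms d by (intro factorisation pcomp_closed)
  ultimately have "(\<mu>, \<nu>) = (\<mu>', \<nu>')"
    using assms by (elim ex1E) (metis (mono_tags, lifting) case_prod_conv)
  then show ?thesis by simp
qed

lemma factor:
  assumes "\<xi> \<in> paths \<Lambda>" "deg \<Lambda> \<xi> = m + n"
  obtains \<mu> \<nu> where "\<mu> \<in> paths \<Lambda>" "\<nu> \<in> paths \<Lambda>" "src \<Lambda> \<mu> = rng \<Lambda> \<nu>" "\<xi> = pcomp \<Lambda> \<mu> \<nu>"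
    "deg \<Lambda> \<mu> = m" "deg \<Lambda> \<nu> = n"
  using factorisation[OF assms] by (elim ex1E) (auto split: prod.splits)

lemma vertex_rng_src:
  assumes "z \<in> vertices \<Lambda>" shows "rng \<Lambda> z = z" "src \<Lambda> z = z"
proof -
  have z: "z \<in> paths \<Lambda>" "deg \<Lambda> z = 0" using assms by (auto simp: vertices_def)
  have "rng \<Lambda> z = z \<and> z = src \<Lambda> z"
    by (rule pcomp_cancel) (auto simp: z rng_closed src_closed src_rng rng_src pcomp_rng pcomp_src deg_rng)
  then show "rng \<Lambda> z = z" "src \<Lambda> z = z" by auto
qed

lemma deg_zero_eq: "\<xi> \<in> paths \<Lambda> \<Longrightarrow> deg \<Lambda> \<xi> = 0 \<Longrightarrow> \<xi> = rng \<Lambda> \<xi>"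
  using vertex_rng_src(1)[of \<xi>] by (simp add: vertices_def)

lemma deg_zero_eq_src: "\<xi> \<in> paths \<Lambda> \<Longrightarrow> deg \<Lambda> \<xi> = 0 \<Longrightarrow> \<xi> = src \<Lambda> \<xi>"
  using vertex_rng_src(2)[of \<xi>] by (simp add: vertices_def)

text \<open>
  The extending paths would have degree 0, hence be vertices.
\<close>

lemma min_ext_same_degree:
  assumes "\<mu> \<in> paths \<Lambda>" "\<nu> \<in> paths \<Lambda>" "deg \<Lambda> \<mu> = deg \<Lambda> \<nu>" "\<mu> \<noteq> \<nu>"
  shows "min_ext \<Lambda> \<mu> \<nu> = {}"
  using assms pcomp_cancel[of \<mu> _ \<nu>] by (fastforce simp: min_ext_def)

lemma paths_at_add_subset:
  "paths_at \<Lambda> z (m + n) \<subseteq>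
    (\<lambda>(\<mu>, \<nu>). pcomp \<Lambda> \<mu> \<nu>) ` (SIGMA \<mu>:paths_at \<Lambda> z m. paths_at \<Lambda> (src \<Lambda> \<mu>) n)"
proof
  fix \<xi> assume "\<xi> \<in> paths_at \<Lambda> z (m + n)"
  then have \<xi>: "\<xi> \<in> paths \<Lambda>" "deg \<Lambda> \<xi> = m + n" "rng \<Lambda> \<xi> = z" by (auto simp: paths_at_def)
  from factor[OF \<xi>(1,2)] obtain \<mu> \<nu> where "\<mu> \<in> paths \<Lambda>" "\<nu> \<in> paths \<Lambda>" "src \<Lambda> \<mu> = rng \<Lambda> \<nu>"
    "\<xi> = pcomp \<Lambda> \<mu> \<nu>" "deg \<Lambda> \<mu> = m" "deg \<Lambda> \<nu> = n" .
  then show "\<xi> \<in> (\<lambda>(\<mu>, \<nu>). pcomp \<Lambda> \<mu> \<nu>) ` (SIGMA \<mu>:paths_at \<Lambda> z m. paths_at \<Lambda> (src \<Lambda> \<mu>) n)"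
    using \<xi>(3) by (intro image_eqI[of _ _ "(\<mu>, \<nu>)"]) (auto simp: paths_at_def rng_pcomp)
qed

text \<open>
  The index sets of the expansions of \<open>t\<^sub>\<mu>t\<^sub>\<nu>\<^sup>*t\<^sub>\<rho>t\<^sub>\<tau>\<^sup>*\<close> and \<open>t\<^sub>\<rho>t\<^sub>\<tau>\<^sup>*t\<^sub>\<mu>t\<^sub>\<nu>\<^sup>*\<close>, restricted to
  the diagonal terms, are exchanged by swapping the pairs. The reason is that a common extension
  \<open>\<nu>\<alpha> = \<rho>\<beta>\<close> is minimal iff the degrees of \<open>\<alpha>\<close> and \<open>\<beta>\<close> have disjoint support, and this condition
  on \<open>\<alpha>\<close> and \<open>\<beta>\<close> also expresses minimality of \<open>\<tau>\<beta> = \<mu>\<alpha>\<close>.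
\<close>

lemma min_ext_swap:
  assumes paths: "\<mu> \<in> paths \<Lambda>" "\<nu> \<in> paths \<Lambda>" "\<rho> \<in> paths \<Lambda>" "\<tau> \<in> paths \<Lambda>"
    and src: "src \<Lambda> \<mu> = src \<Lambda> \<nu>" "src \<Lambda> \<rho> = src \<Lambda> \<tau>"
    and ab: "(\<alpha>, \<beta>) \<in> min_ext \<Lambda> \<nu> \<rho>" and eq: "pcomp \<Lambda> \<mu> \<alpha> = pcomp \<Lambda> \<tau> \<beta>"
  shows "(\<beta>, \<alpha>) \<in> min_ext \<Lambda> \<tau> \<mu>" "pcomp \<Lambda> \<rho> \<beta> = pcomp \<Lambda> \<nu> \<alpha>"
proof -
  have m: "\<alpha> \<in> paths \<Lambda>" "\<beta> \<in> paths \<Lambda>" "src \<Lambda> \<nu> = rng \<Lambda> \<alpha>" "src \<Lambda> \<rho> = rng \<Lambda> \<beta>"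
    "pcomp \<Lambda> \<nu> \<alpha> = pcomp \<Lambda> \<rho> \<beta>" "deg \<Lambda> (pcomp \<Lambda> \<nu> \<alpha>) = sup (deg \<Lambda> \<nu>) (deg \<Lambda> \<rho>)"
    using ab by (auto simp: min_ext_def)
  show "pcomp \<Lambda> \<rho> \<beta> = pcomp \<Lambda> \<nu> \<alpha>" using m by simp
  have "deg \<Lambda> \<nu> + deg \<Lambda> \<alpha> = sup (deg \<Lambda> \<nu>) (deg \<Lambda> \<rho>)" "deg \<Lambda> \<rho> + deg \<Lambda> \<beta> = sup (deg \<Lambda> \<nu>) (deg \<Lambda> \<rho>)"
    using m paths deg_pcomp[of \<nu> \<alpha>] deg_pcomp[of \<rho> \<beta>] by simp_all
  moreover have "deg \<Lambda> \<mu> + deg \<Lambda> \<alpha> = deg \<Lambda> \<tau> + deg \<Lambda> \<beta>"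
    using m paths src eq deg_pcomp[of \<mu> \<alpha>] deg_pcomp[of \<tau> \<beta>] by simp
  ultimately have "deg \<Lambda> \<tau> + deg \<Lambda> \<beta> = sup (deg \<Lambda> \<tau>) (deg \<Lambda> \<mu>)"
    by (auto simp: prod_eq_iff sup_nat_def max_def split: if_splits)
  moreover have "rng \<Lambda> \<tau> = rng \<Lambda> \<mu>"
    using m paths src eq rng_pcomp[of \<mu> \<alpha>] rng_pcomp[of \<tau> \<beta>] by simp
  ultimately show "(\<beta>, \<alpha>) \<in> min_ext \<Lambda> \<tau> \<mu>"
    using m paths src eq by (simp add: min_ext_def deg_pcomp)
qed

lemma min_ext_src:
  assumes p: "\<mu> \<in> paths \<Lambda>" "\<nu> \<in> paths \<Lambda>" "\<rho> \<in> paths \<Lambda>" "\<tau> \<in> paths \<Lambda>"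
    and s: "src \<Lambda> \<mu> = src \<Lambda> \<nu>" "src \<Lambda> \<rho> = src \<Lambda> \<tau>"
    and q: "(\<alpha>, \<beta>) \<in> min_ext \<Lambda> \<nu> \<rho>"
  shows "\<alpha> \<in> paths \<Lambda>" "\<beta> \<in> paths \<Lambda>" "src \<Lambda> \<mu> = rng \<Lambda> \<alpha>" "src \<Lambda> \<tau> = rng \<Lambda> \<beta>" "src \<Lambda> \<alpha> = src \<Lambda> \<beta>"
    "pcomp \<Lambda> \<mu> \<alpha> \<in> paths \<Lambda>" "pcomp \<Lambda> \<tau> \<beta> \<in> paths \<Lambda>"
    "src \<Lambda> (pcomp \<Lambda> \<mu> \<alpha>) = src \<Lambda> \<alpha>" "src \<Lambda> (pcomp \<Lambda> \<tau> \<beta>) = src \<Lambda> \<beta>"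
proof -
  have c: "\<alpha> \<in> paths \<Lambda>" "\<beta> \<in> paths \<Lambda>" "src \<Lambda> \<nu> = rng \<Lambda> \<alpha>" "src \<Lambda> \<rho> = rng \<Lambda> \<beta>"
    "pcomp \<Lambda> \<nu> \<alpha> = pcomp \<Lambda> \<rho> \<beta>"
    using q by (auto simp: min_ext_def)
  then show "\<alpha> \<in> paths \<Lambda>" "\<beta> \<in> paths \<Lambda>" "src \<Lambda> \<mu> = rng \<Lambda> \<alpha>" "src \<Lambda> \<tau> = rng \<Lambda> \<beta>" using s by simp_all
  show "src \<Lambda> \<alpha> = src \<Lambda> \<beta>"
    using c p src_pcomp[of \<nu> \<alpha>] src_pcomp[of \<rho> \<beta>] by simp
  show "pcomp \<Lambda> \<mu> \<alpha> \<in> paths \<Lambda>" "pcomp \<Lambda> \<tau> \<beta> \<in> paths \<Lambda>"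
    "src \<Lambda> (pcomp \<Lambda> \<mu> \<alpha>) = src \<Lambda> \<alpha>" "src \<Lambda> (pcomp \<Lambda> \<tau> \<beta>) = src \<Lambda> \<beta>"
    using c p s by (simp_all add: pcomp_closed src_pcomp)
qed

text \<open>
  The paths with source outside \<open>V\<close> are closed under factorisation: the hypothesis, applied to the
  second factor, keeps the source of the first factor outside \<open>V\<close>.
\<close>

lemma two_graph_graph_minus:
  assumes her: "\<And>\<xi>. \<xi> \<in> paths \<Lambda> \<Longrightarrow> src \<Lambda> \<xi> \<notin> V \<Longrightarrow> rng \<Lambda> \<xi> \<notin> V"
  shows "two_graph (graph_minus \<Lambda> V)"
proof -
  have sel: "paths (graph_minus \<Lambda> V) = {\<mu> \<in> paths \<Lambda>. src \<Lambda> \<mu> \<notin> V}" "rng (graph_minus \<Lambda> V) = rng \<Lambda>"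
    "src (graph_minus \<Lambda> V) = src \<Lambda>" "pcomp (graph_minus \<Lambda> V) = pcomp \<Lambda>" "deg (graph_minus \<Lambda> V) = deg \<Lambda>"
    by (simp_all add: graph_minus_def)
  show ?thesis
  proof (unfold_locales, unfold sel)
    show "countable {\<mu> \<in> paths \<Lambda>. src \<Lambda> \<mu> \<notin> V}"
      by (rule countable_subset[OF _ countable_paths]) auto
    fix \<xi> m n assume \<xi>: "\<xi> \<in> {\<mu> \<in> paths \<Lambda>. src \<Lambda> \<mu> \<notin> V}" "deg \<Lambda> \<xi> = m + n"
    have "(case p of (\<mu>, \<nu>) \<Rightarrow> \<mu> \<in> {\<mu> \<in> paths \<Lambda>. src \<Lambda> \<mu> \<notin> V} \<and> \<nu> \<in> {\<mu> \<in> paths \<Lambda>. src \<Lambda> \<mu> \<notin> V} \<and>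
        src \<Lambda> \<mu> = rng \<Lambda> \<nu> \<and> \<xi> = pcomp \<Lambda> \<mu> \<nu> \<and> deg \<Lambda> \<mu> = m \<and> deg \<Lambda> \<nu> = n) \<longleftrightarrow>
      (case p of (\<mu>, \<nu>) \<Rightarrow> \<mu> \<in> paths \<Lambda> \<and> \<nu> \<in> paths \<Lambda> \<and>
        src \<Lambda> \<mu> = rng \<Lambda> \<nu> \<and> \<xi> = pcomp \<Lambda> \<mu> \<nu> \<and> deg \<Lambda> \<mu> = m \<and> deg \<Lambda> \<nu> = n)" for p
      using \<xi> her by (auto simp: src_pcomp split: prod.splits)
    then show "\<exists>!p. case p of (\<mu>, \<nu>) \<Rightarrow> \<mu> \<in> {\<mu> \<in> paths \<Lambda>. src \<Lambda> \<mu> \<notin> V} \<and> \<nu> \<in> {\<mu> \<in> paths \<Lambda>. src \<Lambda> \<mu> \<notin> V} \<and>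
        src \<Lambda> \<mu> = rng \<Lambda> \<nu> \<and> \<xi> = pcomp \<Lambda> \<mu> \<nu> \<and> deg \<Lambda> \<mu> = m \<and> deg \<Lambda> \<nu> = n"
      using factorisation[of \<xi> m n] \<xi> by simp
  qed (auto simp: rng_closed src_closed rng_rng src_rng rng_src src_src pcomp_closed rng_pcomp
      src_pcomp pcomp_assoc pcomp_rng pcomp_src deg_rng deg_src deg_pcomp her)
qed

end

locale finite_two_graph = two_graph +
  assumes finite_vertices: "finite (vertices \<Lambda>)"
    and finite_edges1: "finite (paths_at \<Lambda> z e1)"
    and finite_edges2: "finite (paths_at \<Lambda> z e2)"
begin

lemma finite_paths_at: "finite (paths_at \<Lambda> z n)"
proof -
  have add: "finite (paths_at \<Lambda> z (m + n))" if "\<And>z. finite (paths_at \<Lambda> z m)" "\<And>z. finite (paths_at \<Lambda> z n)"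
    for z m n
    using that by (intro finite_subset[OF paths_at_add_subset]) auto
  have zero: "finite (paths_at \<Lambda> z 0)" for z
    by (rule finite_subset[OF _ finite_vertices]) (auto simp: paths_at_def vertices_def)
  have "finite (paths_at \<Lambda> z (i, 0))" for z i
  proof (induction i arbitrary: z)
    case 0
    then show ?case using zero by (simp add: zero_prod_def)
  next
    case (Suc i)
    then show ?case using add[of "(i, 0)" e1 z] finite_edges1 by simp
  qed
  moreover have "finite (paths_at \<Lambda> z (0, j))" for z j
  proof (induction j arbitrary: z)
    case 0
    then show ?case using zero by (simp add: zero_prod_def)
  next
    case (Suc j)
    then show ?case using add[of "(0, j)" e2 z] finite_edges2 by simp
  qed
  ultimately show ?thesis using add[of "(fst n, 0)" "(0, snd n)" z] by simp
qed

lemma finite_min_ext: "finite (min_ext \<Lambda> \<mu> \<nu>)" if "\<mu> \<in> paths \<Lambda>" "\<nu> \<in> paths \<Lambda>"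
proof -
  let ?s = "sup (deg \<Lambda> \<mu>) (deg \<Lambda> \<nu>)"
  have "min_ext \<Lambda> \<mu> \<nu> \<subseteq> paths_at \<Lambda> (src \<Lambda> \<mu>) (?s - deg \<Lambda> \<mu>) \<times> paths_at \<Lambda> (src \<Lambda> \<nu>) (?s - deg \<Lambda> \<nu>)"
  proof (clarsimp simp: min_ext_def)
    fix \<alpha> \<beta> assume h: "\<alpha> \<in> paths \<Lambda>" "\<beta> \<in> paths \<Lambda>" "src \<Lambda> \<mu> = rng \<Lambda> \<alpha>" "src \<Lambda> \<nu> = rng \<Lambda> \<beta>"
      "pcomp \<Lambda> \<mu> \<alpha> = pcomp \<Lambda> \<nu> \<beta>" "deg \<Lambda> (pcomp \<Lambda> \<nu> \<beta>) = ?s"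
    then have "deg \<Lambda> \<mu> + deg \<Lambda> \<alpha> = ?s" "deg \<Lambda> \<nu> + deg \<Lambda> \<beta> = ?s"
      using that deg_pcomp[of \<mu> \<alpha>] deg_pcomp[of \<nu> \<beta>] by simp_all
    then have "deg \<Lambda> \<alpha> = ?s - deg \<Lambda> \<mu>" "deg \<Lambda> \<beta> = ?s - deg \<Lambda> \<nu>"
      by (metis add_diff_cancel_left')+
    with h show "\<alpha> \<in> paths_at \<Lambda> (rng \<Lambda> \<alpha>) (?s - deg \<Lambda> \<mu>) \<and> \<beta> \<in> paths_at \<Lambda> (rng \<Lambda> \<beta>) (?s - deg \<Lambda> \<nu>)"
      by (simp add: paths_at_def)
  qed
  then show ?thesis by (rule finite_subset) (intro finite_cartesian_product finite_paths_at)
qed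

end

text \<open>In a graph with a single vertex all paths are composable.\<close>

locale one_vertex_two_graph = finite_two_graph +
  fixes u
  assumes one_vertex: "vertices \<Lambda> = {u}"
begin

lemma rng_eq: "\<xi> \<in> paths \<Lambda> \<Longrightarrow> rng \<Lambda> \<xi> = u"
  using rng_in_vertices[of \<xi>] one_vertex by auto

lemma src_eq: "\<xi> \<in> paths \<Lambda> \<Longrightarrow> src \<Lambda> \<xi> = u"
  using src_in_vertices[of \<xi>] one_vertex by auto

lemma card_extensions:
  assumes "\<mu> \<in> paths \<Lambda>"
  shows "card (pcomp \<Lambda> \<mu> ` paths_at \<Lambda> u n) = card (paths_at \<Lambda> u n)"
proof (rule card_image, rule inj_onI)
  fix \<alpha> \<beta> assume "\<alpha> \<in> paths_at \<Lambda> u n" "\<beta> \<in> paths_at \<Lambda> u n" "pcomp \<Lambda> \<mu> \<alpha> = pcomp \<Lambda> \<mu> \<beta>"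
  then show "\<alpha> = \<beta>"
    using pcomp_cancel[of \<mu> \<alpha> \<mu> \<beta>] assms by (auto simp: paths_at_def src_eq)
qed

text \<open>
  Composition is a bijection from pairs of paths, by unique factorisation.
\<close>

lemma card_paths_at_add:
  "card (paths_at \<Lambda> u (m + n)) = card (paths_at \<Lambda> u m) * card (paths_at \<Lambda> u n)"
proof -
  have "bij_betw (\<lambda>(\<mu>, \<nu>). pcomp \<Lambda> \<mu> \<nu>) (paths_at \<Lambda> u m \<times> paths_at \<Lambda> u n) (paths_at \<Lambda> u (m + n))"
    unfolding bij_betw_def
  proof
    show "inj_on (\<lambda>(\<mu>, \<nu>). pcomp \<Lambda> \<mu> \<nu>) (paths_at \<Lambda> u m \<times> paths_at \<Lambda> u n)"
    proof (rule inj_onI, clarsimp simp: paths_at_def)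
      fix \<mu> \<nu> \<mu>' \<nu>'
      assume "\<mu> \<in> paths \<Lambda>" "\<nu> \<in> paths \<Lambda>" "\<mu>' \<in> paths \<Lambda>" "\<nu>' \<in> paths \<Lambda>"
        "pcomp \<Lambda> \<mu> \<nu> = pcomp \<Lambda> \<mu>' \<nu>'" "deg \<Lambda> \<mu>' = deg \<Lambda> \<mu>"
      then show "\<mu> = \<mu>' \<and> \<nu> = \<nu>'" by (intro pcomp_cancel) (simp_all add: src_eq rng_eq)
    qed
    show "(\<lambda>(\<mu>, \<nu>). pcomp \<Lambda> \<mu> \<nu>) ` (paths_at \<Lambda> u m \<times> paths_at \<Lambda> u n) = paths_at \<Lambda> u (m + n)"
    proof
      show "(\<lambda>(\<mu>, \<nu>). pcomp \<Lambda> \<mu> \<nu>) ` (paths_at \<Lambda> u m \<times> paths_at \<Lambda> u n) \<subseteq> paths_at \<Lambda> u (m + n)"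
        by (auto simp: paths_at_def pcomp_closed deg_pcomp rng_pcomp src_eq rng_eq)
      show "paths_at \<Lambda> u (m + n) \<subseteq> (\<lambda>(\<mu>, \<nu>). pcomp \<Lambda> \<mu> \<nu>) ` (paths_at \<Lambda> u m \<times> paths_at \<Lambda> u n)"
        using paths_at_add_subset[of u m n] by (force simp: paths_at_def src_eq)
    qed
  qed
  then have "card (paths_at \<Lambda> u m \<times> paths_at \<Lambda> u n) = card (paths_at \<Lambda> u (m + n))"
    by (rule bij_betw_same_card)
  then show ?thesis by (simp add: card_cartesian_product)
qed

lemma card_paths_at_zero: "card (paths_at \<Lambda> u 0) = 1"
proof -
  have "paths_at \<Lambda> u 0 = vertices \<Lambda>"
    by (auto simp: paths_at_def vertices_def rng_eq)
  then show ?thesis by (simp add: one_vertex)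
qed

lemma card_paths_at:
  "card (paths_at \<Lambda> u (i, j)) = card (paths_at \<Lambda> u e1) ^ i * card (paths_at \<Lambda> u e2) ^ j"
proof -
  have "card (paths_at \<Lambda> u (i, 0)) = card (paths_at \<Lambda> u e1) ^ i"
  proof (induction i)
    case (Suc i)
    then show ?case using card_paths_at_add[of e1 "(i, 0)"] by simp
  qed (use card_paths_at_zero in \<open>simp add: zero_prod_def\<close>)
  moreover have "card (paths_at \<Lambda> u (0, j)) = card (paths_at \<Lambda> u e2) ^ j"
  proof (induction j)
    case (Suc j)
    then show ?case using card_paths_at_add[of e2 "(0, j)"] by simp
  qed (use card_paths_at_zero in \<open>simp add: zero_prod_def\<close>)
  ultimately show ?thesis using card_paths_at_add[of "(i, 0)" "(0, j)"] by simp
qed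

end

text \<open>
  A path with source \<open>u\<close> is a composite of edges, and an edge with source \<open>u\<close> is a
  loop; induction on the length peels off the last edge.
\<close>

lemma (in two_graph) rng_eq_if_src_eq:
  assumes edges: "\<And>z. z \<noteq> u \<Longrightarrow> paths_between \<Lambda> z e1 u = {}" "\<And>z. z \<noteq> u \<Longrightarrow> paths_between \<Lambda> z e2 u = {}"
    and \<xi>: "\<xi> \<in> paths \<Lambda>" "src \<Lambda> \<xi> = u"
  shows "rng \<Lambda> \<xi> = u"
  using \<xi>
proof (induction "fst (deg \<Lambda> \<xi>) + snd (deg \<Lambda> \<xi>)" arbitrary: \<xi>)
  case 0
  then have "deg \<Lambda> \<xi> = 0" by (simp add: prod_eq_iff)
  then have "rng \<Lambda> \<xi> = src \<Lambda> \<xi>" using 0 deg_zero_eq[of \<xi>] deg_zero_eq_src[of \<xi>] by simp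
  with 0 show ?case by simp
next
  case (Suc n)
  \<comment> \<open>The truncated subtraction is harmless: the total degree is positive, so the second coordinate
    is positive when the first one is 0.\<close>
  obtain e m where e: "e = e1 \<or> e = e2" "deg \<Lambda> \<xi> = m + e"
  proof (cases "fst (deg \<Lambda> \<xi>)")
    case 0
    then have "deg \<Lambda> \<xi> = (0, snd (deg \<Lambda> \<xi>) - 1) + e2" using Suc(2) by (simp add: prod_eq_iff)
    then show ?thesis using that by blast
  next
    case (Suc k)
    then have "deg \<Lambda> \<xi> = (k, snd (deg \<Lambda> \<xi>)) + e1" by (simp add: prod_eq_iff)
    then show ?thesis using that by blast
  qed
  from factor[OF Suc(3) e(2)] obtain \<mu> \<nu> where f: "\<mu> \<in> paths \<Lambda>" "\<nu> \<in> paths \<Lambda>" "src \<Lambda> \<mu> = rng \<Lambda> \<nu>"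
    "\<xi> = pcomp \<Lambda> \<mu> \<nu>" "deg \<Lambda> \<mu> = m" "deg \<Lambda> \<nu> = e" .
  have "src \<Lambda> \<nu> = u" using f Suc(4) by (simp add: src_pcomp)
  then have "\<nu> \<in> paths_between \<Lambda> (rng \<Lambda> \<nu>) e u"
    using f by (simp add: paths_between_def paths_at_def)
  then have "src \<Lambda> \<mu> = u" using edges e f by fastforce
  moreover have "n = fst (deg \<Lambda> \<mu>) + snd (deg \<Lambda> \<mu>)" using Suc(2) e f by auto
  ultimately have "rng \<Lambda> \<mu> = u" using Suc(1)[of \<mu>] f by simp
  then show ?case using f by (simp add: rng_pcomp)
qed

section \<open>Toeplitz algebras\<close>

lemma (in cstar_algebra) finsum_mult_right:
  assumes "finite I" "g \<in> I \<rightarrow> carrier A" "x \<in> carrier A"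
  shows "x \<otimes> (\<Oplus>i\<in>I. g i) = (\<Oplus>i\<in>I. x \<otimes> g i)"
  using assms
proof (induction I)
  case (insert i I)
  then have "g i \<in> carrier A" "g \<in> I \<rightarrow> carrier A" "(\<lambda>i. x \<otimes> g i) \<in> I \<rightarrow> carrier A" by auto
  with insert show ?case by (simp add: mult_distrib_left)
qed simp

lemma (in cstar_algebra) finsum_mult_left:
  assumes "finite I" "g \<in> I \<rightarrow> carrier A" "x \<in> carrier A"
  shows "(\<Oplus>i\<in>I. g i) \<otimes> x = (\<Oplus>i\<in>I. g i \<otimes> x)"
  using assms
proof (induction I)
  case (insert i I)
  then have "g i \<in> carrier A" "g \<in> I \<rightarrow> carrier A" "(\<lambda>i. g i \<otimes> x) \<in> I \<rightarrow> carrier A" by auto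
  with insert show ?case by (simp add: mult_distrib_right)
qed simp

lemma (in cstar_algebra) invol_finsum:
  assumes "finite I" "g \<in> I \<rightarrow> carrier A"
  shows "invol A (\<Oplus>i\<in>I. g i) = (\<Oplus>i\<in>I. invol A (g i))"
  using assms
proof (induction I)
  case (insert i I)
  then have "g i \<in> carrier A" "g \<in> I \<rightarrow> carrier A" "(\<lambda>i. invol A (g i)) \<in> I \<rightarrow> carrier A" by auto
  with insert show ?case by (simp add: invol_add)
qed simp

lemma (in cstar_algebra) bounded_functional_mult_right:
  assumes "bounded_functional A K f" "y \<in> carrier A"
  shows "bounded_functional A (K * cnorm A y) (\<lambda>x. f (x \<otimes> y))"
proof -
  have f: "linear_functional A f" "0 \<le> K" "\<And>x. x \<in> carrier A \<Longrightarrow> cmod (f x) \<le> K * cnorm A x"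
    using assms by (auto simp: bounded_functional_def)
  have "cmod (f (x \<otimes> y)) \<le> K * cnorm A y * cnorm A x" if "x \<in> carrier A" for x
  proof -
    have "cmod (f (x \<otimes> y)) \<le> K * cnorm A (x \<otimes> y)" using f assms(2) that by simp
    also have "\<dots> \<le> K * (cnorm A x * cnorm A y)"
      using f assms(2) that by (intro mult_left_mono cnorm_mult)
    finally show ?thesis by (simp add: mult_ac)
  qed
  then show ?thesis
    using f assms(2) cnorm_nonneg[OF assms(2)]
    by (simp add: bounded_functional_def linear_functional_def mult_distrib_right smult_mult_left)
qed

lemma (in cstar_algebra) bounded_functional_mult_left:
  assumes "bounded_functional A K f" "y \<in> carrier A"
  shows "bounded_functional A (K * cnorm A y) (\<lambda>x. f (y \<otimes> x))"
proof -
  have f: "linear_functional A f" "0 \<le> K" "\<And>x. x \<in> carrier A \<Longrightarrow> cmod (f x) \<le> K * cnorm A x"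
    using assms by (auto simp: bounded_functional_def)
  have "cmod (f (y \<otimes> x)) \<le> K * cnorm A y * cnorm A x" if "x \<in> carrier A" for x
  proof -
    have "cmod (f (y \<otimes> x)) \<le> K * cnorm A (y \<otimes> x)" using f assms(2) that by simp
    also have "\<dots> \<le> K * (cnorm A y * cnorm A x)"
      using f assms(2) that by (intro mult_left_mono cnorm_mult)
    finally show ?thesis by (simp add: mult_ac)
  qed
  then show ?thesis
    using f assms(2) cnorm_nonneg[OF assms(2)]
    by (simp add: bounded_functional_def linear_functional_def mult_distrib_left smult_mult_right)
qed

lemma (in cstar_algebra) bounded_functional_scale:
  assumes "bounded_functional A K f"
  shows "bounded_functional A (cmod c * K) (\<lambda>x. c * f x)"
  using assms unfolding bounded_functional_def linear_functional_def
  by (auto simp: norm_mult mult.assoc distrib_left intro!: mult_left_mono)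

lemma (in cstar_algebra) bounded_functional_cnj_invol:
  assumes "bounded_functional A K f"
  shows "bounded_functional A K (\<lambda>x. cnj (f (invol A x)))"
  using assms unfolding bounded_functional_def linear_functional_def
  by (auto simp: invol_add invol_smult) (metis cnorm_invol invol_closed)

lemma convergent_cnj: "convergent f \<Longrightarrow> convergent (\<lambda>n. cnj (f n))"
  unfolding convergent_def using tendsto_cnj by blast

locale toeplitz = finite_two_graph \<Lambda> + cstar_algebra A
  for \<Lambda> :: "'p pregraph" and A :: "'a cstar" (structure) +
  fixes t :: "'p \<Rightarrow> 'a"
  assumes family: "toeplitz_family \<Lambda> A t"
    and generated: "\<lbrakk>cstar_subalgebra A S; t ` paths \<Lambda> \<subseteq> S\<rbrakk> \<Longrightarrow> S = carrier A"
begin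

lemma t_closed [simp, intro]: "\<xi> \<in> paths \<Lambda> \<Longrightarrow> t \<xi> \<in> carrier A"
  using family by (simp add: toeplitz_family_def)

lemma vertex_path: "z \<in> vertices \<Lambda> \<Longrightarrow> z \<in> paths \<Lambda>"
  by (simp add: vertices_def)

lemma invol_t_vertex: "z \<in> vertices \<Lambda> \<Longrightarrow> invol A (t z) = t z"
  using family by (simp add: toeplitz_family_def)

lemma t_vertices_orthogonal:
  "\<lbrakk>y \<in> vertices \<Lambda>; z \<in> vertices \<Lambda>; y \<noteq> z\<rbrakk> \<Longrightarrow> t y \<otimes> t z = \<zero>"
  using family by (simp add: toeplitz_family_def)

lemma t_mult:
  "\<lbrakk>\<xi> \<in> paths \<Lambda>; \<mu> \<in> paths \<Lambda>; src \<Lambda> \<xi> = rng \<Lambda> \<mu>\<rbrakk> \<Longrightarrow> t \<xi> \<otimes> t \<mu> = t (pcomp \<Lambda> \<xi> \<mu>)"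
  using family by (simp add: toeplitz_family_def)

lemma invol_t_mult_t: "\<xi> \<in> paths \<Lambda> \<Longrightarrow> invol A (t \<xi>) \<otimes> t \<xi> = t (src \<Lambda> \<xi>)"
  using family by (simp add: toeplitz_family_def)

lemma toeplitz_inequality:
  "z \<in> vertices \<Lambda> \<Longrightarrow> cstar_le A (\<Oplus>\<xi>\<in>paths_at \<Lambda> z n. t \<xi> \<otimes> invol A (t \<xi>)) (t z)"
  using family by (cases n) (simp add: toeplitz_family_def)

lemma invol_t_mult:
  "\<lbrakk>\<mu> \<in> paths \<Lambda>; \<nu> \<in> paths \<Lambda>\<rbrakk> \<Longrightarrow> invol A (t \<mu>) \<otimes> t \<nu> =
    (\<Oplus>p\<in>min_ext \<Lambda> \<mu> \<nu>. t (fst p) \<otimes> invol A (t (snd p)))"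
  using family by (simp add: toeplitz_family_def)

lemma t_rng_mult: "\<mu> \<in> paths \<Lambda> \<Longrightarrow> t (rng \<Lambda> \<mu>) \<otimes> t \<mu> = t \<mu>"
  using t_mult[of "rng \<Lambda> \<mu>" \<mu>] by (simp add: rng_closed src_rng pcomp_rng)

lemma t_mult_src: "\<mu> \<in> paths \<Lambda> \<Longrightarrow> t \<mu> \<otimes> t (src \<Lambda> \<mu>) = t \<mu>"
  using t_mult[of \<mu> "src \<Lambda> \<mu>"] by (simp add: src_closed rng_src pcomp_src)

definition gen :: "'p \<Rightarrow> 'p \<Rightarrow> 'a" where
  "gen \<mu> \<nu> = t \<mu> \<otimes> invol A (t \<nu>)"

lemma gen_closed [simp, intro]: "\<lbrakk>\<mu> \<in> paths \<Lambda>; \<nu> \<in> paths \<Lambda>\<rbrakk> \<Longrightarrow> gen \<mu> \<nu> \<in> carrier A"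
  by (simp add: gen_def)

lemma gen_src: "\<mu> \<in> paths \<Lambda> \<Longrightarrow> gen \<mu> (src \<Lambda> \<mu>) = t \<mu>"
  by (simp add: gen_def invol_t_vertex src_in_vertices t_mult_src)

lemma gen_src_left: "\<mu> \<in> paths \<Lambda> \<Longrightarrow> gen (src \<Lambda> \<mu>) \<mu> = invol A (t \<mu>)"
proof -
  assume \<mu>: "\<mu> \<in> paths \<Lambda>"
  have "invol A (t \<mu> \<otimes> t (src \<Lambda> \<mu>)) = gen (src \<Lambda> \<mu>) \<mu>"
    using \<mu> by (simp add: gen_def invol_mult src_closed invol_t_vertex src_in_vertices)
  then show ?thesis using \<mu> by (simp add: t_mult_src)
qed

lemma invol_gen: "\<lbrakk>\<mu> \<in> paths \<Lambda>; \<nu> \<in> paths \<Lambda>\<rbrakk> \<Longrightarrow> invol A (gen \<mu> \<nu>) = gen \<nu> \<mu>"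
  by (simp add: gen_def invol_mult invol_invol)

text \<open>
  By (T5) a product of spanning elements is a sum of spanning elements; together with \<open>invol_gen\<close> this
  shows that they span a *-algebra.
\<close>

lemma gen_mult:
  assumes p: "\<mu> \<in> paths \<Lambda>" "\<nu> \<in> paths \<Lambda>" "\<rho> \<in> paths \<Lambda>" "\<tau> \<in> paths \<Lambda>"
    and s: "src \<Lambda> \<mu> = src \<Lambda> \<nu>" "src \<Lambda> \<rho> = src \<Lambda> \<tau>"
  shows "gen \<mu> \<nu> \<otimes> gen \<rho> \<tau> =
    (\<Oplus>p\<in>min_ext \<Lambda> \<nu> \<rho>. gen (pcomp \<Lambda> \<mu> (fst p)) (pcomp \<Lambda> \<tau> (snd p)))"
proof -
  have m: "fst p \<in> paths \<Lambda>" "snd p \<in> paths \<Lambda>" "src \<Lambda> \<mu> = rng \<Lambda> (fst p)" "src \<Lambda> \<tau> = rng \<Lambda> (snd p)"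
    if "p \<in> min_ext \<Lambda> \<nu> \<rho>" for p
    using that s by (auto simp: min_ext_def)
  have "gen \<mu> \<nu> \<otimes> gen \<rho> \<tau> = (t \<mu> \<otimes> (invol A (t \<nu>) \<otimes> t \<rho>)) \<otimes> invol A (t \<tau>)"
    using p by (simp add: gen_def mult_assoc)
  also have "\<dots> = (t \<mu> \<otimes> (\<Oplus>p\<in>min_ext \<Lambda> \<nu> \<rho>. t (fst p) \<otimes> invol A (t (snd p)))) \<otimes> invol A (t \<tau>)"
    using p by (simp add: invol_t_mult)
  also have "\<dots> = (\<Oplus>p\<in>min_ext \<Lambda> \<nu> \<rho>. t \<mu> \<otimes> (t (fst p) \<otimes> invol A (t (snd p)))) \<otimes> invol A (t \<tau>)"
    using p m finite_min_ext by (subst finsum_mult_right) auto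
  also have "\<dots> = (\<Oplus>p\<in>min_ext \<Lambda> \<nu> \<rho>. (t \<mu> \<otimes> (t (fst p) \<otimes> invol A (t (snd p)))) \<otimes> invol A (t \<tau>))"
    using p m finite_min_ext by (subst finsum_mult_left) auto
  also have "\<dots> = (\<Oplus>p\<in>min_ext \<Lambda> \<nu> \<rho>. gen (pcomp \<Lambda> \<mu> (fst p)) (pcomp \<Lambda> \<tau> (snd p)))"
  proof (rule M.finsum_cong')
    fix q assume "q \<in> min_ext \<Lambda> \<nu> \<rho>"
    note q = m[OF this]
    have "(t \<mu> \<otimes> (t (fst q) \<otimes> invol A (t (snd q)))) \<otimes> invol A (t \<tau>)
        = (t \<mu> \<otimes> t (fst q)) \<otimes> (invol A (t (snd q)) \<otimes> invol A (t \<tau>))"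
      using p q by (simp add: mult_assoc)
    also have "\<dots> = (t \<mu> \<otimes> t (fst q)) \<otimes> invol A (t \<tau> \<otimes> t (snd q))"
      using p q by (simp add: invol_mult)
    also have "\<dots> = gen (pcomp \<Lambda> \<mu> (fst q)) (pcomp \<Lambda> \<tau> (snd q))"
      using p q by (simp add: t_mult gen_def)
    finally show "(t \<mu> \<otimes> (t (fst q) \<otimes> invol A (t (snd q)))) \<otimes> invol A (t \<tau>)
        = gen (pcomp \<Lambda> \<mu> (fst q)) (pcomp \<Lambda> \<tau> (snd q))" .
  qed (use p m in \<open>auto simp: pcomp_closed\<close>)
  finally show ?thesis .
qed

definition convergent_on_gens :: "(nat \<Rightarrow> 'a \<Rightarrow> complex) \<Rightarrow> bool" where
  "convergent_on_gens f \<longleftrightarrow> (\<exists>K. \<forall>n. bounded_functional A K (f n)) \<and>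
     (\<forall>\<mu>\<in>paths \<Lambda>. \<forall>\<nu>\<in>paths \<Lambda>. src \<Lambda> \<mu> = src \<Lambda> \<nu> \<longrightarrow> convergent (\<lambda>n. f n (gen \<mu> \<nu>)))"

text \<open>
  A product of a spanning element with \<open>gen \<rho> \<tau>\<close> is a finite sum of spanning elements, on each of which
  the sequence converges.
\<close>

lemma convergent_on_gens_mult_gen:
  assumes f: "convergent_on_gens f"
    and y: "\<rho> \<in> paths \<Lambda>" "\<tau> \<in> paths \<Lambda>" "src \<Lambda> \<rho> = src \<Lambda> \<tau>"
  shows "convergent_on_gens (\<lambda>n x. f n (x \<otimes> gen \<rho> \<tau>))"
proof -
  obtain K where K: "\<And>n. bounded_functional A K (f n)"
    using f by (auto simp: convergent_on_gens_def)
  have lin: "linear_functional A (f n)" for n using K by (simp add: bounded_functional_def)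
  have "bounded_functional A (K * cnorm A (gen \<rho> \<tau>)) (\<lambda>x. f n (x \<otimes> gen \<rho> \<tau>))" for n
    using K y by (intro bounded_functional_mult_right) auto
  moreover have "convergent (\<lambda>n. f n (gen \<mu> \<nu> \<otimes> gen \<rho> \<tau>))"
    if p: "\<mu> \<in> paths \<Lambda>" "\<nu> \<in> paths \<Lambda>" "src \<Lambda> \<mu> = src \<Lambda> \<nu>" for \<mu> \<nu>
  proof -
    have m: "pcomp \<Lambda> \<mu> (fst p) \<in> paths \<Lambda>" "pcomp \<Lambda> \<tau> (snd p) \<in> paths \<Lambda>"
      "src \<Lambda> (pcomp \<Lambda> \<mu> (fst p)) = src \<Lambda> (pcomp \<Lambda> \<tau> (snd p))" if "p \<in> min_ext \<Lambda> \<nu> \<rho>" for p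
      using min_ext_src[of \<mu> \<nu> \<rho> \<tau> "fst p" "snd p"] p y that by simp_all
    have "f n (gen \<mu> \<nu> \<otimes> gen \<rho> \<tau>) =
        (\<Sum>p\<in>min_ext \<Lambda> \<nu> \<rho>. f n (gen (pcomp \<Lambda> \<mu> (fst p)) (pcomp \<Lambda> \<tau> (snd p))))" for n
      using m p y finite_min_ext by (simp add: gen_mult) (intro linear_functional_finsum[OF lin]; auto)
    moreover have "convergent (\<lambda>n. \<Sum>p\<in>min_ext \<Lambda> \<nu> \<rho>. f n (gen (pcomp \<Lambda> \<mu> (fst p)) (pcomp \<Lambda> \<tau> (snd p))))"
      using m f by (intro convergent_sum) (auto simp: convergent_on_gens_def)
    ultimately show ?thesis by simp
  qed
  ultimately show ?thesis by (auto simp: convergent_on_gens_def)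
qed

text \<open>
  The elements \<open>x\<close> at which all such sequences converge form a closed subspace. It is closed under
  products by freezing one factor at a time: \<open>x \<mapsto> f\<^sub>n(x gen \<rho> \<tau>)\<close> is again such a sequence, so \<open>f\<^sub>n(x gen \<rho> \<tau>)\<close>
  converges for every \<open>x\<close> of the set, which says that \<open>y \<mapsto> f\<^sub>n(x y)\<close> is such a sequence. As it contains
  the generators, it is the whole algebra.
\<close>

theorem convergent_on_gens_convergent:
  assumes "convergent_on_gens f" "x \<in> carrier A"
  shows "convergent (\<lambda>n. f n x)"
proof -
  define S where "S = {x \<in> carrier A. \<forall>f. convergent_on_gens f \<longrightarrow> convergent (\<lambda>n. f n x)}"
  have sub: "S \<subseteq> carrier A" by (auto simp: S_def)
  have SI: "x \<in> S" if "x \<in> carrier A" "\<And>f. convergent_on_gens f \<Longrightarrow> convergent (\<lambda>n. f n x)" for x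
    using that by (simp add: S_def)
  have SD: "convergent (\<lambda>n. f n x)" if "x \<in> S" "convergent_on_gens f" for x f
    using that by (simp add: S_def)
  have lin: "linear_functional A (f n)" if "convergent_on_gens f" for f n
    using that by (auto simp: convergent_on_gens_def bounded_functional_def)
  have "closedin (cstar_topology A) S"
  proof (rule closedinI[OF sub])
    fix x assume x: "x \<in> carrier A" and approx: "\<And>\<epsilon>. 0 < \<epsilon> \<Longrightarrow> \<exists>y\<in>S. cnorm A (x \<ominus> y) < \<epsilon>"
    show "x \<in> S"
    proof (rule SI[OF x])
      fix f assume f: "convergent_on_gens f"
      obtain K where K: "\<And>n. bounded_functional A K (f n)" using f by (auto simp: convergent_on_gens_def)
      have K0: "0 \<le> K" using K[of 0] by (simp add: bounded_functional_def)
      have "Cauchy (\<lambda>n. f n x)"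
        unfolding Cauchy_def
      proof (intro allI impI)
        fix \<epsilon> :: real assume \<epsilon>: "0 < \<epsilon>"
        then have "0 < \<epsilon> / (3 * (K + 1))" using K0 by simp
        from approx[OF this] obtain y where y: "y \<in> S" "cnorm A (x \<ominus> y) < \<epsilon> / (3 * (K + 1))" by blast
        then have yc: "y \<in> carrier A" using sub by auto
        have near: "cmod (f n x - f n y) < \<epsilon> / 3" for n
        proof -
          have "cmod (f n x - f n y) = cmod (f n (x \<ominus> y))"
            using x yc by (simp add: linear_functional_minus[OF lin[OF f]])
          also have "\<dots> \<le> K * cnorm A (x \<ominus> y)"
            using K x yc by (simp add: bounded_functional_def)
          also have "\<dots> \<le> (K + 1) * cnorm A (x \<ominus> y)"
            using cnorm_nonneg[of "x \<ominus> y"] x yc by (intro mult_right_mono) auto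
          also have "\<dots> < (K + 1) * (\<epsilon> / (3 * (K + 1)))"
            using y(2) K0 by (intro mult_strict_left_mono) auto
          also have "\<dots> = \<epsilon> / 3" using K0 by (simp add: field_simps)
          finally show ?thesis .
        qed
        have "Cauchy (\<lambda>n. f n y)" using SD[OF y(1) f] by (rule convergent_Cauchy)
        then obtain N where N: "\<forall>m\<ge>N. \<forall>n\<ge>N. dist (f m y) (f n y) < \<epsilon> / 3"
          using \<epsilon> unfolding Cauchy_def by (metis zero_less_divide_iff zero_less_numeral)
        have "dist (f m x) (f n x) < \<epsilon>" if "N \<le> m" "N \<le> n" for m n
        proof -
          have "dist (f m y) (f n y) < \<epsilon> / 3" using N that by blast
          then show ?thesis
            using near[of m] near[of n] dist_triangle[of "f m x" "f n x" "f m y"]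
              dist_triangle[of "f m y" "f n x" "f n y"]
            by (simp add: dist_norm norm_minus_commute)
        qed
        then show "\<exists>N. \<forall>m\<ge>N. \<forall>n\<ge>N. dist (f m x) (f n x) < \<epsilon>" by blast
      qed
      then show "convergent (\<lambda>n. f n x)" by (simp add: Cauchy_convergent)
    qed
  qed
  moreover have "\<zero> \<in> S"
    by (rule SI) (simp_all add: linear_functional_zero lin convergent_const)
  moreover have "x \<oplus> y \<in> S" if "x \<in> S" "y \<in> S" for x y
  proof (rule SI)
    have c: "x \<in> carrier A" "y \<in> carrier A" using that sub by auto
    then show "x \<oplus> y \<in> carrier A" by simp
    fix f assume f: "convergent_on_gens f"
    show "convergent (\<lambda>n. f n (x \<oplus> y))"
      unfolding linear_functional_add[OF lin[OF f] c] by (intro convergent_add SD that f)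
  qed
  moreover have "c \<odot> x \<in> S" if "x \<in> S" for c x
  proof (rule SI)
    have c: "x \<in> carrier A" using that sub by auto
    then show "c \<odot> x \<in> carrier A" by simp
    fix f assume f: "convergent_on_gens f"
    show "convergent (\<lambda>n. f n (c \<odot> x))"
      unfolding linear_functional_smult[OF lin[OF f] c] by (intro convergent_mult convergent_const SD that f)
  qed
  moreover have "invol A x \<in> S" if x: "x \<in> S" for x
  proof (rule SI)
    show "invol A x \<in> carrier A" using x sub by auto
    fix f assume f: "convergent_on_gens f"
    have "convergent_on_gens (\<lambda>n x. cnj (f n (invol A x)))"
      unfolding convergent_on_gens_def
    proof (intro conjI ballI impI)
      show "\<exists>K. \<forall>n. bounded_functional A K (\<lambda>x. cnj (f n (invol A x)))"
        using f bounded_functional_cnj_invol unfolding convergent_on_gens_def by blast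
      show "convergent (\<lambda>n. cnj (f n (invol A (gen \<mu> \<nu>))))"
        if "\<mu> \<in> paths \<Lambda>" "\<nu> \<in> paths \<Lambda>" "src \<Lambda> \<mu> = src \<Lambda> \<nu>" for \<mu> \<nu>
        using f that by (simp add: invol_gen convergent_on_gens_def convergent_cnj)
    qed
    from SD[OF x this] show "convergent (\<lambda>n. f n (invol A x))"
      using convergent_cnj by fastforce
  qed
  moreover have "x \<otimes> y \<in> S" if x: "x \<in> S" and y: "y \<in> S" for x y
  proof (rule SI)
    have xc: "x \<in> carrier A" and yc: "y \<in> carrier A" using x y sub by auto
    then show "x \<otimes> y \<in> carrier A" by simp
    fix f assume f: "convergent_on_gens f"
    have "convergent_on_gens (\<lambda>n y. f n (x \<otimes> y))"
      unfolding convergent_on_gens_def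
    proof (intro conjI ballI impI)
      show "\<exists>K. \<forall>n. bounded_functional A K (\<lambda>y. f n (x \<otimes> y))"
        using f bounded_functional_mult_left[OF _ xc] unfolding convergent_on_gens_def by blast
      show "convergent (\<lambda>n. f n (x \<otimes> gen \<mu> \<nu>))"
        if "\<mu> \<in> paths \<Lambda>" "\<nu> \<in> paths \<Lambda>" "src \<Lambda> \<mu> = src \<Lambda> \<nu>" for \<mu> \<nu>
        using SD[OF x convergent_on_gens_mult_gen[OF f that]] .
    qed
    then show "convergent (\<lambda>n. f n (x \<otimes> y))" by (rule SD[OF y])
  qed
  ultimately have "cstar_subalgebra A S"
    using sub by (simp add: cstar_subalgebra_def)
  moreover have "t \<mu> \<in> S" if "\<mu> \<in> paths \<Lambda>" for \<mu>
  proof (rule SI)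
    fix f assume "convergent_on_gens f"
    then have "convergent (\<lambda>n. f n (gen \<mu> (src \<Lambda> \<mu>)))"
      using that by (auto simp: convergent_on_gens_def src_closed src_src)
    then show "convergent (\<lambda>n. f n (t \<mu>))" using that by (simp add: gen_src)
  qed (use that in simp)
  ultimately have "S = carrier A" by (intro generated) auto
  then show ?thesis using assms SD by auto
qed

text \<open>
  The alternating sequence \<open>f, g, f, g, \<dots>\<close> converges at \<open>x\<close> only if \<open>f x = g x\<close>.
\<close>

corollary functionals_eq_if_eq_on_gens:
  assumes f: "bounded_functional A K f" and g: "bounded_functional A L g"
    and eq: "\<And>\<mu> \<nu>. \<lbrakk>\<mu> \<in> paths \<Lambda>; \<nu> \<in> paths \<Lambda>; src \<Lambda> \<mu> = src \<Lambda> \<nu>\<rbrakk> \<Longrightarrow> f (gen \<mu> \<nu>) = g (gen \<mu> \<nu>)"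
    and x: "x \<in> carrier A"
  shows "f x = g x"
proof -
  define h where "h n = (if even n then f else g)" for n :: nat
  have mono: "bounded_functional A (max K L) k" if "bounded_functional A K k \<or> bounded_functional A L k" for k
  proof -
    have "M * cnorm A y \<le> max K L * cnorm A y" if "M = K \<or> M = L" "y \<in> carrier A" for M y
      using that cnorm_nonneg by (intro mult_right_mono) auto
    then show ?thesis using that by (fastforce simp: bounded_functional_def)
  qed
  have "convergent_on_gens h"
    unfolding convergent_on_gens_def
  proof (intro conjI ballI impI)
    show "\<exists>K. \<forall>n. bounded_functional A K (h n)" using f g mono by (auto simp: h_def)
    show "convergent (\<lambda>n. h n (gen \<mu> \<nu>))"
      if "\<mu> \<in> paths \<Lambda>" "\<nu> \<in> paths \<Lambda>" "src \<Lambda> \<mu> = src \<Lambda> \<nu>" for \<mu> \<nu>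
    proof -
      have "(\<lambda>n. h n (gen \<mu> \<nu>)) = (\<lambda>n. f (gen \<mu> \<nu>))" using eq[OF that] by (auto simp: h_def)
      then show ?thesis by (simp add: convergent_const)
    qed
  qed
  then obtain l where l: "(\<lambda>n. h n x) \<longlonglongrightarrow> l"
    using convergent_on_gens_convergent[OF _ x] by (auto simp: convergent_def)
  have "(\<lambda>n. h (2 * n) x) \<longlonglongrightarrow> l" "(\<lambda>n. h (2 * n + 1) x) \<longlonglongrightarrow> l"
    using LIMSEQ_subseq_LIMSEQ[OF l, of "\<lambda>n. 2 * n"] LIMSEQ_subseq_LIMSEQ[OF l, of "\<lambda>n. 2 * n + 1"]
    by (simp_all add: strict_mono_def o_def)
  then have "f x = l" "g x = l" by (simp_all add: h_def LIMSEQ_const_iff)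
  then show ?thesis by simp
qed

definition unit :: 'a where "unit = (\<Oplus>z\<in>vertices \<Lambda>. t z)"

text \<open>
  Only the summand \<open>t\<close> of the range of \<open>\<mu>\<close> is not orthogonal to \<open>t \<mu>\<close>.
\<close>

lemma unit_mult_t: "\<mu> \<in> paths \<Lambda> \<Longrightarrow> unit \<otimes> t \<mu> = t \<mu>"
proof -
  assume \<mu>: "\<mu> \<in> paths \<Lambda>"
  have "unit \<otimes> t \<mu> = (\<Oplus>z\<in>vertices \<Lambda>. t z \<otimes> t \<mu>)"
    unfolding unit_def using \<mu> finite_vertices by (intro finsum_mult_left) (auto simp: vertex_path)
  also have "\<dots> = (\<Oplus>z\<in>vertices \<Lambda>. if rng \<Lambda> \<mu> = z then t \<mu> else \<zero>)"
  proof (rule M.finsum_cong')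
    fix z assume z: "z \<in> vertices \<Lambda>"
    have "t z \<otimes> t \<mu> = (t z \<otimes> t (rng \<Lambda> \<mu>)) \<otimes> t \<mu>"
      using \<mu> z by (simp add: mult_assoc vertex_path rng_closed t_rng_mult)
    then show "t z \<otimes> t \<mu> = (if rng \<Lambda> \<mu> = z then t \<mu> else \<zero>)"
      using \<mu> z by (auto simp: t_rng_mult t_vertices_orthogonal rng_in_vertices)
  qed (use \<mu> in auto)
  also have "\<dots> = t \<mu>"
    using \<mu> finite_vertices rng_in_vertices by (intro M.finsum_singleton) auto
  finally show ?thesis .
qed

lemma t_mult_unit: "\<mu> \<in> paths \<Lambda> \<Longrightarrow> t \<mu> \<otimes> unit = t \<mu>"
proof -
  assume \<mu>: "\<mu> \<in> paths \<Lambda>"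
  have "t \<mu> \<otimes> unit = (\<Oplus>z\<in>vertices \<Lambda>. t \<mu> \<otimes> t z)"
    unfolding unit_def using \<mu> finite_vertices by (intro finsum_mult_right) (auto simp: vertex_path)
  also have "\<dots> = (\<Oplus>z\<in>vertices \<Lambda>. if src \<Lambda> \<mu> = z then t \<mu> else \<zero>)"
  proof (rule M.finsum_cong')
    fix z assume z: "z \<in> vertices \<Lambda>"
    have "t \<mu> \<otimes> t z = t \<mu> \<otimes> (t (src \<Lambda> \<mu>) \<otimes> t z)"
      using \<mu> z by (simp add: mult_assoc[symmetric] vertex_path src_closed t_mult_src)
    then show "t \<mu> \<otimes> t z = (if src \<Lambda> \<mu> = z then t \<mu> else \<zero>)"
      using \<mu> z by (auto simp: t_mult_src t_vertices_orthogonal src_in_vertices)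
  qed (use \<mu> in auto)
  also have "\<dots> = t \<mu>"
    using \<mu> finite_vertices src_in_vertices by (intro M.finsum_singleton) auto
  finally show ?thesis .
qed

lemma unit_in_carrier: "unit \<in> carrier A"
  by (auto simp: unit_def vertex_path)

lemma invol_unit_self: "invol A unit = unit"
proof -
  have "invol A unit = (\<Oplus>z\<in>vertices \<Lambda>. invol A (t z))"
    unfolding unit_def using finite_vertices by (intro invol_finsum) (auto simp: vertex_path)
  also have "\<dots> = unit"
    unfolding unit_def by (rule M.finsum_cong') (auto simp: vertex_path invol_t_vertex)
  finally show ?thesis .
qed

text \<open>
  The elements fixed by left and right multiplication with \<open>unit\<close> form a closed *-subalgebra that contains
  the generators.
\<close>

lemma unit_is_unit: "x \<in> carrier A \<Longrightarrow> unit \<otimes> x = x \<and> x \<otimes> unit = x"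
proof -
  define S where "S = {x \<in> carrier A. unit \<otimes> x = x \<and> x \<otimes> unit = x}"
  note u = unit_in_carrier
  have "closedin (cstar_topology A) S"
  proof (rule closedinI)
    show "S \<subseteq> carrier A" by (auto simp: S_def)
    fix x assume x: "x \<in> carrier A" and approx: "\<And>\<epsilon>. 0 < \<epsilon> \<Longrightarrow> \<exists>y\<in>S. cnorm A (x \<ominus> y) < \<epsilon>"
    have "cnorm A (unit \<otimes> x \<ominus> x) \<le> 0 + \<epsilon> \<and> cnorm A (x \<otimes> unit \<ominus> x) \<le> 0 + \<epsilon>" if e: "0 < \<epsilon>" for \<epsilon>
    proof -
      define c where "c = cnorm A unit + 1"
      have c: "0 < c" using cnorm_nonneg[OF u] by (simp add: c_def)
      obtain y where y: "y \<in> S" "cnorm A (x \<ominus> y) < \<epsilon> / c"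
        using approx[OF divide_pos_pos[OF e c]] by blast
      then have yc: "y \<in> carrier A" "unit \<otimes> y = y" "y \<otimes> unit = y" by (auto simp: S_def)
      have small: "cnorm A (x \<ominus> y) * c \<le> \<epsilon>" using y(2) c by (simp add: field_simps)
      have d: "x \<ominus> y \<in> carrier A" using x yc by simp
      have "cnorm A (unit \<otimes> x \<ominus> x) \<le> cnorm A (unit \<otimes> x \<ominus> y) + cnorm A (y \<ominus> x)"
        using x yc u by (intro cnorm_minus_triangle) auto
      also have "unit \<otimes> x \<ominus> y = unit \<otimes> (x \<ominus> y)"
        using x yc u by (simp add: mult_minus_right)
      also have "cnorm A (unit \<otimes> (x \<ominus> y)) + cnorm A (y \<ominus> x) \<le> cnorm A (x \<ominus> y) * c"
        using cnorm_mult[OF u d] x yc by (simp add: c_def cnorm_minus_commute algebra_simps)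
      finally have 1: "cnorm A (unit \<otimes> x \<ominus> x) \<le> cnorm A (x \<ominus> y) * c" .
      have "cnorm A (x \<otimes> unit \<ominus> x) \<le> cnorm A (x \<otimes> unit \<ominus> y) + cnorm A (y \<ominus> x)"
        using x yc u by (intro cnorm_minus_triangle) auto
      also have "x \<otimes> unit \<ominus> y = (x \<ominus> y) \<otimes> unit"
        using x yc u by (simp add: mult_minus_left)
      also have "cnorm A ((x \<ominus> y) \<otimes> unit) + cnorm A (y \<ominus> x) \<le> cnorm A (x \<ominus> y) * c"
        using cnorm_mult[OF d u] x yc by (simp add: c_def cnorm_minus_commute algebra_simps)
      finally show ?thesis using 1 small by simp
    qed
    then have "cnorm A (unit \<otimes> x \<ominus> x) \<le> 0" "cnorm A (x \<otimes> unit \<ominus> x) \<le> 0"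
      by (blast intro: field_le_epsilon)+
    then have "cnorm A (unit \<otimes> x \<ominus> x) = 0" "cnorm A (x \<otimes> unit \<ominus> x) = 0"
      using x u cnorm_nonneg by (auto intro: antisym)
    then show "x \<in> S" using x u by (simp add: S_def cnorm_minus_eq_0)
  qed
  moreover have "invol A x \<in> S" if "x \<in> S" for x
  proof -
    have "invol A (x \<otimes> unit) = invol A x" "invol A (unit \<otimes> x) = invol A x" "x \<in> carrier A"
      using that by (simp_all add: S_def)
    then show ?thesis using u by (simp add: S_def invol_mult invol_unit_self)
  qed
  moreover have "x \<otimes> y \<in> S" if "x \<in> S" "y \<in> S" for x y
  proof -
    have "unit \<otimes> (x \<otimes> y) = (unit \<otimes> x) \<otimes> y" "(x \<otimes> y) \<otimes> unit = x \<otimes> (y \<otimes> unit)"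
      using that u mult_assoc[of unit x y] mult_assoc[of x y unit] by (auto simp: S_def)
    then show ?thesis using that by (simp add: S_def)
  qed
  ultimately have "cstar_subalgebra A S"
    using u by (auto simp: cstar_subalgebra_def S_def mult_distrib_left mult_distrib_right
        smult_mult_left smult_mult_right)
  moreover have "t ` paths \<Lambda> \<subseteq> S" by (auto simp: S_def unit_mult_t t_mult_unit)
  ultimately have "S = carrier A" by (rule generated)
  then show "x \<in> carrier A \<Longrightarrow> ?thesis" by (auto simp: S_def)
qed

sublocale unital_cstar_algebra A unit
  by unfold_locales (simp_all add: unit_in_carrier unit_is_unit)

end

section \<open>KMS states on Toeplitz algebras\<close>

definition weight :: "'p pregraph \<Rightarrow> real \<times> real \<Rightarrow> 'p \<Rightarrow> real" where
  "weight \<Lambda> r \<mu> = fst r * real (fst (deg \<Lambda> \<mu>)) + snd r * real (snd (deg \<Lambda> \<mu>))"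

lemma (in two_graph) weight_pcomp:
  "\<lbrakk>\<mu> \<in> paths \<Lambda>; \<nu> \<in> paths \<Lambda>; src \<Lambda> \<mu> = rng \<Lambda> \<nu>\<rbrakk>
    \<Longrightarrow> weight \<Lambda> r (pcomp \<Lambda> \<mu> \<nu>) = weight \<Lambda> r \<mu> + weight \<Lambda> r \<nu>"
  by (simp add: weight_def deg_pcomp algebra_simps)

lemma (in two_graph) weight_src [simp]: "\<xi> \<in> paths \<Lambda> \<Longrightarrow> weight \<Lambda> r (src \<Lambda> \<xi>) = 0"
  by (simp add: weight_def deg_src)

lemma rationally_independent_weight_eq:
  assumes "rationally_independent r1 r2" "weight \<Lambda> (r1, r2) \<mu> = weight \<Lambda> (r1, r2) \<nu>"
  shows "deg \<Lambda> \<mu> = deg \<Lambda> \<nu>"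
proof -
  define p q :: rat where "p = of_int (int (fst (deg \<Lambda> \<mu>)) - int (fst (deg \<Lambda> \<nu>)))"
    and "q = of_int (int (snd (deg \<Lambda> \<mu>)) - int (snd (deg \<Lambda> \<nu>)))"
  have "of_rat p * r1 + of_rat q * r2 = 0"
    using assms(2) by (simp add: p_def q_def weight_def of_rat_diff algebra_simps)
  then have "p = 0 \<and> q = 0" using assms(1) by (simp add: rationally_independent_def)
  then show ?thesis by (simp add: p_def q_def prod_eq_iff)
qed

lemma (in cstar_algebra) limitin_cstar_topology:
  "limitin (cstar_topology A) f l F \<longleftrightarrow>
    l \<in> carrier A \<and> (\<forall>\<epsilon>>0. \<forall>\<^sub>F x in F. f x \<in> carrier A \<and> cstar_dist A (f x) l < \<epsilon>)"
  by (simp add: cstar_topology_def Metric_space.limitin_metric[OF Metric_space_cstar])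

text \<open>
  The difference quotients of \<open>F\<close> converge in norm, and \<open>f\<close> is norm continuous.
\<close>

lemma (in cstar_algebra) entire_into_bounded_functional:
  assumes F: "entire_into A F" and f: "bounded_functional A K f"
  shows "(\<lambda>z. f (F z)) holomorphic_on UNIV"
proof -
  have lin: "linear_functional A f" and K: "0 \<le> K" "\<And>x. x \<in> carrier A \<Longrightarrow> cmod (f x) \<le> K * cnorm A x"
    using f by (auto simp: bounded_functional_def)
  have Fc: "F z \<in> carrier A" for z using F by (auto simp: entire_into_def)
  have "\<exists>D. ((\<lambda>z. f (F z)) has_field_derivative D) (at z)" for z
  proof -
    obtain D where D: "limitin (cstar_topology A)
        (\<lambda>h. inverse h \<odot> (F (z + h) \<ominus> F z)) D (at 0)"
      using F by (auto simp: entire_into_def)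
    then have Dc: "D \<in> carrier A" by (simp add: limitin_cstar_topology)
    have "(\<lambda>h. (f (F (z + h)) - f (F z)) / h) \<midarrow>0\<rightarrow> f D"
    proof (rule tendstoI)
      fix \<epsilon> :: real assume "0 < \<epsilon>"
      then have "0 < \<epsilon> / (K + 1)" using K by simp
      with D have "\<forall>\<^sub>F h in at 0. cstar_dist A (inverse h \<odot> (F (z + h) \<ominus> F z)) D < \<epsilon> / (K + 1)"
        by (simp add: limitin_cstar_topology Fc)
      then show "\<forall>\<^sub>F h in at 0. dist ((f (F (z + h)) - f (F z)) / h) (f D) < \<epsilon>"
      proof (rule eventually_mono)
        fix h :: complex
        let ?x = "inverse h \<odot> (F (z + h) \<ominus> F z)"
        assume "cstar_dist A ?x D < \<epsilon> / (K + 1)"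
        then have less: "cnorm A (?x \<ominus> D) < \<epsilon> / (K + 1)" by (simp add: cstar_dist_def Fc Dc)
        have "dist ((f (F (z + h)) - f (F z)) / h) (f D) = cmod (f (?x \<ominus> D))"
          by (simp add: dist_norm Fc Dc linear_functional_minus[OF lin] linear_functional_smult[OF lin]
              divide_inverse mult.commute)
        also have "\<dots> \<le> K * cnorm A (?x \<ominus> D)" by (intro K) (simp add: Fc Dc)
        also have "\<dots> \<le> (K + 1) * cnorm A (?x \<ominus> D)"
          using cnorm_nonneg[of "?x \<ominus> D"] by (intro mult_right_mono) (auto simp: Fc Dc)
        also have "\<dots> < (K + 1) * (\<epsilon> / (K + 1))"
          using less K by (intro mult_strict_left_mono) auto
        finally show "dist ((f (F (z + h)) - f (F z)) / h) (f D) < \<epsilon>" using K by simp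
      qed
    qed
    then have "((\<lambda>z. f (F z)) has_field_derivative f D) (at z)" by (simp add: DERIV_def)
    then show ?thesis ..
  qed
  then show ?thesis by (simp add: holomorphic_on_open)
qed

lemma (in cstar_algebra) entire_into_scalar_multiple:
  assumes g: "\<And>z. (g has_field_derivative g' z) (at z)" and x: "x \<in> carrier A"
  shows "entire_into A (\<lambda>z. g z \<odot> x)"
  unfolding entire_into_def
proof (intro conjI allI)
  show "range (\<lambda>z. g z \<odot> x) \<subseteq> carrier A" using x by auto
  fix z
  have eq: "cstar_dist A (inverse h \<odot> (g (z + h) \<odot> x \<ominus> g z \<odot> x)) (g' z \<odot> x)
      = cmod ((g (z + h) - g z) / h - g' z) * cnorm A x" for h
  proof -
    have "inverse h \<odot> (g (z + h) \<odot> x \<ominus> g z \<odot> x) \<ominus> g' z \<odot> x = ((g (z + h) - g z) / h - g' z) \<odot> x"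
    proof -
      have "((g (z + h) - g z) / h - g' z) = inverse h * (g (z + h) + - 1 * g z) + - 1 * g' z"
        by (simp add: divide_inverse mult.commute)
      then show ?thesis
        using x by (simp only: smult_add_left smult_smult[symmetric] minus_eq_smult smult_in_carrier
            smult_add_right M.a_closed)
    qed
    then show ?thesis using x by (simp add: cstar_dist_def cnorm_smult)
  qed
  have "((\<lambda>h. cmod ((g (z + h) - g z) / h - g' z) * cnorm A x) \<longlongrightarrow> cmod (g' z - g' z) * cnorm A x) (at 0)"
    using g[of z] by (intro tendsto_intros) (simp add: DERIV_def)
  then have "\<forall>\<^sub>F h in at 0. cmod ((g (z + h) - g z) / h - g' z) * cnorm A x < \<epsilon>" if "0 < \<epsilon>" for \<epsilon>
    using that by (intro order_tendstoD(2)) auto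
  then show "\<exists>D. limitin (cstar_topology A)
      (\<lambda>h. inverse h \<odot> (g (z + h) \<odot> x \<ominus> g z \<odot> x)) D (at 0)"
    using x by (intro exI[of _ "g' z \<odot> x"]) (simp add: limitin_cstar_topology eq)
qed

locale toeplitz_system = toeplitz +
  fixes r :: "real \<times> real" and \<alpha> :: "real \<Rightarrow> 'b \<Rightarrow> 'b"
  assumes dynamics: "toeplitz_dynamics \<Lambda> A t r \<alpha>"
begin

lemma star_hom_\<alpha>: "star_hom A A (\<alpha> s)"
  using dynamics by (simp add: toeplitz_dynamics_def cstar_dynamics_def)

lemma \<alpha>_closed: "x \<in> carrier A \<Longrightarrow> \<alpha> s x \<in> carrier A"
  using star_hom_\<alpha>[of s] by (auto simp: star_hom_def)

lemma \<alpha>_add: "x \<in> carrier A \<Longrightarrow> \<alpha> (s + s') x = \<alpha> s (\<alpha> s' x)"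
  using dynamics by (simp add: toeplitz_dynamics_def cstar_dynamics_def)

lemma \<alpha>_zero: "x \<in> carrier A \<Longrightarrow> \<alpha> 0 x = x"
  using dynamics by (simp add: toeplitz_dynamics_def cstar_dynamics_def)

lemma \<alpha>_gen:
  assumes "\<mu> \<in> paths \<Lambda>" "\<nu> \<in> paths \<Lambda>"
  shows "\<alpha> s (gen \<mu> \<nu>) = exp (\<i> * of_real s * of_real (weight \<Lambda> r \<mu> - weight \<Lambda> r \<nu>)) \<odot> gen \<mu> \<nu>"
proof -
  have "s * (fst r * (real (fst (deg \<Lambda> \<mu>)) - real (fst (deg \<Lambda> \<nu>))) +
      snd r * (real (snd (deg \<Lambda> \<mu>)) - real (snd (deg \<Lambda> \<nu>)))) = s * (weight \<Lambda> r \<mu> - weight \<Lambda> r \<nu>)"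
    by (simp add: weight_def algebra_simps)
  moreover have "\<alpha> s (t \<mu> \<otimes> invol A (t \<nu>)) = exp (\<i> * complex_of_real (s *
      (fst r * (real (fst (deg \<Lambda> \<mu>)) - real (fst (deg \<Lambda> \<nu>))) +
       snd r * (real (snd (deg \<Lambda> \<mu>)) - real (snd (deg \<Lambda> \<nu>)))))) \<odot> (t \<mu> \<otimes> invol A (t \<nu>))"
    using dynamics assms unfolding toeplitz_dynamics_def by blast
  ultimately show ?thesis
    by (simp only: gen_def of_real_mult mult.assoc)
qed

definition gen_ext :: "'a \<Rightarrow> 'a \<Rightarrow> complex \<Rightarrow> 'b" where
  "gen_ext \<mu> \<nu> z = exp (\<i> * z * of_real (weight \<Lambda> r \<mu> - weight \<Lambda> r \<nu>)) \<odot> gen \<mu> \<nu>"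

lemma analytic_extension_gen:
  assumes "\<mu> \<in> paths \<Lambda>" "\<nu> \<in> paths \<Lambda>"
  shows "analytic_extension A \<alpha> (gen \<mu> \<nu>) (gen_ext \<mu> \<nu>)"
proof -
  have "entire_into A (gen_ext \<mu> \<nu>)"
    unfolding gen_ext_def[abs_def] using assms
    by (intro entire_into_scalar_multiple) (auto intro!: derivative_eq_intros)
  then show ?thesis
    using assms by (simp add: analytic_extension_def gen_ext_def \<alpha>_gen)
qed

text \<open>
  At \<open>z = \<i>\<close> the entire extension of the orbit of \<open>gen \<mu> \<nu>\<close> is a real multiple of \<open>gen \<mu> \<nu>\<close>.
\<close>

lemma kms_state_gens:
  assumes f: "kms_state A \<alpha> 1 f"
    and p: "\<mu> \<in> paths \<Lambda>" "\<nu> \<in> paths \<Lambda>" "\<rho> \<in> paths \<Lambda>" "\<tau> \<in> paths \<Lambda>"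
  shows "f (gen \<mu> \<nu> \<otimes> gen \<rho> \<tau>) = exp (of_real (weight \<Lambda> r \<nu> - weight \<Lambda> r \<mu>)) * f (gen \<rho> \<tau> \<otimes> gen \<mu> \<nu>)"
proof -
  have lin: "linear_functional A f"
    using f cstar_state_positive by (auto simp: kms_state_def positive_functional_def)
  have "f (gen \<mu> \<nu> \<otimes> gen \<rho> \<tau>) = f (gen \<rho> \<tau> \<otimes> gen_ext \<mu> \<nu> (\<i> * complex_of_real 1))"
    using f p analytic_extension_gen unfolding kms_state_def analytic_element_def by blast
  also have "gen_ext \<mu> \<nu> (\<i> * complex_of_real 1) =
      exp (of_real (weight \<Lambda> r \<nu> - weight \<Lambda> r \<mu>)) \<odot> gen \<mu> \<nu>"
    by (simp add: gen_ext_def mult.assoc[symmetric])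
  finally show ?thesis
    using p by (simp add: smult_mult_right linear_functional_smult[OF lin])
qed

text \<open>
  Applying the KMS condition to both factors of \<open>t\<^sub>\<mu>t\<^sub>\<nu>\<^sup>*\<close> shows that it can only be charged
  when the two weights agree, that is, when \<open>\<mu>\<close> and \<open>\<nu>\<close> have the same degree; then (T5) leaves
  only \<open>\<mu> = \<nu>\<close>.
\<close>

lemma kms_state_gen:
  assumes f: "kms_state A \<alpha> 1 f"
    and indep: "rationally_independent (fst r) (snd r)"
    and p: "\<mu> \<in> paths \<Lambda>" "\<nu> \<in> paths \<Lambda>"
  shows "f (gen \<mu> \<nu>) = (if \<mu> = \<nu> then exp (- of_real (weight \<Lambda> r \<mu>)) * f (t (src \<Lambda> \<mu>)) else 0)"
proof -
  have lin: "linear_functional A f"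
    using f cstar_state_positive by (auto simp: kms_state_def positive_functional_def)
  have 1: "f (gen \<mu> \<nu>) = exp (- of_real (weight \<Lambda> r \<mu>)) * f (invol A (t \<nu>) \<otimes> t \<mu>)"
    using kms_state_gens[OF f, of \<mu> "src \<Lambda> \<mu>" "src \<Lambda> \<nu>" \<nu>] p
    by (simp add: gen_src gen_src_left src_closed) (simp add: gen_def)
  have 2: "f (invol A (t \<nu>) \<otimes> t \<mu>) = exp (of_real (weight \<Lambda> r \<nu>)) * f (gen \<mu> \<nu>)"
    using kms_state_gens[OF f, of "src \<Lambda> \<nu>" \<nu> \<mu> "src \<Lambda> \<mu>"] p
    by (simp add: gen_src gen_src_left src_closed) (simp add: gen_def)
  show ?thesis
  proof (cases "\<mu> = \<nu>")
    case True
    then show ?thesis using 1 p by (simp add: invol_t_mult_t)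
  next
    case False
    have "f (gen \<mu> \<nu>) = 0"
    proof (cases "weight \<Lambda> r \<mu> = weight \<Lambda> r \<nu>")
      case True
      then have "deg \<Lambda> \<nu> = deg \<Lambda> \<mu>"
        using rationally_independent_weight_eq[OF indep, of \<Lambda> \<nu> \<mu>] by simp
      then have "invol A (t \<nu>) \<otimes> t \<mu> = \<zero>"
        using p False by (simp add: invol_t_mult min_ext_same_degree)
      then show ?thesis using 1 linear_functional_zero[OF lin] by simp
    next
      case False
      have "f (gen \<mu> \<nu>) = exp (of_real (weight \<Lambda> r \<nu> - weight \<Lambda> r \<mu>)) * f (gen \<mu> \<nu>)"
        using 1 2 by (simp add: exp_diff exp_minus divide_inverse mult_ac)
      moreover have "exp (of_real (weight \<Lambda> r \<nu> - weight \<Lambda> r \<mu>)) \<noteq> (1 :: complex)"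
        using False by (simp only: exp_of_real of_real_eq_1_iff exp_eq_one_iff)
      ultimately show ?thesis by simp
    qed
    then show ?thesis using False by simp
  qed
qed

end

text \<open>
  The values found in \<open>kms_state_gen\<close>, with \<open>m z\<close> for the mass at the vertex \<open>z\<close>, are now taken as
  hypotheses, in order to derive the KMS condition from them.
\<close>

locale diagonal_functional = toeplitz_system +
  fixes f :: "'b \<Rightarrow> complex" and m :: "'a \<Rightarrow> complex"
  assumes positive: "positive_functional A f"
    and diagonal: "\<lbrakk>\<mu> \<in> paths \<Lambda>; \<nu> \<in> paths \<Lambda>; src \<Lambda> \<mu> = src \<Lambda> \<nu>\<rbrakk> \<Longrightarrow>
      f (gen \<mu> \<nu>) = (if \<mu> = \<nu> then exp (- of_real (weight \<Lambda> r \<mu>)) * m (src \<Lambda> \<mu>) else 0)"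
begin

lemma linear: "linear_functional A f"
  using positive by (simp add: positive_functional_def)

lemma bounded: "bounded_functional A (Re (f unit)) f"
  by (rule positive_functional_bounded[OF positive])

text \<open>
  The functional annihilates all terms of the expansion of the product that are not of the form \<open>gen \<xi> \<xi>\<close>.
\<close>

lemma value_on_product:
  assumes p: "\<mu> \<in> paths \<Lambda>" "\<nu> \<in> paths \<Lambda>" "\<rho> \<in> paths \<Lambda>" "\<tau> \<in> paths \<Lambda>"
    and s: "src \<Lambda> \<mu> = src \<Lambda> \<nu>" "src \<Lambda> \<rho> = src \<Lambda> \<tau>"
  shows "f (gen \<mu> \<nu> \<otimes> gen \<rho> \<tau>) =
    (\<Sum>(\<alpha>', \<beta>)\<in>{(\<alpha>', \<beta>) \<in> min_ext \<Lambda> \<nu> \<rho>. pcomp \<Lambda> \<mu> \<alpha>' = pcomp \<Lambda> \<tau> \<beta>}.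
      exp (- of_real (weight \<Lambda> r \<mu> + weight \<Lambda> r \<alpha>')) * m (src \<Lambda> \<alpha>'))"
proof -
  note c = min_ext_src[OF p s]
  have fin: "finite (min_ext \<Lambda> \<nu> \<rho>)" using p by (intro finite_min_ext)
  have "f (gen \<mu> \<nu> \<otimes> gen \<rho> \<tau>) = (\<Sum>q\<in>min_ext \<Lambda> \<nu> \<rho>. f (gen (pcomp \<Lambda> \<mu> (fst q)) (pcomp \<Lambda> \<tau> (snd q))))"
    unfolding gen_mult[OF p s] using c fin by (intro linear_functional_finsum[OF linear]) auto
  also have "\<dots> = (\<Sum>q\<in>min_ext \<Lambda> \<nu> \<rho>. if pcomp \<Lambda> \<mu> (fst q) = pcomp \<Lambda> \<tau> (snd q)
      then exp (- of_real (weight \<Lambda> r \<mu> + weight \<Lambda> r (fst q))) * m (src \<Lambda> (fst q)) else 0)"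
  proof (rule sum.cong[OF refl])
    fix q assume "q \<in> min_ext \<Lambda> \<nu> \<rho>"
    then have "(fst q, snd q) \<in> min_ext \<Lambda> \<nu> \<rho>" by simp
    note cq = c[OF this]
    show "f (gen (pcomp \<Lambda> \<mu> (fst q)) (pcomp \<Lambda> \<tau> (snd q))) =
      (if pcomp \<Lambda> \<mu> (fst q) = pcomp \<Lambda> \<tau> (snd q)
      then exp (- of_real (weight \<Lambda> r \<mu> + weight \<Lambda> r (fst q))) * m (src \<Lambda> (fst q)) else 0)"
    proof -
      have w: "weight \<Lambda> r (pcomp \<Lambda> \<mu> (fst q)) = weight \<Lambda> r \<mu> + weight \<Lambda> r (fst q)"
        using cq p by (intro weight_pcomp)
      have "src \<Lambda> (pcomp \<Lambda> \<mu> (fst q)) = src \<Lambda> (pcomp \<Lambda> \<tau> (snd q))" using cq by simp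
      from diagonal[OF cq(6,7) this] show ?thesis by (simp only: w cq(8))
    qed
  qed
  also have "\<dots> = (\<Sum>(\<alpha>', \<beta>)\<in>{(\<alpha>', \<beta>) \<in> min_ext \<Lambda> \<nu> \<rho>. pcomp \<Lambda> \<mu> \<alpha>' = pcomp \<Lambda> \<tau> \<beta>}.
      exp (- of_real (weight \<Lambda> r \<mu> + weight \<Lambda> r \<alpha>')) * m (src \<Lambda> \<alpha>'))"
    using fin by (intro sum.mono_neutral_cong_right) (auto split: if_splits)
  finally show ?thesis .
qed

text \<open>
  The expansions of the two products are matched by \<open>min_ext_swap\<close>. Because of \<open>\<mu>\<alpha> = \<tau>\<beta>\<close> the weights
  of matching terms differ by \<open>weight \<tau> - weight \<rho>\<close>, the same amount for all terms.
\<close>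

lemma gens_twisted_commute:
  assumes p: "\<mu> \<in> paths \<Lambda>" "\<nu> \<in> paths \<Lambda>" "\<rho> \<in> paths \<Lambda>" "\<tau> \<in> paths \<Lambda>"
    and s: "src \<Lambda> \<mu> = src \<Lambda> \<nu>" "src \<Lambda> \<rho> = src \<Lambda> \<tau>"
  shows "f (gen \<rho> \<tau> \<otimes> gen \<mu> \<nu>) = exp (of_real (weight \<Lambda> r \<tau> - weight \<Lambda> r \<rho>)) * f (gen \<mu> \<nu> \<otimes> gen \<rho> \<tau>)"
proof -
  let ?P = "{(\<alpha>', \<beta>) \<in> min_ext \<Lambda> \<nu> \<rho>. pcomp \<Lambda> \<mu> \<alpha>' = pcomp \<Lambda> \<tau> \<beta>}"
  let ?Q = "{(\<gamma>, \<delta>) \<in> min_ext \<Lambda> \<tau> \<mu>. pcomp \<Lambda> \<rho> \<gamma> = pcomp \<Lambda> \<nu> \<delta>}"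
  have "f (gen \<rho> \<tau> \<otimes> gen \<mu> \<nu>) =
      (\<Sum>(\<gamma>, \<delta>)\<in>?Q. exp (- of_real (weight \<Lambda> r \<rho> + weight \<Lambda> r \<gamma>)) * m (src \<Lambda> \<gamma>))"
    using p s by (intro value_on_product) auto
  also have "\<dots> = (\<Sum>(\<alpha>', \<beta>)\<in>?P. exp (- of_real (weight \<Lambda> r \<rho> + weight \<Lambda> r \<beta>)) * m (src \<Lambda> \<beta>))"
  proof (rule sum.reindex_bij_witness[of _ prod.swap prod.swap])
    fix q assume "q \<in> ?Q"
    then show "prod.swap q \<in> ?P"
      using min_ext_swap[of \<rho> \<tau> \<mu> \<nu> "fst q" "snd q"] p s by auto
  next
    fix q assume "q \<in> ?P"
    then show "prod.swap q \<in> ?Q"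
      using min_ext_swap[of \<mu> \<nu> \<rho> \<tau> "fst q" "snd q"] p s by auto
  qed auto
  also have "\<dots> = (\<Sum>(\<alpha>', \<beta>)\<in>?P. exp (of_real (weight \<Lambda> r \<tau> - weight \<Lambda> r \<rho>)) *
      (exp (- of_real (weight \<Lambda> r \<mu> + weight \<Lambda> r \<alpha>')) * m (src \<Lambda> \<alpha>')))"
  proof (rule sum.cong[OF refl], clarify)
    fix \<alpha>' \<beta> assume q: "(\<alpha>', \<beta>) \<in> min_ext \<Lambda> \<nu> \<rho>" and eq: "pcomp \<Lambda> \<mu> \<alpha>' = pcomp \<Lambda> \<tau> \<beta>"
    note c = min_ext_src[OF p s q]
    have "weight \<Lambda> r \<mu> + weight \<Lambda> r \<alpha>' = weight \<Lambda> r \<tau> + weight \<Lambda> r \<beta>"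
      using weight_pcomp[of \<mu> \<alpha>' r] weight_pcomp[of \<tau> \<beta> r] c p eq by simp
    then have "- (weight \<Lambda> r \<rho> + weight \<Lambda> r \<beta>) =
        (weight \<Lambda> r \<tau> - weight \<Lambda> r \<rho>) + - (weight \<Lambda> r \<mu> + weight \<Lambda> r \<alpha>')" by simp
    then have "exp (- of_real (weight \<Lambda> r \<rho> + weight \<Lambda> r \<beta>)) =
        (exp (of_real (weight \<Lambda> r \<tau> - weight \<Lambda> r \<rho>)) *
         exp (- of_real (weight \<Lambda> r \<mu> + weight \<Lambda> r \<alpha>')) :: complex)"
      by (metis exp_add of_real_add of_real_minus)
    then show "exp (- of_real (weight \<Lambda> r \<rho> + weight \<Lambda> r \<beta>)) * m (src \<Lambda> \<beta>) =
        exp (of_real (weight \<Lambda> r \<tau> - weight \<Lambda> r \<rho>)) *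
        (exp (- of_real (weight \<Lambda> r \<mu> + weight \<Lambda> r \<alpha>')) * m (src \<Lambda> \<alpha>'))"
      using c by (simp add: mult.assoc)
  qed
  also have "\<dots> = exp (of_real (weight \<Lambda> r \<tau> - weight \<Lambda> r \<rho>)) * f (gen \<mu> \<nu> \<otimes> gen \<rho> \<tau>)"
    unfolding value_on_product[OF p s] sum_distrib_left by (rule sum.cong) auto
  finally show ?thesis .
qed

lemma twisted_commute:
  assumes p: "\<rho> \<in> paths \<Lambda>" "\<tau> \<in> paths \<Lambda>" "src \<Lambda> \<rho> = src \<Lambda> \<tau>" and x: "x \<in> carrier A"
  shows "f (gen \<rho> \<tau> \<otimes> x) = exp (of_real (weight \<Lambda> r \<tau> - weight \<Lambda> r \<rho>)) * f (x \<otimes> gen \<rho> \<tau>)"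
proof (rule functionals_eq_if_eq_on_gens[OF bounded_functional_mult_left[OF bounded]
        bounded_functional_scale[OF bounded_functional_mult_right[OF bounded]] _ x])
  show "gen \<rho> \<tau> \<in> carrier A" "gen \<rho> \<tau> \<in> carrier A" using p by simp_all
qed (rule gens_twisted_commute[OF _ _ p(1,2) _ p(3)])

text \<open>
  The only spanning elements charged by \<open>f\<close> are the \<open>gen \<mu> \<mu>\<close>, which the dynamics fixes; \<open>f \<circ> \<alpha>\<^sub>s\<close> is
  positive, hence bounded, so agreement on spanning elements is enough.
\<close>

lemma \<alpha>_invariant:
  assumes x: "x \<in> carrier A"
  shows "f (\<alpha> s x) = f x"
proof -
  have h: "star_hom A A (\<alpha> s)" by (rule star_hom_\<alpha>)
  have "positive_functional A (\<lambda>x. f (\<alpha> s x))"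
    using h positive unfolding star_hom_def positive_functional_def linear_functional_def by (auto simp: Pi_iff)
  then have "bounded_functional A (Re (f (\<alpha> s unit))) (\<lambda>x. f (\<alpha> s x))"
    by (rule positive_functional_bounded)
  from this bounded show ?thesis
    by (rule functionals_eq_if_eq_on_gens[OF _ _ _ x])
      (auto simp: \<alpha>_gen linear_functional_smult[OF linear] diagonal)
qed

text \<open>
  Both sides are entire in \<open>z\<close>. For real \<open>z = s\<close> they agree by invariance:
  \<open>f(\<alpha>\<^sub>s(a) y) = f(\<alpha>\<^sub>s(a \<alpha>\<^sub>-\<^sub>s(y))) = f(a \<alpha>\<^sub>-\<^sub>s(y))\<close>, where \<open>\<alpha>\<^sub>-\<^sub>s(y)\<close> is a scalar multiple of the spanning
  element \<open>y\<close>.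
\<close>

lemma entire_orbit_identity:
  assumes F: "analytic_extension A \<alpha> a F"
    and p: "\<rho> \<in> paths \<Lambda>" "\<tau> \<in> paths \<Lambda>"
  shows "f (F z \<otimes> gen \<rho> \<tau>) =
    exp (- \<i> * z * of_real (weight \<Lambda> r \<rho> - weight \<Lambda> r \<tau>)) * f (a \<otimes> gen \<rho> \<tau>)"
proof -
  define \<theta> where "\<theta> = weight \<Lambda> r \<rho> - weight \<Lambda> r \<tau>"
  define k where "k z = f (F z \<otimes> gen \<rho> \<tau>) - exp (- \<i> * z * of_real \<theta>) * f (a \<otimes> gen \<rho> \<tau>)" for z
  have ac: "a \<in> carrier A" and F': "entire_into A F" "\<And>s. F (complex_of_real s) = \<alpha> s a"
    using F by (simp_all add: analytic_extension_def)
  have g: "gen \<rho> \<tau> \<in> carrier A" using p by simp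
  have real: "k (of_real s) = 0" for s
  proof -
    have "\<alpha> s (a \<otimes> \<alpha> (- s) (gen \<rho> \<tau>)) = \<alpha> s a \<otimes> \<alpha> s (\<alpha> (- s) (gen \<rho> \<tau>))"
      using star_hom_\<alpha>[of s] ac g \<alpha>_closed by (simp add: star_hom_def)
    also have "\<alpha> s (\<alpha> (- s) (gen \<rho> \<tau>)) = gen \<rho> \<tau>"
      using \<alpha>_add[OF g, of s "- s"] \<alpha>_zero[OF g] by simp
    finally have "f (\<alpha> s a \<otimes> gen \<rho> \<tau>) = f (a \<otimes> \<alpha> (- s) (gen \<rho> \<tau>))"
      using \<alpha>_invariant[of "a \<otimes> \<alpha> (- s) (gen \<rho> \<tau>)" s] ac g \<alpha>_closed by simp
    also have "\<dots> = exp (- \<i> * of_real s * of_real \<theta>) * f (a \<otimes> gen \<rho> \<tau>)"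
      using ac g p by (simp add: \<alpha>_gen \<theta>_def smult_mult_right linear_functional_smult[OF linear])
    finally show ?thesis by (simp add: k_def F')
  qed
  have "(\<lambda>z. f (F z \<otimes> gen \<rho> \<tau>)) holomorphic_on UNIV"
    by (rule entire_into_bounded_functional[OF F'(1) bounded_functional_mult_right[OF bounded g]])
  then have hol: "k holomorphic_on UNIV"
    unfolding k_def[abs_def] by (intro holomorphic_intros)
  have lim: "0 islimpt (\<real> :: complex set)"
    unfolding islimpt_approachable
  proof (intro allI impI)
    fix \<epsilon> :: real assume "0 < \<epsilon>"
    then show "\<exists>x'\<in>\<real>. x' \<noteq> (0::complex) \<and> dist x' 0 < \<epsilon>"
      by (intro bexI[of _ "of_real (\<epsilon> / 2)"]) auto
  qed
  have "k x = 0" if "x \<in> \<real>" for x using that real by (auto simp: Reals_def)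
  from analytic_continuation[OF hol open_UNIV connected_UNIV subset_UNIV UNIV_I lim this UNIV_I]
  have "k z = 0" .
  then show ?thesis by (simp add: k_def \<theta>_def)
qed

text \<open>
  Evaluating at \<open>z = \<i>\<close> cancels against the twist in the commutation relation, which gives the
  KMS condition against spanning elements and hence against everything.
\<close>

theorem kms_condition:
  assumes F: "analytic_extension A \<alpha> a F" and b: "b \<in> carrier A"
  shows "f (a \<otimes> b) = f (b \<otimes> F \<i>)"
proof -
  have ac: "a \<in> carrier A" and Fc: "F \<i> \<in> carrier A"
    using F by (auto simp: analytic_extension_def entire_into_def)
  show ?thesis
  proof (rule functionals_eq_if_eq_on_gens[OF bounded_functional_mult_left[OF bounded ac]
        bounded_functional_mult_right[OF bounded Fc] _ b])
    fix \<rho> \<tau> assume p: "\<rho> \<in> paths \<Lambda>" "\<tau> \<in> paths \<Lambda>" "src \<Lambda> \<rho> = src \<Lambda> \<tau>"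
    have "f (gen \<rho> \<tau> \<otimes> F \<i>) = exp (of_real (weight \<Lambda> r \<tau> - weight \<Lambda> r \<rho>)) * f (F \<i> \<otimes> gen \<rho> \<tau>)"
      by (rule twisted_commute[OF p Fc])
    also have "f (F \<i> \<otimes> gen \<rho> \<tau>) = exp (of_real (weight \<Lambda> r \<rho> - weight \<Lambda> r \<tau>)) * f (a \<otimes> gen \<rho> \<tau>)"
      using entire_orbit_identity[OF F p(1,2), of \<i>] by simp
    finally show "f (a \<otimes> gen \<rho> \<tau>) = f (gen \<rho> \<tau> \<otimes> F \<i>)"
      by (simp add: mult.assoc[symmetric] exp_add[symmetric] of_real_add[symmetric]
          del: of_real_add of_real_diff)
  qed
qed

end

lemma (in diagonal_functional) kms_state:
  assumes "cstar_state A f" shows "kms_state A \<alpha> 1 f"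
  using assms kms_condition
  by (auto simp: kms_state_def analytic_element_def analytic_extension_def)

context toeplitz_system
begin

text \<open>
  The functional \<open>f\<close> is applied to (T4), the values \<open>f(t\<^sub>\<xi>t\<^sub>\<xi>\<^sup>*)\<close> are those of \<open>kms_state_gen\<close>, and the paths
  are grouped by their sources.
\<close>

lemma kms_state_subinvariant:
  assumes f: "kms_state A \<alpha> 1 f" and indep: "rationally_independent (fst r) (snd r)"
    and z: "z \<in> vertices \<Lambda>"
  shows "exp (- (fst r * real (fst n) + snd r * real (snd n))) *
    (\<Sum>x\<in>vertices \<Lambda>. card (paths_between \<Lambda> z n x) * Re (f (t x))) \<le> Re (f (t z))"
proof -
  have st: "cstar_state A f" using f by (simp add: kms_state_def)
  have pos: "positive_functional A f" by (rule cstar_state_positive[OF st])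
  then have lin: "linear_functional A f" by (simp add: positive_functional_def)
  let ?P = "paths_at \<Lambda> z n"
  let ?c = "exp (- (fst r * real (fst n) + snd r * real (snd n)))"
  have p: "\<xi> \<in> paths \<Lambda>" "deg \<Lambda> \<xi> = n" if "\<xi> \<in> ?P" for \<xi> using that by (auto simp: paths_at_def)
  have sc: "(\<Oplus>\<xi>\<in>?P. t \<xi> \<otimes> invol A (t \<xi>)) \<in> carrier A" using p by (intro M.finsum_closed) auto
  obtain c where c: "c \<in> carrier A" "t z \<ominus> (\<Oplus>\<xi>\<in>?P. t \<xi> \<otimes> invol A (t \<xi>)) = invol A c \<otimes> c"
    using toeplitz_inequality[OF z, of n] by (auto simp: cstar_le_def)
  have "0 \<le> Re (f (t z \<ominus> (\<Oplus>\<xi>\<in>?P. t \<xi> \<otimes> invol A (t \<xi>))))"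
    using pos c by (simp add: positive_functional_def complex_nonneg_Reals_iff)
  also have "f (t z \<ominus> (\<Oplus>\<xi>\<in>?P. t \<xi> \<otimes> invol A (t \<xi>))) = f (t z) - f (\<Oplus>\<xi>\<in>?P. t \<xi> \<otimes> invol A (t \<xi>))"
    using sc z by (intro linear_functional_minus[OF lin]) (auto simp: vertex_path)
  also have "f (\<Oplus>\<xi>\<in>?P. t \<xi> \<otimes> invol A (t \<xi>)) = (\<Sum>\<xi>\<in>?P. f (t \<xi> \<otimes> invol A (t \<xi>)))"
    using p finite_paths_at by (intro linear_functional_finsum[OF lin]) auto
  also have "\<dots> = (\<Sum>\<xi>\<in>?P. of_real ?c * f (t (src \<Lambda> \<xi>)))"
  proof (rule sum.cong[OF refl])
    fix \<xi> assume "\<xi> \<in> ?P"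
    note x = p[OF this]
    have "f (gen \<xi> \<xi>) = exp (- of_real (weight \<Lambda> r \<xi>)) * f (t (src \<Lambda> \<xi>))"
      using kms_state_gen[OF f indep x(1) x(1)] by simp
    then show "f (t \<xi> \<otimes> invol A (t \<xi>)) = of_real ?c * f (t (src \<Lambda> \<xi>))"
      unfolding gen_def weight_def x(2) by (simp only: exp_of_real[symmetric] of_real_minus)
  qed
  also have "Re (f (t z) - (\<Sum>\<xi>\<in>?P. of_real ?c * f (t (src \<Lambda> \<xi>)))) =
      Re (f (t z)) - ?c * (\<Sum>\<xi>\<in>?P. Re (f (t (src \<Lambda> \<xi>))))"
    by (simp add: sum_distrib_left)
  also have "(\<Sum>\<xi>\<in>?P. Re (f (t (src \<Lambda> \<xi>)))) =
      (\<Sum>x\<in>vertices \<Lambda>. \<Sum>\<xi>\<in>{\<xi> \<in> ?P. src \<Lambda> \<xi> = x}. Re (f (t (src \<Lambda> \<xi>))))"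
    using p by (intro sum.group[symmetric] finite_paths_at finite_vertices) (auto simp: src_in_vertices)
  also have "\<dots> = (\<Sum>x\<in>vertices \<Lambda>. card (paths_between \<Lambda> z n x) * Re (f (t x)))"
    by (simp add: paths_between_def)
  finally show ?thesis by simp
qed

lemma kms_state_vertex_nonneg:
  assumes f: "kms_state A \<alpha> 1 f" and z: "z \<in> vertices \<Lambda>"
  shows "f (t z) \<in> \<real>\<^sub>\<ge>\<^sub>0"
proof -
  have "positive_functional A f" using f cstar_state_positive by (simp add: kms_state_def)
  then have "f (invol A (t z) \<otimes> t z) \<in> \<real>\<^sub>\<ge>\<^sub>0" using z by (simp add: positive_functional_def vertex_path)
  then show ?thesis
    using z invol_t_mult_t[of z] vertex_rng_src[OF z] by (simp add: vertex_path)
qed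

lemma kms_state_vertices_sum:
  assumes f: "kms_state A \<alpha> 1 f"
  shows "(\<Sum>z\<in>vertices \<Lambda>. f (t z)) = 1"
proof -
  have st: "cstar_state A f" using f by (simp add: kms_state_def)
  then have "linear_functional A f" using cstar_state_positive by (simp add: positive_functional_def)
  then have "f unit = (\<Sum>z\<in>vertices \<Lambda>. f (t z))"
    unfolding unit_def using finite_vertices by (intro linear_functional_finsum) (auto simp: vertex_path)
  then show ?thesis using cstar_state_unit[OF st] by simp
qed

lemma states_eqI:
  assumes f: "cstar_state A f" and g: "cstar_state A g"
    and eq: "\<And>\<mu> \<nu>. \<lbrakk>\<mu> \<in> paths \<Lambda>; \<nu> \<in> paths \<Lambda>; src \<Lambda> \<mu> = src \<Lambda> \<nu>\<rbrakk> \<Longrightarrow> f (gen \<mu> \<nu>) = g (gen \<mu> \<nu>)"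
  shows "f = g"
proof (rule extensionalityI)
  show "f \<in> extensional (carrier A)" "g \<in> extensional (carrier A)"
    using f g by (simp_all add: cstar_state_def)
  show "f x = g x" if "x \<in> carrier A" for x
    using functionals_eq_if_eq_on_gens[OF positive_functional_bounded[OF cstar_state_positive[OF f]]
        positive_functional_bounded[OF cstar_state_positive[OF g]] eq that] .
qed

end


section \<open>Square summable sequences\<close>

text \<open>
  The sequences are complex, but the type carries the underlying real Hilbert space structure, because the
  classes of inner product and Banach spaces, and the Banach space of bounded operators, are real.
  The complex structure reappears as the operator \<open>times_i\<close>.
\<close>

typedef ell2 = "{x :: nat \<Rightarrow> complex. (\<lambda>n. (cmod (x n))\<^sup>2) summable_on UNIV}"
  morphisms coord Abs_ell2
  by (rule exI[of _ "\<lambda>_. 0"]) simp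

lemma coord_summable: "(\<lambda>n. (cmod (coord x n))\<^sup>2) summable_on UNIV"
  using coord[of x] by simp

lemma ell2_eqI: "(\<And>n. coord x n = coord y n) \<Longrightarrow> x = y"
  by (simp add: coord_inject[symmetric] fun_eq_iff)

lemma coord_Abs_ell2:
  "(\<lambda>n. (cmod (x n))\<^sup>2) summable_on UNIV \<Longrightarrow> coord (Abs_ell2 x) = x"
  by (simp add: Abs_ell2_inverse)

lemma square_summable_add:
  fixes x y :: "nat \<Rightarrow> complex"
  assumes "(\<lambda>n. (cmod (x n))\<^sup>2) summable_on UNIV" "(\<lambda>n. (cmod (y n))\<^sup>2) summable_on UNIV"
  shows "(\<lambda>n. (cmod (x n + y n))\<^sup>2) summable_on UNIV"
proof (rule summable_on_comparison_test)
  show "(\<lambda>n. 2 * (cmod (x n))\<^sup>2 + 2 * (cmod (y n))\<^sup>2) summable_on UNIV"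
    using assms by (intro summable_on_add summable_on_cmult_right)
  show "(cmod (x n + y n))\<^sup>2 \<le> 2 * (cmod (x n))\<^sup>2 + 2 * (cmod (y n))\<^sup>2" for n
  proof -
    have "(cmod (x n + y n))\<^sup>2 \<le> (cmod (x n) + cmod (y n))\<^sup>2"
      by (intro power_mono norm_triangle_ineq) simp
    also have "\<dots> \<le> 2 * (cmod (x n))\<^sup>2 + 2 * (cmod (y n))\<^sup>2"
      using sum_squares_bound[of "cmod (x n)" "cmod (y n)"] by (simp add: power2_sum)
    finally show ?thesis .
  qed
qed simp

lemma square_summable_mult:
  fixes x :: "nat \<Rightarrow> complex"
  assumes "(\<lambda>n. (cmod (x n))\<^sup>2) summable_on UNIV"
  shows "(\<lambda>n. (cmod (c * x n))\<^sup>2) summable_on UNIV"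
  using summable_on_cmult_right[OF assms, of "(cmod c)\<^sup>2"] by (simp add: norm_mult power_mult_distrib)

instantiation ell2 :: real_inner
begin

definition "0 = Abs_ell2 (\<lambda>_. 0)"
definition "x + y = Abs_ell2 (\<lambda>n. coord x n + coord y n)"
definition "- x = Abs_ell2 (\<lambda>n. - coord x n)"
definition "x - y = Abs_ell2 (\<lambda>n. coord x n - coord y n)"
definition "r *\<^sub>R x = Abs_ell2 (\<lambda>n. of_real r * coord x n)"
definition "inner x y = (\<Sum>\<^sub>\<infinity>n. coord x n \<bullet> coord y n)"
definition "norm x = sqrt (inner x x)" for x :: ell2
definition "dist x y = norm (x - y)" for x y :: ell2
definition "sgn x = inverse (norm x) *\<^sub>R x" for x :: ell2
definition "(uniformity :: (ell2 \<times> ell2) filter) = (INF e\<in>{0 <..}. principal {(x, y). dist x y < e})"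
definition "open (U :: ell2 set) = (\<forall>x\<in>U. eventually (\<lambda>(x', y). x' = x \<longrightarrow> y \<in> U) uniformity)"

lemma coord_simps [simp]:
  "coord 0 n = 0"
  "coord (x + y) n = coord x n + coord y n"
  "coord (- x) n = - coord x n"
  "coord (x - y) n = coord x n - coord y n"
  "coord (r *\<^sub>R x) n = of_real r * coord x n"
proof -
  show "coord 0 n = 0" by (simp add: zero_ell2_def coord_Abs_ell2)
  show "coord (x + y) n = coord x n + coord y n"
    by (simp add: plus_ell2_def coord_Abs_ell2 square_summable_add coord_summable)
  have neg: "(\<lambda>n. (cmod (- coord z n))\<^sup>2) summable_on UNIV" for z
    by (simp add: coord_summable)
  show "coord (- x) n = - coord x n"
    by (simp add: uminus_ell2_def coord_Abs_ell2[OF neg])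
  have "(\<lambda>n. (cmod (coord x n - coord y n))\<^sup>2) summable_on UNIV"
    using square_summable_add[OF coord_summable[of x] neg[of y]] by simp
  then show "coord (x - y) n = coord x n - coord y n"
    by (simp add: minus_ell2_def coord_Abs_ell2)
  show "coord (r *\<^sub>R x) n = of_real r * coord x n"
    by (simp add: scaleR_ell2_def coord_Abs_ell2[OF square_summable_mult[OF coord_summable]])
qed

lemma inner_coord_summable: "(\<lambda>n. coord x n \<bullet> coord y n) summable_on UNIV"
proof (rule abs_summable_summable, rule Infinite_Sum.abs_summable_on_comparison_test')
  show "(\<lambda>n. (cmod (coord x n))\<^sup>2 + (cmod (coord y n))\<^sup>2) summable_on UNIV"
    by (intro summable_on_add coord_summable)
  show "norm (coord x n \<bullet> coord y n) \<le> (cmod (coord x n))\<^sup>2 + (cmod (coord y n))\<^sup>2" for n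
  proof -
    have "\<bar>coord x n \<bullet> coord y n\<bar> \<le> cmod (coord x n) * cmod (coord y n)"
      by (rule Cauchy_Schwarz_ineq2)
    also have "\<dots> \<le> (cmod (coord x n))\<^sup>2 + (cmod (coord y n))\<^sup>2"
      using sum_squares_bound[of "cmod (coord x n)" "cmod (coord y n)"]
        mult_nonneg_nonneg[OF norm_ge_zero norm_ge_zero, of "coord x n" "coord y n"] by linarith
    finally show ?thesis by simp
  qed
qed

instance
proof
  fix x y z :: ell2 and r s :: real
  show "x + y + z = x + (y + z)" "x + y = y + x" "0 + x = x" "- x + x = 0" "x - y = x + - y"
    "r *\<^sub>R (x + y) = r *\<^sub>R x + r *\<^sub>R y" "(r + s) *\<^sub>R x = r *\<^sub>R x + s *\<^sub>R x"
    "r *\<^sub>R s *\<^sub>R x = (r * s) *\<^sub>R x" "1 *\<^sub>R x = x"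
    by (rule ell2_eqI; simp add: algebra_simps)+
  show "inner x y = inner y x"
    by (simp add: inner_ell2_def inner_commute)
  show "inner (x + y) z = inner x z + inner y z"
    by (simp add: inner_ell2_def inner_add_left infsum_add inner_coord_summable)
  have "of_real r * (c :: complex) = r *\<^sub>R c" for c by (simp add: scaleR_conv_of_real)
  then show "inner (r *\<^sub>R x) y = r * inner x y"
    by (simp add: inner_ell2_def infsum_cmult_right')
  show "0 \<le> inner x x"
    by (simp add: inner_ell2_def infsum_nonneg)
  show "inner x x = 0 \<longleftrightarrow> x = 0"
  proof
    assume "inner x x = 0"
    then have "coord x n \<bullet> coord x n = 0" for n
      using nonneg_infsum_le_0D[OF _ inner_coord_summable[of x x], of n]
      by (auto simp: inner_ell2_def)
    then show "x = 0" by (intro ell2_eqI) simp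
  qed (simp add: inner_ell2_def)
qed (simp_all add: norm_ell2_def dist_ell2_def sgn_ell2_def uniformity_ell2_def open_ell2_def)

end

lemma coord_norm_le: "cmod (coord x n) \<le> norm x"
proof -
  have "(\<Sum>k\<in>{n}. coord x k \<bullet> coord x k) \<le> inner x x"
    unfolding inner_ell2_def by (rule finite_sum_le_infsum[OF inner_coord_summable]) auto
  then show ?thesis
    by (simp add: norm_eq_sqrt_inner)
qed

lemma norm_ell2_leI:
  assumes "\<And>F. finite F \<Longrightarrow> (\<Sum>n\<in>F. (cmod (coord x n))\<^sup>2) \<le> K\<^sup>2" "0 \<le> K"
  shows "norm x \<le> K"
proof -
  have "inner x x \<le> K\<^sup>2"
    unfolding inner_ell2_def
    using assms(1) by (intro infsum_le_finite_sums inner_coord_summable) (simp add: power2_norm_eq_inner)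
  then show ?thesis
    using assms(2) by (simp add: norm_eq_sqrt_inner real_le_lsqrt)
qed

lemma finite_coord_sum_le: "finite F \<Longrightarrow> (\<Sum>n\<in>F. (cmod (coord x n))\<^sup>2) \<le> (norm x)\<^sup>2"
proof -
  assume "finite F"
  then have "(\<Sum>n\<in>F. coord x n \<bullet> coord x n) \<le> inner x x"
    unfolding inner_ell2_def by (rule finite_sum_le_infsum[OF inner_coord_summable]) auto
  then show ?thesis by (simp add: power2_norm_eq_inner)
qed

instance ell2 :: banach
proof
  fix \<sigma> :: "nat \<Rightarrow> ell2" assume \<sigma>: "Cauchy \<sigma>"
  have "Cauchy (\<lambda>k. coord (\<sigma> k) n)" for n
    unfolding Cauchy_def
  proof (intro allI impI)
    fix e :: real assume "0 < e"
    then obtain M where "\<forall>m\<ge>M. \<forall>k\<ge>M. dist (\<sigma> m) (\<sigma> k) < e"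
      using \<sigma> by (auto simp: Cauchy_def)
    moreover have "dist (coord (\<sigma> m) n) (coord (\<sigma> k) n) \<le> dist (\<sigma> m) (\<sigma> k)" for m k
      using coord_norm_le[of "\<sigma> m - \<sigma> k" n] by (simp add: dist_norm)
    ultimately show "\<exists>M. \<forall>m\<ge>M. \<forall>k\<ge>M. dist (coord (\<sigma> m) n) (coord (\<sigma> k) n) < e"
      by (meson le_less_trans)
  qed
  then have "\<exists>l. (\<lambda>k. coord (\<sigma> k) n) \<longlonglongrightarrow> l" for n
    using Cauchy_convergent convergent_def by blast
  then obtain l where l: "\<And>n. (\<lambda>k. coord (\<sigma> k) n) \<longlonglongrightarrow> l n" by metis
  \<comment> \<open>Fatou's argument: bounds on finite partial sums survive the coordinatewise limit.\<close>
  have tail: "(\<Sum>n\<in>F. (cmod (coord (\<sigma> m) n - l n))\<^sup>2) \<le> e\<^sup>2"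
    if F: "finite F" and M: "\<forall>k\<ge>M. dist (\<sigma> m) (\<sigma> k) < e" for m M e F
  proof (rule Lim_bounded)
    show "(\<lambda>k. \<Sum>n\<in>F. (cmod (coord (\<sigma> m) n - coord (\<sigma> k) n))\<^sup>2)
        \<longlonglongrightarrow> (\<Sum>n\<in>F. (cmod (coord (\<sigma> m) n - l n))\<^sup>2)"
      by (intro tendsto_intros l)
    show "\<forall>k\<ge>M. (\<Sum>n\<in>F. (cmod (coord (\<sigma> m) n - coord (\<sigma> k) n))\<^sup>2) \<le> e\<^sup>2"
    proof (intro allI impI)
      fix k assume "M \<le> k"
      have "(\<Sum>n\<in>F. (cmod (coord (\<sigma> m) n - coord (\<sigma> k) n))\<^sup>2) \<le> (norm (\<sigma> m - \<sigma> k))\<^sup>2"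
        using finite_coord_sum_le[OF F, of "\<sigma> m - \<sigma> k"] by simp
      also have "\<dots> \<le> e\<^sup>2"
        using M \<open>M \<le> k\<close> by (intro power_mono) (auto simp: dist_norm intro: less_imp_le)
      finally show "(\<Sum>n\<in>F. (cmod (coord (\<sigma> m) n - coord (\<sigma> k) n))\<^sup>2) \<le> e\<^sup>2" .
    qed
  qed
  have diff_summable: "(\<lambda>n. (cmod (coord (\<sigma> m) n - l n))\<^sup>2) summable_on UNIV"
    if M: "\<forall>k\<ge>M. dist (\<sigma> m) (\<sigma> k) < e" for m M e
    using tail[OF _ M] by (intro nonneg_bdd_above_summable_on) (auto simp: bdd_above_def)
  obtain M1 where "\<forall>m\<ge>M1. \<forall>k\<ge>M1. dist (\<sigma> m) (\<sigma> k) < 1"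
    using \<sigma> zero_less_one unfolding Cauchy_def by blast
  then have "(\<lambda>n. (cmod (coord (\<sigma> M1) n - l n))\<^sup>2) summable_on UNIV"
    by (intro diff_summable) auto
  from square_summable_add[OF square_summable_mult[OF this, of "-1"] coord_summable[of "\<sigma> M1"]]
  have lsum: "(\<lambda>n. (cmod (l n))\<^sup>2) summable_on UNIV" by simp
  define L where "L = Abs_ell2 l"
  have L: "coord L n = l n" for n by (simp add: L_def coord_Abs_ell2[OF lsum])
  have "\<sigma> \<longlonglongrightarrow> L"
  proof (rule metric_LIMSEQ_I)
    fix e :: real assume "0 < e"
    then obtain M where M: "\<forall>m\<ge>M. \<forall>k\<ge>M. dist (\<sigma> m) (\<sigma> k) < e / 2"
      using \<sigma> half_gt_zero unfolding Cauchy_def by blast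
    have "dist (\<sigma> m) L < e" if "M \<le> m" for m
    proof -
      have "norm (\<sigma> m - L) \<le> e / 2"
        using tail[of _ M m "e / 2"] M that \<open>0 < e\<close> by (intro norm_ell2_leI) (auto simp: L)
      then show ?thesis using \<open>0 < e\<close> by (simp add: dist_norm)
    qed
    then show "\<exists>no. \<forall>n\<ge>no. dist (\<sigma> n) L < e" by blast
  qed
  then show "convergent \<sigma>" by (auto simp: convergent_def)
qed

definition times_i :: "ell2 \<Rightarrow>\<^sub>L ell2" where
  "times_i = Blinfun (\<lambda>x. Abs_ell2 (\<lambda>n. \<i> * coord x n))"

lemma coord_mult_Abs: "coord (Abs_ell2 (\<lambda>n. c * coord x n)) n = c * coord x n"
  by (simp add: coord_Abs_ell2[OF square_summable_mult[OF coord_summable]])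

lemma coord_times_i [simp]: "coord (times_i x) n = \<i> * coord x n"
proof -
  have "bounded_linear (\<lambda>x. Abs_ell2 (\<lambda>n. \<i> * coord x n))"
  proof (rule bounded_linear_intro[where K=1])
    fix x y :: ell2 and r :: real
    show "Abs_ell2 (\<lambda>n. \<i> * coord (x + y) n) = Abs_ell2 (\<lambda>n. \<i> * coord x n) + Abs_ell2 (\<lambda>n. \<i> * coord y n)"
      "Abs_ell2 (\<lambda>n. \<i> * coord (r *\<^sub>R x) n) = r *\<^sub>R Abs_ell2 (\<lambda>n. \<i> * coord x n)"
      by (rule ell2_eqI; simp only: coord_mult_Abs; simp add: coord_mult_Abs algebra_simps)+
    show "norm (Abs_ell2 (\<lambda>n. \<i> * coord x n)) \<le> norm x * 1"
      using finite_coord_sum_le[of _ x]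
      by (intro norm_ell2_leI) (simp_all only: coord_mult_Abs, simp_all add: norm_mult)
  qed
  then show ?thesis
    by (simp add: times_i_def bounded_linear_Blinfun_apply coord_mult_Abs)
qed

lemma times_i_times_i [simp]: "times_i (times_i x) = - x"
  by (rule ell2_eqI) (simp add: mult.assoc[symmetric])

lemma inner_times_i: "times_i x \<bullet> y = - (x \<bullet> times_i y)"
proof -
  have "(\<i> * a) \<bullet> b = - (a \<bullet> (\<i> * b))" for a b :: complex
    by (simp add: inner_complex_def)
  then show ?thesis by (simp add: inner_ell2_def infsum_uminus)
qed


section \<open>The C*-algebra of operators on square summable sequences\<close>

text \<open>
  Adjoints are taken with respect to the real inner product. For operators that commute with \<open>times_i\<close>
  they are also the adjoints with respect to the complex one.
\<close>

definition is_adjoint :: "(ell2 \<Rightarrow>\<^sub>L ell2) \<Rightarrow> (ell2 \<Rightarrow>\<^sub>L ell2) \<Rightarrow> bool" where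
  "is_adjoint S S' \<longleftrightarrow> (\<forall>x y. blinfun_apply S x \<bullet> y = x \<bullet> blinfun_apply S' y)"

definition adj :: "(ell2 \<Rightarrow>\<^sub>L ell2) \<Rightarrow> (ell2 \<Rightarrow>\<^sub>L ell2)" where
  "adj S = (THE S'. is_adjoint S S')"

text \<open>
  Commuting with \<open>times_i\<close> is complex linearity. Having an adjoint is part of the definition; that this
  property survives norm limits is shown in \<open>ops_limit\<close>.
\<close>

definition ops :: "(ell2 \<Rightarrow>\<^sub>L ell2) set" where
  "ops = {S. (\<forall>x. blinfun_apply S (times_i x) = times_i (blinfun_apply S x)) \<and> (\<exists>S'. is_adjoint S S')}"

definition cscale :: "complex \<Rightarrow> (ell2 \<Rightarrow>\<^sub>L ell2) \<Rightarrow> (ell2 \<Rightarrow>\<^sub>L ell2)" where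
  "cscale c S = Re c *\<^sub>R S + Im c *\<^sub>R (times_i o\<^sub>L S)"

lemma is_adjoint_sym: "is_adjoint S S' \<Longrightarrow> is_adjoint S' S"
  by (simp add: is_adjoint_def) (metis inner_commute)

lemma is_adjoint_unique: "is_adjoint S S1 \<Longrightarrow> is_adjoint S S2 \<Longrightarrow> S1 = S2"
  by (intro blinfun_eqI) (metis is_adjoint_def vector_eq_ldot)

lemma adj_eq: "is_adjoint S S' \<Longrightarrow> adj S = S'"
  unfolding adj_def by (rule the_equality) (auto dest: is_adjoint_unique)

lemma adj_is_adjoint: "S \<in> ops \<Longrightarrow> is_adjoint S (adj S)"
  by (auto simp: ops_def adj_eq)

lemma ops_times_i: "S \<in> ops \<Longrightarrow> S (times_i x) = times_i (S x)"
  by (simp add: ops_def)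

lemma is_adjoint_times_i: "is_adjoint times_i (- times_i)"
  by (simp add: is_adjoint_def inner_times_i blinfun.bilinear_simps)

lemma is_adjoint_zero: "is_adjoint 0 0"
  by (simp add: is_adjoint_def)

lemma is_adjoint_add: "is_adjoint S S' \<Longrightarrow> is_adjoint R R' \<Longrightarrow> is_adjoint (S + R) (S' + R')"
  by (simp add: is_adjoint_def blinfun.bilinear_simps inner_add_left inner_add_right)

lemma is_adjoint_scaleR: "is_adjoint S S' \<Longrightarrow> is_adjoint (r *\<^sub>R S) (r *\<^sub>R S')"
  by (simp add: is_adjoint_def blinfun.bilinear_simps)

lemma is_adjoint_compose: "is_adjoint S S' \<Longrightarrow> is_adjoint R R' \<Longrightarrow> is_adjoint (S o\<^sub>L R) (R' o\<^sub>L S')"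
  by (simp add: is_adjoint_def)

lemma ops_zero: "0 \<in> ops"
  using is_adjoint_zero by (auto simp: ops_def blinfun.bilinear_simps)

lemma ops_add: "S \<in> ops \<Longrightarrow> R \<in> ops \<Longrightarrow> S + R \<in> ops"
  using is_adjoint_add by (fastforce simp: ops_def blinfun.bilinear_simps)

lemma ops_compose: "S \<in> ops \<Longrightarrow> R \<in> ops \<Longrightarrow> S o\<^sub>L R \<in> ops"
  using is_adjoint_compose by (fastforce simp: ops_def)

lemma ops_adj: "S \<in> ops \<Longrightarrow> adj S \<in> ops"
proof -
  assume S: "S \<in> ops"
  note a = adj_is_adjoint[OF S]
  have "adj S (times_i x) = times_i (adj S x)" for x
  proof -
    have "y \<bullet> adj S (times_i x) = y \<bullet> times_i (adj S x)" for y
    proof -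
      have "y \<bullet> adj S (times_i x) = S y \<bullet> times_i x" using a by (simp add: is_adjoint_def)
      also have "\<dots> = - (S (times_i y) \<bullet> x)" by (simp add: ops_times_i[OF S] inner_times_i)
      also have "\<dots> = - (times_i y \<bullet> adj S x)" using a by (simp add: is_adjoint_def)
      also have "\<dots> = y \<bullet> times_i (adj S x)" by (simp add: inner_times_i)
      finally show ?thesis .
    qed
    then show ?thesis by (metis vector_eq_ldot)
  qed
  then show ?thesis using is_adjoint_sym[OF a] by (auto simp: ops_def)
qed

lemma is_adjoint_cscale:
  assumes "S \<in> ops" shows "is_adjoint (cscale c S) (cscale (cnj c) (adj S))"
proof -
  have "is_adjoint (cscale c S) (Re c *\<^sub>R adj S + Im c *\<^sub>R (adj S o\<^sub>L - times_i))"
    unfolding cscale_def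
    by (intro is_adjoint_add is_adjoint_scaleR is_adjoint_compose is_adjoint_times_i adj_is_adjoint assms)
  also have "Re c *\<^sub>R adj S + Im c *\<^sub>R (adj S o\<^sub>L - times_i) = cscale (cnj c) (adj S)"
    by (rule blinfun_eqI) (simp add: cscale_def blinfun.bilinear_simps ops_times_i[OF ops_adj[OF assms]])
  finally show ?thesis .
qed

lemma ops_cscale: "S \<in> ops \<Longrightarrow> cscale c S \<in> ops"
proof -
  assume S: "S \<in> ops"
  have "cscale c S (times_i x) = times_i (cscale c S x)" for x
    by (simp add: cscale_def blinfun.add_left blinfun.add_right blinfun.scaleR_left blinfun.scaleR_right
        ops_times_i[OF S])
  then show ?thesis using is_adjoint_cscale[OF S] by (auto simp: ops_def)
qed

lemma adj_adj: "S \<in> ops \<Longrightarrow> adj (adj S) = S"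
  by (rule adj_eq, rule is_adjoint_sym, rule adj_is_adjoint)

text \<open>
  \<open>S x\<close> and \<open>times_i (S x)\<close> are orthogonal and have the same length.
\<close>

lemma norm_cscale: "norm (cscale c S x) = cmod c * norm (S x)"
proof -
  let ?y = "S x"
  have orth: "times_i ?y \<bullet> ?y = 0" using inner_times_i[of ?y ?y] by (simp add: inner_commute)
  have iso: "times_i ?y \<bullet> times_i ?y = ?y \<bullet> ?y" using inner_times_i[of ?y "times_i ?y"] by simp
  have "cscale c S x \<bullet> cscale c S x = ((Re c)\<^sup>2 + (Im c)\<^sup>2) * (?y \<bullet> ?y)"
    by (simp add: cscale_def blinfun.bilinear_simps inner_add_left
        inner_add_right orth iso inner_commute[of ?y "times_i ?y"])
      (simp add: algebra_simps power2_eq_square)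
  then show ?thesis
    by (simp add: norm_eq_sqrt_inner[where 'a=ell2] cmod_def real_sqrt_mult)
qed

lemma norm_cscale_op: "norm (cscale c S) = cmod c * norm S"
proof (cases "c = 0")
  case False
  have "norm S \<le> norm (cscale c S) / cmod c"
  proof (rule norm_blinfun_bound)
    fix x
    have "cmod c * norm (S x) \<le> norm (cscale c S) * norm x"
      using norm_blinfun[of "cscale c S" x] by (simp add: norm_cscale)
    then show "norm (S x) \<le> norm (cscale c S) / cmod c * norm x"
      using False by (simp add: field_simps)
  qed simp
  then have "cmod c * norm S \<le> norm (cscale c S)" using False by (simp add: field_simps)
  moreover have "norm (cscale c S) \<le> cmod c * norm S"
    by (rule norm_blinfun_bound) (auto simp: norm_cscale mult.assoc intro!: mult_left_mono norm_blinfun)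
  ultimately show ?thesis by simp
qed (simp add: cscale_def)

text \<open>The C*-identity is the Cauchy--Schwarz inequality \<open>|Sx|\<^sup>2 = (x, S*Sx) \<le> |S*S||x|\<^sup>2\<close>.\<close>

lemma norm_square_le:
  assumes S: "S \<in> ops" shows "(norm S)\<^sup>2 \<le> norm (adj S o\<^sub>L S)"
proof -
  have "norm S \<le> sqrt (norm (adj S o\<^sub>L S))"
  proof (rule norm_blinfun_bound)
    fix x
    have "(norm (S x))\<^sup>2 = x \<bullet> (adj S o\<^sub>L S) x"
      using adj_is_adjoint[OF S] by (simp add: power2_norm_eq_inner is_adjoint_def)
    also have "\<dots> \<le> norm x * norm ((adj S o\<^sub>L S) x)" by (rule norm_cauchy_schwarz)
    also have "\<dots> \<le> norm x * (norm (adj S o\<^sub>L S) * norm x)"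
      by (intro mult_left_mono norm_blinfun) simp
    finally have "(norm (S x))\<^sup>2 \<le> (sqrt (norm (adj S o\<^sub>L S)) * norm x)\<^sup>2"
      by (simp add: power_mult_distrib power2_eq_square mult_ac)
    then show "norm (S x) \<le> sqrt (norm (adj S o\<^sub>L S)) * norm x"
      by (rule power2_le_imp_le) simp
  qed simp
  then show ?thesis by (metis norm_ge_zero real_sqrt_le_iff real_sqrt_pow2 real_sqrt_abs abs_norm_cancel)
qed

lemma norm_adj:
  assumes S: "S \<in> ops" shows "norm (adj S) = norm S"
proof -
  have le: "norm R \<le> norm (adj R)" if R: "R \<in> ops" for R
  proof -
    have "norm R * norm R \<le> norm (adj R) * norm R"
      using norm_square_le[OF R] norm_blinfun_compose[of "adj R" R] by (simp add: power2_eq_square)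
    then show ?thesis by (cases "norm R = 0") auto
  qed
  show ?thesis
    using le[OF S] le[OF ops_adj[OF S]] adj_adj[OF S] by simp
qed

lemma norm_adj_compose: "S \<in> ops \<Longrightarrow> norm (adj S o\<^sub>L S) = (norm S)\<^sup>2"
  using norm_square_le[of S] norm_blinfun_compose[of "adj S" S] norm_adj[of S]
  by (simp add: power2_eq_square)

text \<open>
  Passing to adjoints is isometric, so the adjoints of a convergent sequence are a Cauchy sequence, whose
  limit is an adjoint of the limit.
\<close>

lemma ops_limit:
  assumes \<sigma>: "\<And>n. \<sigma> n \<in> ops" and lim: "\<sigma> \<longlonglongrightarrow> S"
  shows "S \<in> ops"
proof -
  have ap: "(\<lambda>n. \<sigma> n x) \<longlonglongrightarrow> S x" for x
    by (intro tendsto_intros lim)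
  have "S (times_i x) = times_i (S x)" for x
  proof (rule LIMSEQ_unique)
    show "(\<lambda>n. \<sigma> n (times_i x)) \<longlonglongrightarrow> S (times_i x)" by (rule ap)
    show "(\<lambda>n. \<sigma> n (times_i x)) \<longlonglongrightarrow> times_i (S x)"
      unfolding ops_times_i[OF \<sigma>] by (intro tendsto_intros ap)
  qed
  moreover have "Cauchy (\<lambda>n. adj (\<sigma> n))"
    unfolding Cauchy_def
  proof (intro allI impI)
    fix e :: real assume "0 < e"
    then obtain M where M: "\<forall>m\<ge>M. \<forall>n\<ge>M. dist (\<sigma> m) (\<sigma> n) < e"
      using LIMSEQ_imp_Cauchy[OF lim] unfolding Cauchy_def by blast
    have "dist (adj (\<sigma> m)) (adj (\<sigma> n)) = dist (\<sigma> m) (\<sigma> n)" for m n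
    proof -
      have neg: "is_adjoint (- \<sigma> n) (- adj (\<sigma> n))"
        using adj_is_adjoint[OF \<sigma>, of n] by (simp add: is_adjoint_def blinfun.bilinear_simps)
      then have "- \<sigma> n \<in> ops"
        using \<sigma>[of n] by (auto simp: ops_def blinfun.bilinear_simps)
      then have "\<sigma> m - \<sigma> n \<in> ops" using ops_add[OF \<sigma>] by fastforce
      moreover have "is_adjoint (\<sigma> m - \<sigma> n) (adj (\<sigma> m) - adj (\<sigma> n))"
        using is_adjoint_add[OF adj_is_adjoint[OF \<sigma>] neg, of m] by simp
      ultimately show ?thesis using norm_adj adj_eq by (metis dist_norm)
    qed
    with M show "\<exists>M. \<forall>m\<ge>M. \<forall>n\<ge>M. dist (adj (\<sigma> m)) (adj (\<sigma> n)) < e" by auto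
  qed
  then obtain S' where S': "(\<lambda>n. adj (\<sigma> n)) \<longlonglongrightarrow> S'"
    using Cauchy_convergent convergent_def by blast
  have "S x \<bullet> y = x \<bullet> S' y" for x y
  proof (rule LIMSEQ_unique)
    show "(\<lambda>n. \<sigma> n x \<bullet> y) \<longlonglongrightarrow> S x \<bullet> y" by (intro tendsto_intros ap)
    have "\<sigma> n x \<bullet> y = x \<bullet> adj (\<sigma> n) y" for n
      using adj_is_adjoint[OF \<sigma>] by (simp add: is_adjoint_def)
    then show "(\<lambda>n. \<sigma> n x \<bullet> y) \<longlonglongrightarrow> x \<bullet> S' y"
      by (simp, intro tendsto_intros S')
  qed
  ultimately show ?thesis by (auto simp: ops_def is_adjoint_def)
qed

text \<open>
  The operators have to be presented inside the type \<open>test_carrier\<close>, so they are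
  encoded as functions on sequences.
\<close>

definition encode :: "(ell2 \<Rightarrow>\<^sub>L ell2) \<Rightarrow> test_carrier" where
  "encode S = (\<lambda>f. coord (blinfun_apply S (Abs_ell2 f)))"

definition decode :: "test_carrier \<Rightarrow> (ell2 \<Rightarrow>\<^sub>L ell2)" where
  "decode = inv_into UNIV encode"

lemma decode_encode [simp]: "decode (encode S) = S"
proof -
  have "inj encode"
  proof (rule injI)
    fix S R assume "encode S = encode R"
    then have "coord (S (Abs_ell2 (coord x))) = coord (R (Abs_ell2 (coord x)))" for x
      by (metis encode_def)
    then show "S = R" by (intro blinfun_eqI) (simp add: coord_inverse coord_inject)
  qed
  then show ?thesis by (simp add: decode_def)
qed

lemma encode_eq_iff [simp]: "encode S = encode R \<longleftrightarrow> S = R"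
  by (metis decode_encode)

definition op_algebra :: "test_carrier cstar" where
  "op_algebra = \<lparr>carrier = encode ` ops,
     monoid.mult = (\<lambda>x y. encode (decode x o\<^sub>L decode y)), one = encode 0,
     zero = encode 0, add = (\<lambda>x y. encode (decode x + decode y)),
     smult = (\<lambda>c x. encode (cscale c (decode x))),
     invol = (\<lambda>x. encode (adj (decode x))), cnorm = (\<lambda>x. norm (decode x))\<rparr>"

lemma op_algebra_simps [simp]:
  "carrier op_algebra = encode ` ops"
  "encode S \<otimes>\<^bsub>op_algebra\<^esub> encode R = encode (S o\<^sub>L R)"
  "\<zero>\<^bsub>op_algebra\<^esub> = encode 0"
  "encode S \<oplus>\<^bsub>op_algebra\<^esub> encode R = encode (S + R)"
  "c \<odot>\<^bsub>op_algebra\<^esub> encode S = encode (cscale c S)"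
  "invol op_algebra (encode S) = encode (adj S)"
  "cnorm op_algebra (encode S) = norm S"
  by (simp_all add: op_algebra_def)

lemma abelian_group_op_algebra: "abelian_group op_algebra"
proof (rule abelian_groupI)
  fix x assume "x \<in> carrier op_algebra"
  then obtain S where S: "S \<in> ops" "x = encode S" by auto
  then have "cscale (-1) S \<in> ops" by (intro ops_cscale)
  with S show "\<exists>y\<in>carrier op_algebra. y \<oplus>\<^bsub>op_algebra\<^esub> x = \<zero>\<^bsub>op_algebra\<^esub>"
    by (intro bexI[of _ "encode (cscale (-1) S)"]) (simp_all add: cscale_def)
qed (auto simp: ops_zero ops_add add_ac)

lemma op_algebra_minus:
  "S \<in> ops \<Longrightarrow> R \<in> ops \<Longrightarrow> encode S \<ominus>\<^bsub>op_algebra\<^esub> encode R = encode (S - R)"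
proof -
  assume S: "S \<in> ops" and R: "R \<in> ops"
  interpret abelian_group op_algebra by (rule abelian_group_op_algebra)
  have "cscale (-1) R \<in> ops" using R by (rule ops_cscale)
  then have "\<ominus>\<^bsub>op_algebra\<^esub> encode R = encode (cscale (-1) R)"
    using R by (intro minus_equality) (simp_all add: cscale_def)
  then show ?thesis by (simp add: a_minus_def cscale_def)
qed

lemma cstar_algebra_op_algebra: "cstar_algebra op_algebra"
proof -
  have dist: "cstar_dist op_algebra (encode S) (encode R) = dist S R" if "S \<in> ops" "R \<in> ops" for S R
    using that by (simp add: cstar_dist_def op_algebra_minus dist_norm)
  interpret MS: Metric_space "carrier op_algebra" "cstar_dist op_algebra"
  proof
    fix x y z
    show "0 \<le> cstar_dist op_algebra x y"
      using dist by (cases "x \<in> carrier op_algebra \<and> y \<in> carrier op_algebra") (auto simp: cstar_dist_def)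
    show "cstar_dist op_algebra x y = cstar_dist op_algebra y x"
      using dist dist_commute
      by (cases "x \<in> carrier op_algebra \<and> y \<in> carrier op_algebra")
        (fastforce, auto simp: cstar_dist_def)
    show "x \<in> carrier op_algebra \<Longrightarrow> y \<in> carrier op_algebra \<Longrightarrow>
        cstar_dist op_algebra x y = 0 \<longleftrightarrow> x = y"
      by (auto simp: dist)
    show "x \<in> carrier op_algebra \<Longrightarrow> y \<in> carrier op_algebra \<Longrightarrow> z \<in> carrier op_algebra \<Longrightarrow>
        cstar_dist op_algebra x z \<le> cstar_dist op_algebra x y + cstar_dist op_algebra y z"
      by (auto simp: dist dist_triangle)
  qed
  have "MS.mcomplete"
    unfolding MS.mcomplete_def
  proof (intro allI impI)
    fix \<sigma> assume \<sigma>: "MS.MCauchy \<sigma>"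
    define S where "S n = decode (\<sigma> n)" for n
    have "range \<sigma> \<subseteq> carrier op_algebra" using \<sigma> by (simp only: MS.MCauchy_def)
    then have range: "\<sigma> n \<in> encode ` ops" for n by auto
    have S: "S n \<in> ops" "\<sigma> n = encode (S n)" for n
      using range[of n] by (auto simp: S_def)
    have "Cauchy S"
      using \<sigma> unfolding MS.MCauchy_def Cauchy_def by (simp add: S dist)
    then obtain L where L: "S \<longlonglongrightarrow> L" using Cauchy_convergent convergent_def by blast
    then have "L \<in> ops" by (rule ops_limit[OF S(1)])
    then have "limitin MS.mtopology \<sigma> (encode L) sequentially"
      using L unfolding MS.limitin_metric by (simp add: S dist tendsto_iff)
    then show "\<exists>x. limitin MS.mtopology \<sigma> x sequentially" by blast
  qed
  moreover have "Module.module (ring_of_type_algebra :: complex ring) op_algebra"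
  proof (rule moduleI)
    show "cring (ring_of_type_algebra :: complex ring)" by (rule cring_from_type_algebra)
    show "c \<odot>\<^bsub>op_algebra\<^esub> x \<in> carrier op_algebra" if "x \<in> carrier op_algebra" for c x
      using that by (auto simp: ops_cscale)
  qed (auto simp: abelian_group_op_algebra ring_of_type_algebra_def cscale_def
      blinfun.bilinear_simps ops_times_i algebra_simps intro!: blinfun_eqI)
  ultimately show ?thesis
    unfolding cstar_algebra_def
  proof (intro conjI cstar_algebra_axioms.intro)
    show "cnorm op_algebra (x \<oplus>\<^bsub>op_algebra\<^esub> y) \<le> cnorm op_algebra x + cnorm op_algebra y"
      if "x \<in> carrier op_algebra" "y \<in> carrier op_algebra" for x y
      using that by (auto intro: norm_triangle_ineq)
    show "cnorm op_algebra (x \<otimes>\<^bsub>op_algebra\<^esub> y) \<le> cnorm op_algebra x * cnorm op_algebra y"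
      if "x \<in> carrier op_algebra" "y \<in> carrier op_algebra" for x y
      using that by (auto intro: norm_blinfun_compose)
    show "invol op_algebra (x \<oplus>\<^bsub>op_algebra\<^esub> y) = invol op_algebra x \<oplus>\<^bsub>op_algebra\<^esub> invol op_algebra y"
      if "x \<in> carrier op_algebra" "y \<in> carrier op_algebra" for x y
      using that by (auto intro!: adj_eq is_adjoint_add adj_is_adjoint)
    show "invol op_algebra (x \<otimes>\<^bsub>op_algebra\<^esub> y) = invol op_algebra y \<otimes>\<^bsub>op_algebra\<^esub> invol op_algebra x"
      if "x \<in> carrier op_algebra" "y \<in> carrier op_algebra" for x y
      using that by (auto intro!: adj_eq is_adjoint_compose adj_is_adjoint)
    show "invol op_algebra (c \<odot>\<^bsub>op_algebra\<^esub> x) = cnj c \<odot>\<^bsub>op_algebra\<^esub> invol op_algebra x"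
      if "x \<in> carrier op_algebra" for c x
      using that by (auto intro!: adj_eq is_adjoint_cscale)
    show "cnorm op_algebra (c \<odot>\<^bsub>op_algebra\<^esub> x) = cmod c * cnorm op_algebra x"
      if "x \<in> carrier op_algebra" for c x
      using that by (auto simp: norm_cscale_op)
  qed (auto simp: ops_compose ops_adj adj_adj norm_adj_compose cscale_def
      blinfun.bilinear_simps ops_times_i intro!: blinfun_eqI)
qed

section \<open>Partial permutation operators\<close>

definition partial_bij :: "(nat \<times> nat) set \<Rightarrow> bool" where
  "partial_bij R \<longleftrightarrow> single_valued R \<and> single_valued (R\<inverse>)"

text \<open>
  A relation that is single-valued in both directions is regarded as an infinite 0-1 matrix with at most one
  entry in each row and column. These matrices multiply by relational composition, and their adjoints are
  the converse relations. The rows of indices outside the domain are zero.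
\<close>

definition shift_fun :: "(nat \<times> nat) set \<Rightarrow> (nat \<Rightarrow> complex) \<Rightarrow> nat \<Rightarrow> complex" where
  "shift_fun R x k = (if k \<in> Domain R then x (THE j. (k, j) \<in> R) else 0)"

definition shift :: "(nat \<times> nat) set \<Rightarrow> ell2 \<Rightarrow>\<^sub>L ell2" where
  "shift R = Blinfun (\<lambda>x. Abs_ell2 (shift_fun R (coord x)))"

lemma partial_bij_converse: "partial_bij R \<Longrightarrow> partial_bij (R\<inverse>)"
  by (simp add: partial_bij_def)

lemma partial_bij_relcomp: "partial_bij R \<Longrightarrow> partial_bij Q \<Longrightarrow> partial_bij (R O Q)"
  by (simp add: partial_bij_def converse_relcomp single_valued_relcomp)

lemma partial_bij_subset: "partial_bij R \<Longrightarrow> Q \<subseteq> R \<Longrightarrow> partial_bij Q"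
  unfolding partial_bij_def by (meson converse_mono single_valued_subset)

lemma the_eq: "partial_bij R \<Longrightarrow> (k, j) \<in> R \<Longrightarrow> (THE j. (k, j) \<in> R) = j"
  by (rule the_equality) (auto simp: partial_bij_def dest: single_valuedD)

lemma shift_fun_in: "partial_bij R \<Longrightarrow> (k, j) \<in> R \<Longrightarrow> shift_fun R x k = x j"
  by (auto simp: shift_fun_def the_eq)

lemma shift_fun_notin: "k \<notin> Domain R \<Longrightarrow> shift_fun R x k = 0"
  by (simp add: shift_fun_def)

lemma bij_betw_the:
  assumes "partial_bij R" shows "bij_betw (\<lambda>k. THE j. (k, j) \<in> R) (Domain R) (Range R)"
proof (rule bij_betwI')
  fix k k' assume "k \<in> Domain R" "k' \<in> Domain R"
  then obtain j j' where "(k, j) \<in> R" "(k', j') \<in> R" by auto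
  then show "((THE j. (k, j) \<in> R) = (THE j. (k', j) \<in> R)) = (k = k')"
    using assms by (auto simp: the_eq partial_bij_def single_valued_def)
next
  fix k assume "k \<in> Domain R"
  then show "(THE j. (k, j) \<in> R) \<in> Range R" using the_eq[OF assms] by auto
next
  fix j assume "j \<in> Range R"
  then show "\<exists>k\<in>Domain R. j = (THE j. (k, j) \<in> R)" using the_eq[OF assms] by fastforce
qed

lemma shift_fun_square_sum_le:
  assumes R: "partial_bij R" and F: "finite F"
  shows "(\<Sum>k\<in>F. (cmod (shift_fun R (coord x) k))\<^sup>2) \<le> (norm x)\<^sup>2"
proof -
  let ?g = "\<lambda>k. THE j. (k, j) \<in> R"
  have "(\<Sum>k\<in>F. (cmod (shift_fun R (coord x) k))\<^sup>2) = (\<Sum>k\<in>F \<inter> Domain R. (cmod (coord x (?g k)))\<^sup>2)"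
    using F by (intro sum.mono_neutral_cong_right) (auto simp: shift_fun_def)
  also have "\<dots> = (\<Sum>j\<in>?g ` (F \<inter> Domain R). (cmod (coord x j))\<^sup>2)"
    using bij_betw_the[OF R] by (subst sum.reindex) (auto simp: bij_betw_def intro: inj_on_subset)
  also have "\<dots> \<le> (norm x)\<^sup>2" using F by (intro finite_coord_sum_le) auto
  finally show ?thesis .
qed

lemma coord_Abs_shift_fun:
  assumes "partial_bij R"
  shows "coord (Abs_ell2 (shift_fun R (coord x))) = shift_fun R (coord x)"
  using shift_fun_square_sum_le[OF assms, of _ x]
  by (intro coord_Abs_ell2 nonneg_bdd_above_summable_on) (auto simp: bdd_above_def)

lemma coord_shift:
  assumes R: "partial_bij R"
  shows "coord (shift R x) k = shift_fun R (coord x) k"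
proof -
  note c = coord_Abs_shift_fun[OF R]
  have "bounded_linear (\<lambda>x. Abs_ell2 (shift_fun R (coord x)))"
  proof (rule bounded_linear_intro[where K=1])
    fix x y :: ell2 and a :: real
    show "Abs_ell2 (shift_fun R (coord (x + y))) = Abs_ell2 (shift_fun R (coord x)) + Abs_ell2 (shift_fun R (coord y))"
      "Abs_ell2 (shift_fun R (coord (a *\<^sub>R x))) = a *\<^sub>R Abs_ell2 (shift_fun R (coord x))"
      by (rule ell2_eqI; simp add: c; simp add: shift_fun_def)+
    show "norm (Abs_ell2 (shift_fun R (coord x))) \<le> norm x * 1"
      using shift_fun_square_sum_le[OF R] by (intro norm_ell2_leI) (simp_all add: c)
  qed
  then show ?thesis by (simp add: shift_def bounded_linear_Blinfun_apply c)
qed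

lemma coord_shift_in: "partial_bij R \<Longrightarrow> (k, j) \<in> R \<Longrightarrow> coord (shift R x) k = coord x j"
  by (simp add: coord_shift shift_fun_in)

lemma coord_shift_notin: "partial_bij R \<Longrightarrow> k \<notin> Domain R \<Longrightarrow> coord (shift R x) k = 0"
  by (simp add: coord_shift shift_fun_notin)

lemma is_adjoint_shift:
  assumes R: "partial_bij R"
  shows "is_adjoint (shift R) (shift (R\<inverse>))"
  unfolding is_adjoint_def
proof (intro allI)
  fix x y
  let ?g = "\<lambda>k. THE j. (k, j) \<in> R"
  note R' = partial_bij_converse[OF R]
  have "shift R x \<bullet> y = (\<Sum>\<^sub>\<infinity>k\<in>Domain R. coord x (?g k) \<bullet> coord (shift (R\<inverse>) y) (?g k))"
    unfolding inner_ell2_def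
    by (rule infsum_cong_neutral)
      (auto simp: coord_shift_notin[OF R] coord_shift_in[OF R] coord_shift_in[OF R'] the_eq[OF R])
  also have "\<dots> = (\<Sum>\<^sub>\<infinity>j\<in>Range R. coord x j \<bullet> coord (shift (R\<inverse>) y) j)"
    by (rule infsum_reindex_bij_betw[OF bij_betw_the[OF R]])
  also have "\<dots> = x \<bullet> shift (R\<inverse>) y"
    unfolding inner_ell2_def
    by (rule infsum_cong_neutral) (auto simp: coord_shift_notin[OF R'])
  finally show "shift R x \<bullet> y = x \<bullet> shift (R\<inverse>) y" .
qed

lemma adj_shift: "partial_bij R \<Longrightarrow> adj (shift R) = shift (R\<inverse>)"
  by (intro adj_eq is_adjoint_shift)

lemma shift_in_ops:
  assumes R: "partial_bij R" shows "shift R \<in> ops"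
proof -
  have "shift R (times_i x) = times_i (shift R x)" for x
    by (rule ell2_eqI) (simp add: coord_shift[OF R] shift_fun_def)
  then show ?thesis using is_adjoint_shift[OF R] by (auto simp: ops_def)
qed

lemma shift_compose:
  assumes R: "partial_bij R" and Q: "partial_bij Q"
  shows "shift R o\<^sub>L shift Q = shift (R O Q)"
proof (rule blinfun_eqI, rule ell2_eqI)
  fix x k
  note RQ = partial_bij_relcomp[OF R Q]
  consider (a) i j where "(k, i) \<in> R" "(i, j) \<in> Q" | (b) i where "(k, i) \<in> R" "i \<notin> Domain Q"
    | (c) "k \<notin> Domain R" by blast
  then show "coord ((shift R o\<^sub>L shift Q) x) k = coord (shift (R O Q) x) k"
  proof cases
    case a
    then have "(k, j) \<in> R O Q" by auto
    then show ?thesis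
      using a by (simp add: coord_shift_in[OF R] coord_shift_in[OF Q] coord_shift_in[OF RQ])
  next
    case b
    then have "k \<notin> Domain (R O Q)" using R by (auto simp: partial_bij_def dest: single_valuedD)
    then show ?thesis
      using b by (simp add: coord_shift_in[OF R] coord_shift_notin[OF Q] coord_shift_notin[OF RQ])
  next
    case c
    then have "k \<notin> Domain (R O Q)" by auto
    then show ?thesis
      using c by (simp add: coord_shift_notin[OF R] coord_shift_notin[OF RQ])
  qed
qed

lemma coord_sum: "coord (\<Sum>i\<in>I. g i) k = (\<Sum>i\<in>I. coord (g i) k)"
  by (induction I rule: infinite_finite_induct) simp_all

lemma shift_UN:
  assumes I: "finite I" and U: "partial_bij (\<Union>i\<in>I. R i)"
    and disj: "\<And>i j. \<lbrakk>i \<in> I; j \<in> I; i \<noteq> j\<rbrakk> \<Longrightarrow> Domain (R i) \<inter> Domain (R j) = {}"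
  shows "shift (\<Union>i\<in>I. R i) = (\<Sum>i\<in>I. shift (R i))"
proof (rule blinfun_eqI, rule ell2_eqI)
  fix x k
  have R: "partial_bij (R i)" if "i \<in> I" for i
    using that by (intro partial_bij_subset[OF U]) auto
  have "coord (shift (\<Union>i\<in>I. R i) x) k = (\<Sum>i\<in>I. coord (shift (R i) x) k)"
  proof (cases "k \<in> Domain (\<Union>i\<in>I. R i)")
    case True
    then obtain i j where i: "i \<in> I" "(k, j) \<in> R i" by auto
    then have "(k, j) \<in> (\<Union>i\<in>I. R i)" by auto
    then have "coord (shift (\<Union>i\<in>I. R i) x) k = coord x j" by (rule coord_shift_in[OF U])
    moreover have "(\<Sum>i'\<in>I. coord (shift (R i') x) k) = (\<Sum>i'\<in>I. if i' = i then coord x j else 0)"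
    proof (rule sum.cong[OF refl])
      fix i' assume i': "i' \<in> I"
      show "coord (shift (R i') x) k = (if i' = i then coord x j else 0)"
      proof (cases "i' = i")
        case False
        then have "k \<notin> Domain (R i')" using disj[of i' i] i i' by auto
        then show ?thesis using False coord_shift_notin[OF R[OF i']] by simp
      qed (use i coord_shift_in[OF R[OF i(1)]] in auto)
    qed
    ultimately show ?thesis using i I by simp
  next
    case False
    then have "coord (shift (R i) x) k = 0" if "i \<in> I" for i
      using that by (intro coord_shift_notin[OF R]) auto
    then show ?thesis using coord_shift_notin[OF U False] by simp
  qed
  then show "coord (shift (\<Union>i\<in>I. R i) x) k = coord ((\<Sum>i\<in>I. shift (R i)) x) k"
    by (simp add: blinfun.sum_left coord_sum)
qed

lemma shift_empty: "shift {} = 0"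
  using shift_UN[of "{}" "\<lambda>_. {}"] by (simp add: partial_bij_def)

lemma finsum_op_algebra:
  assumes "finite I" "\<And>i. i \<in> I \<Longrightarrow> S i \<in> ops"
  shows "(\<Oplus>\<^bsub>op_algebra\<^esub>i\<in>I. encode (S i)) = encode (\<Sum>i\<in>I. S i) \<and> (\<Sum>i\<in>I. S i) \<in> ops"
proof -
  interpret cstar_algebra op_algebra by (rule cstar_algebra_op_algebra)
  show ?thesis
    using assms
  proof (induction I)
    case (insert i I)
    have "(\<lambda>i. encode (S i)) \<in> I \<rightarrow> carrier op_algebra" "encode (S i) \<in> carrier op_algebra"
      using insert.prems by auto
    then show ?case using insert by (simp add: ops_add)
  qed (simp add: ops_zero)
qed

subsection \<open>Diagonal matrix entries as positive functionals\<close>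

definition basis :: "nat \<Rightarrow> ell2" where
  "basis k = Abs_ell2 (\<lambda>n. if n = k then 1 else 0)"

lemma coord_basis: "coord (basis k) n = (if n = k then 1 else 0)"
proof -
  have "(\<lambda>n. (cmod (if n = k then 1 else 0))\<^sup>2) summable_on UNIV \<longleftrightarrow>
      (\<lambda>n. (cmod (if n = k then 1 else 0))\<^sup>2) summable_on {k}"
    by (rule summable_on_cong_neutral) auto
  then show ?thesis by (simp add: basis_def coord_Abs_ell2)
qed

lemma inner_basis: "x \<bullet> basis k = Re (coord x k)"
proof -
  have "x \<bullet> basis k = (\<Sum>\<^sub>\<infinity>n\<in>{k}. coord x n \<bullet> coord (basis k) n)"
    unfolding inner_ell2_def by (rule infsum_cong_neutral) (auto simp: coord_basis)
  then show ?thesis by (simp add: coord_basis inner_complex_def)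
qed

definition diag_entry :: "nat \<Rightarrow> test_carrier \<Rightarrow> complex" where
  "diag_entry k x = coord (blinfun_apply (decode x) (basis k)) k"

lemma diag_entry_shift:
  "partial_bij R \<Longrightarrow> diag_entry k (encode (shift R)) = (if (k, k) \<in> R then 1 else 0)"
proof -
  assume R: "partial_bij R"
  show ?thesis
  proof (cases "k \<in> Domain R")
    case True
    then obtain j where j: "(k, j) \<in> R" by auto
    then have "j = k \<longleftrightarrow> (k, k) \<in> R" using R by (auto simp: partial_bij_def dest: single_valuedD)
    then show ?thesis using j by (simp add: diag_entry_def coord_shift_in[OF R] coord_basis)
  qed (auto simp: diag_entry_def coord_shift_notin[OF R])
qed

text \<open>
  The entry of \<open>S\<^sup>*S\<close> at \<open>(k, k)\<close> has real part \<open>|Se\<^sub>k|\<^sup>2\<close>, and its imaginary part is the inner product of \<open>Se\<^sub>k\<close>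
  with \<open>times_i (Se\<^sub>k)\<close>, which is 0 because \<open>times_i\<close> is skew.
\<close>

lemma positive_functional_diag_entry: "positive_functional op_algebra (diag_entry k)"
  unfolding positive_functional_def linear_functional_def
proof (intro conjI ballI allI)
  fix x assume "x \<in> carrier op_algebra"
  then obtain S where S: "S \<in> ops" "x = encode S" by auto
  note a = adj_is_adjoint[OF S(1)]
  let ?e = "basis k"
  let ?z = "adj S (S ?e)"
  have "?z \<bullet> ?e = S ?e \<bullet> S ?e"
    using a by (metis inner_commute is_adjoint_def)
  then have re: "0 \<le> Re (coord ?z k)" by (simp add: inner_basis[symmetric])
  have "times_i ?z \<bullet> ?e = - (?z \<bullet> times_i ?e)" by (rule inner_times_i)
  also have "?z \<bullet> times_i ?e = S ?e \<bullet> S (times_i ?e)"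
    using a by (metis inner_commute is_adjoint_def)
  also have "\<dots> = S ?e \<bullet> times_i (S ?e)" by (simp add: ops_times_i[OF S(1)])
  also have "\<dots> = 0" using inner_times_i[of "S ?e" "S ?e"] by (simp add: inner_commute)
  finally have "Im (coord ?z k) = 0" by (simp add: inner_basis)
  with re show "diag_entry k (invol op_algebra x \<otimes>\<^bsub>op_algebra\<^esub> x) \<in> \<real>\<^sub>\<ge>\<^sub>0"
    using S by (simp add: diag_entry_def complex_nonneg_Reals_iff)
next
  fix x y assume "x \<in> carrier op_algebra" "y \<in> carrier op_algebra"
  then show "diag_entry k (x \<oplus>\<^bsub>op_algebra\<^esub> y) = diag_entry k x + diag_entry k y"
    by (auto simp: diag_entry_def blinfun.add_left)
next
  fix c x assume "x \<in> carrier op_algebra"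
  then show "diag_entry k (c \<odot>\<^bsub>op_algebra\<^esub> x) = c * diag_entry k x"
    by (auto simp: diag_entry_def cscale_def blinfun.add_left blinfun.scaleR_left
        complex_eq_iff algebra_simps)
qed

section \<open>The regular representation\<close>

context finite_two_graph
begin

definition idx :: "'a \<Rightarrow> nat" where "idx = to_nat_on (paths \<Lambda>)"

text \<open>
  The graph, on indices of paths, of the map \<open>\<eta> \<mapsto> \<mu>\<eta>\<close>.
\<close>

definition creation :: "'a \<Rightarrow> (nat \<times> nat) set" where
  "creation \<mu> = {(idx (pcomp \<Lambda> \<mu> \<eta>), idx \<eta>) |\<eta>. \<eta> \<in> paths \<Lambda> \<and> src \<Lambda> \<mu> = rng \<Lambda> \<eta>}"

lemma idx_eq_iff: "\<lbrakk>\<eta> \<in> paths \<Lambda>; \<xi> \<in> paths \<Lambda>\<rbrakk> \<Longrightarrow> idx \<eta> = idx \<xi> \<longleftrightarrow> \<eta> = \<xi>"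
  using countable_paths by (simp add: idx_def)

lemma creationI:
  "\<lbrakk>\<eta> \<in> paths \<Lambda>; src \<Lambda> \<mu> = rng \<Lambda> \<eta>; \<xi> = pcomp \<Lambda> \<mu> \<eta>\<rbrakk> \<Longrightarrow> (idx \<xi>, idx \<eta>) \<in> creation \<mu>"
  by (auto simp: creation_def)

lemma creation_iff:
  assumes "\<mu> \<in> paths \<Lambda>" "\<xi> \<in> paths \<Lambda>" "\<eta> \<in> paths \<Lambda>"
  shows "(idx \<xi>, idx \<eta>) \<in> creation \<mu> \<longleftrightarrow> src \<Lambda> \<mu> = rng \<Lambda> \<eta> \<and> \<xi> = pcomp \<Lambda> \<mu> \<eta>"
  using assms by (auto simp: creation_def idx_eq_iff pcomp_closed)

lemma creation_subset: "\<mu> \<in> paths \<Lambda> \<Longrightarrow> creation \<mu> \<subseteq> idx ` paths \<Lambda> \<times> idx ` paths \<Lambda>"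
  by (auto simp: creation_def pcomp_closed)

lemma partial_bij_creation: "\<mu> \<in> paths \<Lambda> \<Longrightarrow> partial_bij (creation \<mu>)"
proof -
  assume \<mu>: "\<mu> \<in> paths \<Lambda>"
  have "\<eta> = \<eta>'" if "\<eta> \<in> paths \<Lambda>" "src \<Lambda> \<mu> = rng \<Lambda> \<eta>" "\<eta>' \<in> paths \<Lambda>" "src \<Lambda> \<mu> = rng \<Lambda> \<eta>'"
    "idx (pcomp \<Lambda> \<mu> \<eta>) = idx (pcomp \<Lambda> \<mu> \<eta>')" for \<eta> \<eta>'
    using pcomp_cancel[of \<mu> \<eta> \<mu> \<eta>'] that \<mu> by (simp add: idx_eq_iff pcomp_closed)
  then have "single_valued (creation \<mu>)"
    unfolding single_valued_def creation_def by blast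
  moreover have "single_valued ((creation \<mu>)\<inverse>)"
    unfolding single_valued_def creation_def using idx_eq_iff by blast
  ultimately show ?thesis by (simp add: partial_bij_def)
qed

text \<open>
  Relations between path indices are determined by their restriction to paths, which turns
  the Toeplitz relations into statements about factorisations.
\<close>

lemma idx_relation_eqI:
  assumes "R \<subseteq> idx ` paths \<Lambda> \<times> idx ` paths \<Lambda>" "Q \<subseteq> idx ` paths \<Lambda> \<times> idx ` paths \<Lambda>"
    and "\<And>\<xi> \<eta>. \<lbrakk>\<xi> \<in> paths \<Lambda>; \<eta> \<in> paths \<Lambda>\<rbrakk> \<Longrightarrow> (idx \<xi>, idx \<eta>) \<in> R \<longleftrightarrow> (idx \<xi>, idx \<eta>) \<in> Q"
  shows "R = Q"
  using assms by fast

lemma creation_relcomp_iff: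
  assumes "\<mu> \<in> paths \<Lambda>" "\<nu> \<in> paths \<Lambda>" "\<xi> \<in> paths \<Lambda>" "\<eta> \<in> paths \<Lambda>"
  shows "(idx \<xi>, idx \<eta>) \<in> creation \<mu> O creation \<nu> \<longleftrightarrow>
    src \<Lambda> \<nu> = rng \<Lambda> \<eta> \<and> src \<Lambda> \<mu> = rng \<Lambda> \<nu> \<and> \<xi> = pcomp \<Lambda> \<mu> (pcomp \<Lambda> \<nu> \<eta>)"
proof
  assume "(idx \<xi>, idx \<eta>) \<in> creation \<mu> O creation \<nu>"
  then obtain k where k: "(idx \<xi>, k) \<in> creation \<mu>" "(k, idx \<eta>) \<in> creation \<nu>" by auto
  then obtain \<zeta> where "k = idx \<zeta>" "\<zeta> \<in> paths \<Lambda>" by (auto simp: creation_def)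
  then show "src \<Lambda> \<nu> = rng \<Lambda> \<eta> \<and> src \<Lambda> \<mu> = rng \<Lambda> \<nu> \<and> \<xi> = pcomp \<Lambda> \<mu> (pcomp \<Lambda> \<nu> \<eta>)"
    using k assms by (auto simp: creation_iff rng_pcomp)
next
  assume h: "src \<Lambda> \<nu> = rng \<Lambda> \<eta> \<and> src \<Lambda> \<mu> = rng \<Lambda> \<nu> \<and> \<xi> = pcomp \<Lambda> \<mu> (pcomp \<Lambda> \<nu> \<eta>)"
  then have "(idx \<xi>, idx (pcomp \<Lambda> \<nu> \<eta>)) \<in> creation \<mu>" "(idx (pcomp \<Lambda> \<nu> \<eta>), idx \<eta>) \<in> creation \<nu>"
    using assms by (auto simp: creation_iff pcomp_closed rng_pcomp)
  then show "(idx \<xi>, idx \<eta>) \<in> creation \<mu> O creation \<nu>" by auto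
qed

lemma creation_converse_relcomp_iff:
  assumes "\<mu> \<in> paths \<Lambda>" "\<nu> \<in> paths \<Lambda>" "\<xi> \<in> paths \<Lambda>" "\<eta> \<in> paths \<Lambda>"
  shows "(idx \<xi>, idx \<eta>) \<in> (creation \<mu>)\<inverse> O creation \<nu> \<longleftrightarrow>
    src \<Lambda> \<mu> = rng \<Lambda> \<xi> \<and> src \<Lambda> \<nu> = rng \<Lambda> \<eta> \<and> pcomp \<Lambda> \<mu> \<xi> = pcomp \<Lambda> \<nu> \<eta>"
proof
  assume "(idx \<xi>, idx \<eta>) \<in> (creation \<mu>)\<inverse> O creation \<nu>"
  then obtain k where k: "(k, idx \<xi>) \<in> creation \<mu>" "(k, idx \<eta>) \<in> creation \<nu>" by auto
  then obtain \<zeta> where "k = idx \<zeta>" "\<zeta> \<in> paths \<Lambda>" using creation_subset[OF assms(1)] by auto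
  then show "src \<Lambda> \<mu> = rng \<Lambda> \<xi> \<and> src \<Lambda> \<nu> = rng \<Lambda> \<eta> \<and> pcomp \<Lambda> \<mu> \<xi> = pcomp \<Lambda> \<nu> \<eta>"
    using k assms by (auto simp: creation_iff)
next
  assume h: "src \<Lambda> \<mu> = rng \<Lambda> \<xi> \<and> src \<Lambda> \<nu> = rng \<Lambda> \<eta> \<and> pcomp \<Lambda> \<mu> \<xi> = pcomp \<Lambda> \<nu> \<eta>"
  then have "(idx (pcomp \<Lambda> \<mu> \<xi>), idx \<xi>) \<in> creation \<mu>" "(idx (pcomp \<Lambda> \<mu> \<xi>), idx \<eta>) \<in> creation \<nu>"
    using assms by (auto intro: creationI)
  then show "(idx \<xi>, idx \<eta>) \<in> (creation \<mu>)\<inverse> O creation \<nu>" by auto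
qed

lemma creation_relcomp_converse_iff:
  assumes "\<mu> \<in> paths \<Lambda>" "\<nu> \<in> paths \<Lambda>" "\<xi> \<in> paths \<Lambda>" "\<eta> \<in> paths \<Lambda>"
  shows "(idx \<xi>, idx \<eta>) \<in> creation \<mu> O (creation \<nu>)\<inverse> \<longleftrightarrow>
    (\<exists>\<zeta>\<in>paths \<Lambda>. src \<Lambda> \<mu> = rng \<Lambda> \<zeta> \<and> src \<Lambda> \<nu> = rng \<Lambda> \<zeta> \<and> \<xi> = pcomp \<Lambda> \<mu> \<zeta> \<and> \<eta> = pcomp \<Lambda> \<nu> \<zeta>)"
proof
  assume "(idx \<xi>, idx \<eta>) \<in> creation \<mu> O (creation \<nu>)\<inverse>"
  then obtain k where k: "(idx \<xi>, k) \<in> creation \<mu>" "(idx \<eta>, k) \<in> creation \<nu>" by auto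
  then obtain \<zeta> where "k = idx \<zeta>" "\<zeta> \<in> paths \<Lambda>" using creation_subset[OF assms(1)] by auto
  then show "\<exists>\<zeta>\<in>paths \<Lambda>. src \<Lambda> \<mu> = rng \<Lambda> \<zeta> \<and> src \<Lambda> \<nu> = rng \<Lambda> \<zeta> \<and> \<xi> = pcomp \<Lambda> \<mu> \<zeta> \<and> \<eta> = pcomp \<Lambda> \<nu> \<zeta>"
    using k assms by (auto simp: creation_iff)
next
  assume "\<exists>\<zeta>\<in>paths \<Lambda>. src \<Lambda> \<mu> = rng \<Lambda> \<zeta> \<and> src \<Lambda> \<nu> = rng \<Lambda> \<zeta> \<and> \<xi> = pcomp \<Lambda> \<mu> \<zeta> \<and> \<eta> = pcomp \<Lambda> \<nu> \<zeta>"
  then show "(idx \<xi>, idx \<eta>) \<in> creation \<mu> O (creation \<nu>)\<inverse>"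
    by (auto intro!: relcompI creationI)
qed

lemma creation_vertex:
  assumes "z \<in> vertices \<Lambda>" "\<xi> \<in> paths \<Lambda>" "\<eta> \<in> paths \<Lambda>"
  shows "(idx \<xi>, idx \<eta>) \<in> creation z \<longleftrightarrow> \<xi> = \<eta> \<and> rng \<Lambda> \<xi> = z"
proof -
  have "z \<in> paths \<Lambda>" using assms by (simp add: vertices_def)
  then show ?thesis
    using assms vertex_rng_src[OF assms(1)] pcomp_rng[of \<eta>] by (auto simp: creation_iff)
qed

text \<open>
  A path that begins with both \<open>\<mu>\<close> and \<open>\<nu>\<close> has a unique initial segment of degree
  \<open>deg \<mu> \<squnion> deg \<nu>\<close>, and this segment is the minimal common extension that it passes through.
\<close>

lemma common_extension_factors:
  assumes p: "\<mu> \<in> paths \<Lambda>" "\<nu> \<in> paths \<Lambda>" "\<xi> \<in> paths \<Lambda>" "\<eta> \<in> paths \<Lambda>"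
    and h: "src \<Lambda> \<mu> = rng \<Lambda> \<xi>" "src \<Lambda> \<nu> = rng \<Lambda> \<eta>" "pcomp \<Lambda> \<mu> \<xi> = pcomp \<Lambda> \<nu> \<eta>"
  obtains \<alpha> \<beta> \<zeta> where "(\<alpha>, \<beta>) \<in> min_ext \<Lambda> \<mu> \<nu>" "\<zeta> \<in> paths \<Lambda>" "src \<Lambda> \<alpha> = rng \<Lambda> \<zeta>" "src \<Lambda> \<beta> = rng \<Lambda> \<zeta>"
    "\<xi> = pcomp \<Lambda> \<alpha> \<zeta>" "\<eta> = pcomp \<Lambda> \<beta> \<zeta>"
proof -
  let ?s = "sup (deg \<Lambda> \<mu>) (deg \<Lambda> \<nu>)"
  have d: "deg \<Lambda> \<mu> + deg \<Lambda> \<xi> = deg \<Lambda> \<nu> + deg \<Lambda> \<eta>"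
    using deg_pcomp[of \<mu> \<xi>] deg_pcomp[of \<nu> \<eta>] p h by simp
  then have d1: "deg \<Lambda> \<xi> = (?s - deg \<Lambda> \<mu>) + (deg \<Lambda> \<mu> + deg \<Lambda> \<xi> - ?s)"
    and d2: "deg \<Lambda> \<eta> = (?s - deg \<Lambda> \<nu>) + (deg \<Lambda> \<mu> + deg \<Lambda> \<xi> - ?s)"
    by (auto simp: prod_eq_iff sup_nat_def)
  have s1: "deg \<Lambda> \<mu> + (?s - deg \<Lambda> \<mu>) = ?s" and s2: "deg \<Lambda> \<nu> + (?s - deg \<Lambda> \<nu>) = ?s"
    by (auto simp: prod_eq_iff sup_nat_def)
  from factor[OF p(3) d1] obtain \<alpha> \<zeta> where a: "\<alpha> \<in> paths \<Lambda>" "\<zeta> \<in> paths \<Lambda>" "src \<Lambda> \<alpha> = rng \<Lambda> \<zeta>"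
    "\<xi> = pcomp \<Lambda> \<alpha> \<zeta>" "deg \<Lambda> \<alpha> = ?s - deg \<Lambda> \<mu>" .
  from factor[OF p(4) d2] obtain \<beta> \<zeta>' where b: "\<beta> \<in> paths \<Lambda>" "\<zeta>' \<in> paths \<Lambda>" "src \<Lambda> \<beta> = rng \<Lambda> \<zeta>'"
    "\<eta> = pcomp \<Lambda> \<beta> \<zeta>'" "deg \<Lambda> \<beta> = ?s - deg \<Lambda> \<nu>" .
  have ra: "src \<Lambda> \<mu> = rng \<Lambda> \<alpha>" "src \<Lambda> \<nu> = rng \<Lambda> \<beta>"
    using a b h rng_pcomp[of \<alpha> \<zeta>] rng_pcomp[of \<beta> \<zeta>'] by simp_all
  have "pcomp \<Lambda> (pcomp \<Lambda> \<mu> \<alpha>) \<zeta> = pcomp \<Lambda> (pcomp \<Lambda> \<nu> \<beta>) \<zeta>'"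
    using pcomp_assoc[of \<mu> \<alpha> \<zeta>] pcomp_assoc[of \<nu> \<beta> \<zeta>'] p a b ra h by simp
  then have "pcomp \<Lambda> \<mu> \<alpha> = pcomp \<Lambda> \<nu> \<beta> \<and> \<zeta> = \<zeta>'"
    using p a b ra s1 s2 by (intro pcomp_cancel) (simp_all add: pcomp_closed src_pcomp deg_pcomp)
  moreover have "rng \<Lambda> \<mu> = rng \<Lambda> \<nu>"
    using rng_pcomp[of \<mu> \<xi>] rng_pcomp[of \<nu> \<eta>] p h by simp
  ultimately show thesis
    using that[of \<alpha> \<beta> \<zeta>] a b ra p s1 s2 by (auto simp: min_ext_def deg_pcomp)
qed

lemma creation_min_ext:
  assumes p: "\<mu> \<in> paths \<Lambda>" "\<nu> \<in> paths \<Lambda>"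
  shows "(creation \<mu>)\<inverse> O creation \<nu> = (\<Union>q\<in>min_ext \<Lambda> \<mu> \<nu>. creation (fst q) O (creation (snd q))\<inverse>)"
proof (rule idx_relation_eqI)
  have q: "fst q \<in> paths \<Lambda>" "snd q \<in> paths \<Lambda>" if "q \<in> min_ext \<Lambda> \<mu> \<nu>" for q
    using that by (auto simp: min_ext_def)
  show "(creation \<mu>)\<inverse> O creation \<nu> \<subseteq> idx ` paths \<Lambda> \<times> idx ` paths \<Lambda>"
    using creation_subset[OF p(1)] creation_subset[OF p(2)] by fast
  show "(\<Union>q\<in>min_ext \<Lambda> \<mu> \<nu>. creation (fst q) O (creation (snd q))\<inverse>) \<subseteq> idx ` paths \<Lambda> \<times> idx ` paths \<Lambda>"
    using creation_subset q by fast
  fix \<xi> \<eta> assume x: "\<xi> \<in> paths \<Lambda>" "\<eta> \<in> paths \<Lambda>"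
  show "(idx \<xi>, idx \<eta>) \<in> (creation \<mu>)\<inverse> O creation \<nu> \<longleftrightarrow>
      (idx \<xi>, idx \<eta>) \<in> (\<Union>q\<in>min_ext \<Lambda> \<mu> \<nu>. creation (fst q) O (creation (snd q))\<inverse>)"
  proof
    assume "(idx \<xi>, idx \<eta>) \<in> (creation \<mu>)\<inverse> O creation \<nu>"
    then have h: "src \<Lambda> \<mu> = rng \<Lambda> \<xi>" "src \<Lambda> \<nu> = rng \<Lambda> \<eta>" "pcomp \<Lambda> \<mu> \<xi> = pcomp \<Lambda> \<nu> \<eta>"
      using creation_converse_relcomp_iff[OF p x] by auto
    from common_extension_factors[OF p x h] obtain \<alpha> \<beta> \<zeta> where
      "(\<alpha>, \<beta>) \<in> min_ext \<Lambda> \<mu> \<nu>" "\<zeta> \<in> paths \<Lambda>" "src \<Lambda> \<alpha> = rng \<Lambda> \<zeta>" "src \<Lambda> \<beta> = rng \<Lambda> \<zeta>"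
      "\<xi> = pcomp \<Lambda> \<alpha> \<zeta>" "\<eta> = pcomp \<Lambda> \<beta> \<zeta>" .
    then show "(idx \<xi>, idx \<eta>) \<in> (\<Union>q\<in>min_ext \<Lambda> \<mu> \<nu>. creation (fst q) O (creation (snd q))\<inverse>)"
      by (auto intro!: bexI[of _ "(\<alpha>, \<beta>)"] relcompI creationI)
  next
    assume "(idx \<xi>, idx \<eta>) \<in> (\<Union>q\<in>min_ext \<Lambda> \<mu> \<nu>. creation (fst q) O (creation (snd q))\<inverse>)"
    then obtain q where "q \<in> min_ext \<Lambda> \<mu> \<nu>" "(idx \<xi>, idx \<eta>) \<in> creation (fst q) O (creation (snd q))\<inverse>"
      by (rule UN_E)
    then obtain \<alpha> \<beta> where ab: "(\<alpha>, \<beta>) \<in> min_ext \<Lambda> \<mu> \<nu>" and "(idx \<xi>, idx \<eta>) \<in> creation \<alpha> O (creation \<beta>)\<inverse>"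
      by (cases q) simp
    moreover have c: "\<alpha> \<in> paths \<Lambda>" "\<beta> \<in> paths \<Lambda>" "src \<Lambda> \<mu> = rng \<Lambda> \<alpha>" "src \<Lambda> \<nu> = rng \<Lambda> \<beta>"
      "pcomp \<Lambda> \<mu> \<alpha> = pcomp \<Lambda> \<nu> \<beta>"
      using ab by (auto simp: min_ext_def)
    ultimately obtain \<zeta> where z: "\<zeta> \<in> paths \<Lambda>" "src \<Lambda> \<alpha> = rng \<Lambda> \<zeta>" "src \<Lambda> \<beta> = rng \<Lambda> \<zeta>"
      "\<xi> = pcomp \<Lambda> \<alpha> \<zeta>" "\<eta> = pcomp \<Lambda> \<beta> \<zeta>"
      using creation_relcomp_converse_iff[of \<alpha> \<beta> \<xi> \<eta>] x by auto
    have "pcomp \<Lambda> \<mu> \<xi> = pcomp \<Lambda> \<nu> \<eta>"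
      using pcomp_assoc[of \<mu> \<alpha> \<zeta>] pcomp_assoc[of \<nu> \<beta> \<zeta>] p c z by simp
    then show "(idx \<xi>, idx \<eta>) \<in> (creation \<mu>)\<inverse> O creation \<nu>"
      using p c z x by (subst creation_converse_relcomp_iff) (simp_all add: rng_pcomp)
  qed
qed

text \<open>
  A path has only one initial segment of a given degree.
\<close>

lemma Domain_creation_disjoint:
  assumes p: "\<mu> \<in> paths \<Lambda>" "\<nu> \<in> paths \<Lambda>" and d: "deg \<Lambda> \<mu> = deg \<Lambda> \<nu>" "\<mu> \<noteq> \<nu>"
  shows "Domain (creation \<mu>) \<inter> Domain (creation \<nu>) = {}"
proof -
  have False if "\<eta> \<in> paths \<Lambda>" "src \<Lambda> \<mu> = rng \<Lambda> \<eta>" "\<eta>' \<in> paths \<Lambda>" "src \<Lambda> \<nu> = rng \<Lambda> \<eta>'"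
    "idx (pcomp \<Lambda> \<mu> \<eta>) = idx (pcomp \<Lambda> \<nu> \<eta>')" for \<eta> \<eta>'
    using that p d pcomp_cancel[of \<mu> \<eta> \<nu> \<eta>'] by (simp add: idx_eq_iff pcomp_closed)
  then show ?thesis unfolding creation_def Domain_unfold by blast
qed

definition rep :: "'a \<Rightarrow> test_carrier" where "rep \<mu> = encode (shift (creation \<mu>))"

lemma rep_closed: "\<mu> \<in> paths \<Lambda> \<Longrightarrow> rep \<mu> \<in> carrier op_algebra"
  by (simp add: rep_def shift_in_ops partial_bij_creation)

lemma rep_mult_invol:
  "\<lbrakk>\<mu> \<in> paths \<Lambda>; \<nu> \<in> paths \<Lambda>\<rbrakk> \<Longrightarrow>
    rep \<mu> \<otimes>\<^bsub>op_algebra\<^esub> invol op_algebra (rep \<nu>) = encode (shift (creation \<mu> O (creation \<nu>)\<inverse>))"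
  by (simp add: rep_def adj_shift partial_bij_creation shift_compose partial_bij_converse)

lemma invol_rep_mult:
  "\<lbrakk>\<mu> \<in> paths \<Lambda>; \<nu> \<in> paths \<Lambda>\<rbrakk> \<Longrightarrow>
    invol op_algebra (rep \<mu>) \<otimes>\<^bsub>op_algebra\<^esub> rep \<nu> = encode (shift ((creation \<mu>)\<inverse> O creation \<nu>))"
  by (simp add: rep_def adj_shift partial_bij_creation shift_compose partial_bij_converse)

lemma rep_mult:
  assumes p: "\<mu> \<in> paths \<Lambda>" "\<nu> \<in> paths \<Lambda>" "src \<Lambda> \<mu> = rng \<Lambda> \<nu>"
  shows "rep \<mu> \<otimes>\<^bsub>op_algebra\<^esub> rep \<nu> = rep (pcomp \<Lambda> \<mu> \<nu>)"
proof -
  have "creation \<mu> O creation \<nu> = creation (pcomp \<Lambda> \<mu> \<nu>)"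
  proof (rule idx_relation_eqI)
    show "creation \<mu> O creation \<nu> \<subseteq> idx ` paths \<Lambda> \<times> idx ` paths \<Lambda>"
      using creation_subset[OF p(1)] creation_subset[OF p(2)] by fast
    show "creation (pcomp \<Lambda> \<mu> \<nu>) \<subseteq> idx ` paths \<Lambda> \<times> idx ` paths \<Lambda>"
      using p by (intro creation_subset pcomp_closed)
  qed (use p in \<open>simp add: creation_relcomp_iff creation_iff pcomp_closed src_pcomp, auto simp: pcomp_assoc\<close>)
  then show ?thesis using p by (simp add: rep_def shift_compose partial_bij_creation)
qed

lemma invol_rep_mult_rep:
  assumes p: "\<mu> \<in> paths \<Lambda>"
  shows "invol op_algebra (rep \<mu>) \<otimes>\<^bsub>op_algebra\<^esub> rep \<mu> = rep (src \<Lambda> \<mu>)"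
proof -
  have "(creation \<mu>)\<inverse> O creation \<mu> = creation (src \<Lambda> \<mu>)"
  proof (rule idx_relation_eqI)
    show "(creation \<mu>)\<inverse> O creation \<mu> \<subseteq> idx ` paths \<Lambda> \<times> idx ` paths \<Lambda>"
      using creation_subset[OF p] by fast
    show "creation (src \<Lambda> \<mu>) \<subseteq> idx ` paths \<Lambda> \<times> idx ` paths \<Lambda>"
      using p by (intro creation_subset src_closed)
    fix \<xi> \<eta> assume x: "\<xi> \<in> paths \<Lambda>" "\<eta> \<in> paths \<Lambda>"
    show "(idx \<xi>, idx \<eta>) \<in> (creation \<mu>)\<inverse> O creation \<mu> \<longleftrightarrow> (idx \<xi>, idx \<eta>) \<in> creation (src \<Lambda> \<mu>)"
      unfolding creation_converse_relcomp_iff[OF p p x] creation_vertex[OF src_in_vertices[OF p] x]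
      using pcomp_cancel[of \<mu> \<xi> \<mu> \<eta>] p x by metis
  qed
  then show ?thesis using p by (simp add: invol_rep_mult) (simp add: rep_def)
qed

lemma invol_rep_vertex:
  assumes z: "z \<in> vertices \<Lambda>" shows "invol op_algebra (rep z) = rep z"
proof -
  have p: "z \<in> paths \<Lambda>" using z by (simp add: vertices_def)
  have "(creation z)\<inverse> = creation z"
  proof (rule idx_relation_eqI)
    show "(creation z)\<inverse> \<subseteq> idx ` paths \<Lambda> \<times> idx ` paths \<Lambda>" using creation_subset[OF p] by fast
    show "creation z \<subseteq> idx ` paths \<Lambda> \<times> idx ` paths \<Lambda>" using creation_subset[OF p] .
  qed (use z in \<open>auto simp: creation_vertex\<close>)
  then show ?thesis using p by (simp add: rep_def adj_shift partial_bij_creation)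
qed

lemma rep_toeplitz_relation:
  assumes p: "\<mu> \<in> paths \<Lambda>" "\<nu> \<in> paths \<Lambda>"
  shows "invol op_algebra (rep \<mu>) \<otimes>\<^bsub>op_algebra\<^esub> rep \<nu> =
    (\<Oplus>\<^bsub>op_algebra\<^esub>q\<in>min_ext \<Lambda> \<mu> \<nu>. rep (fst q) \<otimes>\<^bsub>op_algebra\<^esub> invol op_algebra (rep (snd q)))"
proof -
  let ?M = "min_ext \<Lambda> \<mu> \<nu>"
  let ?R = "\<lambda>q. creation (fst q) O (creation (snd q))\<inverse>"
  have q: "fst q \<in> paths \<Lambda>" "snd q \<in> paths \<Lambda>" "src \<Lambda> \<mu> = rng \<Lambda> (fst q)" "src \<Lambda> \<nu> = rng \<Lambda> (snd q)"
    "pcomp \<Lambda> \<mu> (fst q) = pcomp \<Lambda> \<nu> (snd q)" "deg \<Lambda> \<mu> + deg \<Lambda> (fst q) = sup (deg \<Lambda> \<mu>) (deg \<Lambda> \<nu>)"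
    if "q \<in> ?M" for q
  proof -
    obtain \<alpha> \<beta> where q: "q = (\<alpha>, \<beta>)" by (cases q)
    with that show c: "fst q \<in> paths \<Lambda>" "snd q \<in> paths \<Lambda>" "src \<Lambda> \<mu> = rng \<Lambda> (fst q)"
      "src \<Lambda> \<nu> = rng \<Lambda> (snd q)" "pcomp \<Lambda> \<mu> (fst q) = pcomp \<Lambda> \<nu> (snd q)"
      by (simp_all add: min_ext_def)
    have "deg \<Lambda> (pcomp \<Lambda> \<mu> (fst q)) = sup (deg \<Lambda> \<mu>) (deg \<Lambda> \<nu>)"
      using that unfolding q min_ext_def mem_Collect_eq case_prod_conv fst_conv by (elim conjE)
    then show "deg \<Lambda> \<mu> + deg \<Lambda> (fst q) = sup (deg \<Lambda> \<mu>) (deg \<Lambda> \<nu>)"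
      using deg_pcomp[OF p(1) c(1,3)] by simp
  qed
  have pb: "partial_bij (?R q)" if "q \<in> ?M" for q
    using q[OF that] by (intro partial_bij_relcomp partial_bij_converse partial_bij_creation)
  interpret cstar_algebra op_algebra by (rule cstar_algebra_op_algebra)
  have "invol op_algebra (rep \<mu>) \<otimes>\<^bsub>op_algebra\<^esub> rep \<nu> = encode (shift (\<Union>q\<in>?M. ?R q))"
    using p by (simp add: invol_rep_mult creation_min_ext)
  also have "shift (\<Union>q\<in>?M. ?R q) = (\<Sum>q\<in>?M. shift (?R q))"
  proof (rule shift_UN)
    show "finite ?M" using p by (rule finite_min_ext)
    show "partial_bij (\<Union>q\<in>?M. ?R q)"
      using p by (simp add: creation_min_ext[symmetric] partial_bij_relcomp partial_bij_converse partial_bij_creation)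
    fix q q' assume m: "q \<in> ?M" "q' \<in> ?M" and ne: "q \<noteq> q'"
    have deg: "deg \<Lambda> (fst q) = deg \<Lambda> (fst q')" using q(6)[OF m(1)] q(6)[OF m(2)] by (metis add_left_cancel)
    have "fst q \<noteq> fst q'"
    proof
      assume eq: "fst q = fst q'"
      then have "pcomp \<Lambda> \<nu> (snd q) = pcomp \<Lambda> \<nu> (snd q')" using q(5)[OF m(1)] q(5)[OF m(2)] by simp
      then have "snd q = snd q'"
        using pcomp_cancel[of \<nu> "snd q" \<nu> "snd q'"] q[OF m(1)] q[OF m(2)] p by simp
      with eq ne show False by (simp add: prod_eq_iff)
    qed
    then have "Domain (creation (fst q)) \<inter> Domain (creation (fst q')) = {}"
      using q m deg by (intro Domain_creation_disjoint)
    then show "Domain (?R q) \<inter> Domain (?R q') = {}" by blast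
  qed
  also have "encode (\<Sum>q\<in>?M. shift (?R q)) = (\<Oplus>\<^bsub>op_algebra\<^esub>q\<in>?M. encode (shift (?R q)))"
    using finsum_op_algebra[of ?M "\<lambda>q. shift (?R q)"] finite_min_ext[OF p] shift_in_ops[OF pb] by simp
  also have "\<dots> = (\<Oplus>\<^bsub>op_algebra\<^esub>q\<in>?M. rep (fst q) \<otimes>\<^bsub>op_algebra\<^esub> invol op_algebra (rep (snd q)))"
    using q shift_in_ops[OF pb] by (intro M.finsum_cong') (auto simp: rep_mult_invol)
  finally show ?thesis .
qed

text \<open>
  The defect in (T4) is the projection onto the span of the paths with range \<open>z\<close> that do not
  begin with a path of degree \<open>n\<close>.
\<close>

lemma rep_toeplitz_inequality:
  assumes z: "z \<in> vertices \<Lambda>"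
  shows "cstar_le op_algebra
    (\<Oplus>\<^bsub>op_algebra\<^esub>\<xi>\<in>paths_at \<Lambda> z n. rep \<xi> \<otimes>\<^bsub>op_algebra\<^esub> invol op_algebra (rep \<xi>)) (rep z)"
proof -
  let ?P = "paths_at \<Lambda> z n"
  let ?R = "\<lambda>\<xi>. creation \<xi> O (creation \<xi>)\<inverse>"
  interpret cstar_algebra op_algebra by (rule cstar_algebra_op_algebra)
  have zp: "z \<in> paths \<Lambda>" using z by (simp add: vertices_def)
  have q: "\<xi> \<in> paths \<Lambda>" "deg \<Lambda> \<xi> = n" "rng \<Lambda> \<xi> = z" if "\<xi> \<in> ?P" for \<xi>
    using that by (auto simp: paths_at_def)
  have pb: "partial_bij (?R \<xi>)" if "\<xi> \<in> ?P" for \<xi>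
    using q[OF that] by (intro partial_bij_relcomp partial_bij_converse partial_bij_creation)
  define U where "U = (\<Union>\<xi>\<in>?P. ?R \<xi>)"
  have sub: "U \<subseteq> creation z"
  proof -
    have "?R \<xi> \<subseteq> creation z" if x: "\<xi> \<in> ?P" for \<xi>
    proof
      fix k assume "k \<in> ?R \<xi>"
      then obtain i j l where k: "k = (i, j)" "(i, l) \<in> creation \<xi>" "(j, l) \<in> creation \<xi>" by auto
      then obtain \<eta> where "i = idx (pcomp \<Lambda> \<xi> \<eta>)" "\<eta> \<in> paths \<Lambda>" "src \<Lambda> \<xi> = rng \<Lambda> \<eta>"
        by (auto simp: creation_def)
      moreover have "i = j"
        using k partial_bij_creation[OF q(1)[OF x]] by (auto simp: partial_bij_def dest: single_valuedD)
      ultimately show "k \<in> creation z"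
        using k q[OF x] z by (auto simp: creation_vertex pcomp_closed rng_pcomp)
    qed
    then show ?thesis by (auto simp: U_def)
  qed
  have diag: "i = j" if "(i, j) \<in> creation z" for i j
  proof -
    from that obtain \<xi> \<eta> where "i = idx \<xi>" "j = idx \<eta>" "\<xi> \<in> paths \<Lambda>" "\<eta> \<in> paths \<Lambda>"
      using creation_subset[OF zp] by blast
    then show ?thesis using that z by (simp add: creation_vertex)
  qed
  define D where "D = creation z - U"
  have pbz: "partial_bij (creation z)" by (rule partial_bij_creation[OF zp])
  have pbU: "partial_bij U" and pbD: "partial_bij D"
    using sub by (auto intro: partial_bij_subset[OF pbz] simp: D_def)
  have D: "D\<inverse> = D" "D O D = D" using diag by (auto simp: D_def)
  have "(\<Oplus>\<^bsub>op_algebra\<^esub>\<xi>\<in>?P. rep \<xi> \<otimes>\<^bsub>op_algebra\<^esub> invol op_algebra (rep \<xi>))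
      = (\<Oplus>\<^bsub>op_algebra\<^esub>\<xi>\<in>?P. encode (shift (?R \<xi>)))"
    using q shift_in_ops[OF pb] by (intro M.finsum_cong') (auto simp: rep_mult_invol)
  also have "\<dots> = encode (\<Sum>\<xi>\<in>?P. shift (?R \<xi>))"
    using finsum_op_algebra[of ?P "\<lambda>\<xi>. shift (?R \<xi>)"] finite_paths_at shift_in_ops[OF pb] by simp
  also have "(\<Sum>\<xi>\<in>?P. shift (?R \<xi>)) = shift U"
    unfolding U_def
  proof (rule shift_UN[symmetric])
    show "partial_bij (\<Union>\<xi>\<in>?P. ?R \<xi>)" using pbU by (simp add: U_def)
    fix \<xi> \<eta> assume "\<xi> \<in> ?P" "\<eta> \<in> ?P" "\<xi> \<noteq> \<eta>"
    then have "Domain (creation \<xi>) \<inter> Domain (creation \<eta>) = {}"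
      using q by (intro Domain_creation_disjoint) auto
    then show "Domain (?R \<xi>) \<inter> Domain (?R \<eta>) = {}" by blast
  qed (rule finite_paths_at)
  finally have sum: "(\<Oplus>\<^bsub>op_algebra\<^esub>\<xi>\<in>?P. rep \<xi> \<otimes>\<^bsub>op_algebra\<^esub> invol op_algebra (rep \<xi>)) = encode (shift U)" .
  have "shift (creation z) = shift U + shift D"
  proof -
    have "False" if "(i, j) \<in> U" "(i, l) \<in> D" for i j l
      using diag[of i j] diag[of i l] sub that by (auto simp: D_def)
    then have "Domain U \<inter> Domain D = {}" by blast
    moreover have "creation z = (\<Union>b\<in>{True, False}. if b then U else D)" using sub by (auto simp: D_def)
    moreover have "shift (\<Union>b\<in>{True, False}. if b then U else D) = (\<Sum>b\<in>{True, False}. shift (if b then U else D))"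
    proof (rule shift_UN)
      show "partial_bij (\<Union>b\<in>{True, False}. if b then U else D)" using pbz calculation(2) by (simp only:)
      show "Domain (if b then U else D) \<inter> Domain (if b' then U else D) = {}" if "b \<noteq> b'" for b b'
        using that calculation(1) by (cases b; cases b') auto
    qed simp
    ultimately show ?thesis by simp
  qed
  then have "rep z \<ominus>\<^bsub>op_algebra\<^esub> encode (shift U) = encode (shift D)"
    using op_algebra_minus[OF shift_in_ops[OF pbz] shift_in_ops[OF pbU]] by (simp add: rep_def)
  also have "\<dots> = invol op_algebra (encode (shift D)) \<otimes>\<^bsub>op_algebra\<^esub> encode (shift D)"
    by (simp add: adj_shift[OF pbD] D shift_compose[OF pbD pbD])
  finally show ?thesis
    unfolding sum cstar_le_def using shift_in_ops[OF pbD] by auto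
qed

text \<open>
  All relations are identities between the relations \<open>creation \<mu>\<close>, which have been checked above except for the
  orthogonality of distinct vertices.
\<close>

theorem toeplitz_family_rep: "toeplitz_family \<Lambda> op_algebra rep"
proof -
  interpret cstar_algebra op_algebra by (rule cstar_algebra_op_algebra)
  have vp: "z \<in> paths \<Lambda>" if "z \<in> vertices \<Lambda>" for z using that by (simp add: vertices_def)
  have 1: "rep \<xi> \<otimes>\<^bsub>op_algebra\<^esub> invol op_algebra (rep \<xi>) \<otimes>\<^bsub>op_algebra\<^esub> rep \<xi> = rep \<xi>" if "\<xi> \<in> paths \<Lambda>" for \<xi>
    using that rep_closed invol_rep_mult_rep[OF that] rep_mult[of \<xi> "src \<Lambda> \<xi>"] mult_assoc[of "rep \<xi>" "invol op_algebra (rep \<xi>)" "rep \<xi>"]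
    by (simp add: src_closed rng_src pcomp_src del: op_algebra_simps)
  have 2: "rep z \<otimes>\<^bsub>op_algebra\<^esub> rep z = rep z" if "z \<in> vertices \<Lambda>" for z
    using rep_mult[of z z] vertex_rng_src[OF that] vp[OF that] pcomp_rng[of z] by simp
  have 3: "rep y \<otimes>\<^bsub>op_algebra\<^esub> rep z = \<zero>\<^bsub>op_algebra\<^esub>"
    if "y \<in> vertices \<Lambda>" "z \<in> vertices \<Lambda>" "y \<noteq> z" for y z
  proof -
    have "creation y O creation z = {}"
    proof (rule idx_relation_eqI)
      show "creation y O creation z \<subseteq> idx ` paths \<Lambda> \<times> idx ` paths \<Lambda>"
        using creation_subset[OF vp[OF that(1)]] creation_subset[OF vp[OF that(2)]] by fast
    qed (use that vp vertex_rng_src in \<open>auto simp: creation_relcomp_iff\<close>)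
    then show ?thesis
      using that vp by (simp add: rep_def shift_compose partial_bij_creation shift_empty)
  qed
  show ?thesis
    unfolding toeplitz_family_def
    by (intro conjI ballI allI impI;
        rule rep_closed 1 2 3 invol_rep_vertex rep_mult invol_rep_mult_rep
          rep_toeplitz_inequality rep_toeplitz_relation; assumption)
qed

end

section \<open>The critical state of a one-vertex graph\<close>

text \<open>
  The point masses of the distribution on \<open>{0..n}\<close> with tails \<open>x\<^sup>m\<close>, that is, of a geometric variable capped
  at \<open>n\<close>. For \<open>x = 1\<close>, the critical case, it is concentrated at \<open>n\<close>.
\<close>

definition trunc_geom :: "real \<Rightarrow> nat \<Rightarrow> nat \<Rightarrow> real" where
  "trunc_geom x n j = (if j < n then x ^ j - x ^ Suc j else x ^ j)"

lemma trunc_geom_nonneg: "0 \<le> x \<Longrightarrow> x \<le> 1 \<Longrightarrow> 0 \<le> trunc_geom x n j"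
  by (simp add: trunc_geom_def mult_left_le_one_le)

lemma sum_trunc_geom:
  assumes "m \<le> n" shows "(\<Sum>j=m..n. trunc_geom x n j) = x ^ m"
  using assms
proof (induction m rule: inc_induct)
  case base
  then show ?case by (simp add: trunc_geom_def)
next
  case (step m)
  then show ?case by (simp add: sum.atLeast_Suc_atMost trunc_geom_def)
qed

locale one_vertex_toeplitz = toeplitz \<Lambda> A t + one_vertex_two_graph \<Lambda> u
  for \<Lambda> :: "'p pregraph" and A :: "'a cstar" (structure) and t u +
  fixes h r1 r2
  assumes hom: "star_hom A op_algebra h" and h_t: "\<xi> \<in> paths \<Lambda> \<Longrightarrow> h (t \<xi>) = rep \<xi>"
    and edges_pos: "0 < card (paths_at \<Lambda> u e1)" "0 < card (paths_at \<Lambda> u e2)"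
    and r_ge: "ln (real (card (paths_at \<Lambda> u e1))) \<le> r1" "ln (real (card (paths_at \<Lambda> u e2))) \<le> r2"
begin

abbreviation number :: "nat \<times> nat \<Rightarrow> nat" where
  "number n \<equiv> card (paths_at \<Lambda> u n)"

text \<open>
  These ratios are at most 1, with equality exactly when the corresponding \<open>r\<^sub>i\<close> is critical.
\<close>

definition ratio1 :: real where "ratio1 = number e1 * exp (- r1)"
definition ratio2 :: real where "ratio2 = number e2 * exp (- r2)"

lemma ratio_bounds: "0 \<le> ratio1" "ratio1 \<le> 1" "0 \<le> ratio2" "ratio2 \<le> 1"
proof -
  have "real n * exp (- s) \<le> 1" if "0 < n" "ln (real n) \<le> s" for n s
  proof -
    have "real n \<le> exp s" using that by (metis exp_le_cancel_iff exp_ln of_nat_0_less_iff)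
    then show ?thesis by (simp add: exp_minus field_simps)
  qed
  then show "0 \<le> ratio1" "ratio1 \<le> 1" "0 \<le> ratio2" "ratio2 \<le> 1"
    using edges_pos r_ge by (simp_all add: ratio1_def ratio2_def)
qed

lemma number_pos: "0 < number n"
  using edges_pos card_paths_at[of "fst n" "snd n"] by simp

definition entry :: "'p \<Rightarrow> 'a \<Rightarrow> complex" where
  "entry \<xi> x = diag_entry (idx \<xi>) (h x)"

lemma positive_entry: "positive_functional A (entry \<xi>)"
  unfolding entry_def[abs_def]
  by (rule positive_functional_star_hom[OF positive_functional_diag_entry hom])

text \<open>
  A nonzero entry means \<open>\<xi> = \<mu>\<zeta> = \<nu>\<zeta>\<close> for some \<open>\<zeta>\<close>; then \<open>\<mu>\<close> and \<open>\<nu>\<close> have the same degree and are initial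
  segments of the same path.
\<close>

lemma entry_gen:
  assumes p: "\<mu> \<in> paths \<Lambda>" "\<nu> \<in> paths \<Lambda>" and x: "\<xi> \<in> paths \<Lambda>"
  shows "entry \<xi> (gen \<mu> \<nu>) = (if \<mu> = \<nu> \<and> \<xi> \<in> pcomp \<Lambda> \<mu> ` paths \<Lambda> then 1 else 0)"
proof -
  have "h (gen \<mu> \<nu>) = rep \<mu> \<otimes>\<^bsub>op_algebra\<^esub> invol op_algebra (rep \<nu>)"
    using hom p h_t by (simp add: gen_def star_hom_def del: op_algebra_simps)
  also have "\<dots> = encode (shift (creation \<mu> O (creation \<nu>)\<inverse>))" by (rule rep_mult_invol[OF p])
  finally have "entry \<xi> (gen \<mu> \<nu>) = (if (idx \<xi>, idx \<xi>) \<in> creation \<mu> O (creation \<nu>)\<inverse> then 1 else 0)"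
    using p by (simp add: entry_def diag_entry_shift partial_bij_relcomp partial_bij_converse partial_bij_creation)
  also have "(idx \<xi>, idx \<xi>) \<in> creation \<mu> O (creation \<nu>)\<inverse> \<longleftrightarrow> \<mu> = \<nu> \<and> \<xi> \<in> pcomp \<Lambda> \<mu> ` paths \<Lambda>"
  proof
    assume "(idx \<xi>, idx \<xi>) \<in> creation \<mu> O (creation \<nu>)\<inverse>"
    then obtain \<zeta> where z: "\<zeta> \<in> paths \<Lambda>" "\<xi> = pcomp \<Lambda> \<mu> \<zeta>" "\<xi> = pcomp \<Lambda> \<nu> \<zeta>"
      using creation_relcomp_converse_iff[OF p x x] by auto
    have s: "src \<Lambda> \<mu> = rng \<Lambda> \<zeta>" "src \<Lambda> \<nu> = rng \<Lambda> \<zeta>" using p z by (simp_all add: src_eq rng_eq)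
    have "deg \<Lambda> \<mu> + deg \<Lambda> \<zeta> = deg \<Lambda> \<nu> + deg \<Lambda> \<zeta>"
      using deg_pcomp[OF p(1) z(1) s(1)] deg_pcomp[OF p(2) z(1) s(2)] z by simp
    then have "\<mu> = \<nu>"
      using pcomp_cancel[OF p(1) z(1) s(1) p(2) z(1) s(2)] z by simp
    with z show "\<mu> = \<nu> \<and> \<xi> \<in> pcomp \<Lambda> \<mu> ` paths \<Lambda>" by auto
  next
    assume "\<mu> = \<nu> \<and> \<xi> \<in> pcomp \<Lambda> \<mu> ` paths \<Lambda>"
    then show "(idx \<xi>, idx \<xi>) \<in> creation \<mu> O (creation \<nu>)\<inverse>"
      using creation_relcomp_converse_iff[OF p x x] p by (auto simp: src_eq rng_eq)
  qed
  finally show ?thesis .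
qed

definition box :: "nat \<Rightarrow> 'p set" where
  "box n = {\<xi> \<in> paths \<Lambda>. deg \<Lambda> \<xi> \<in> {0..n} \<times> {0..n}}"

text \<open>
  The probability of a path of degree \<open>k\<close>, when the coordinates of the degree are independent capped geometric
  variables and all paths of the same degree are equally likely.
\<close>

definition box_weight :: "nat \<Rightarrow> nat \<times> nat \<Rightarrow> real" where
  "box_weight n k = trunc_geom ratio1 n (fst k) * trunc_geom ratio2 n (snd k) / number k"

definition approx :: "nat \<Rightarrow> 'a \<Rightarrow> complex" where
  "approx n x = (\<Sum>\<xi>\<in>box n. complex_of_real (box_weight n (deg \<Lambda> \<xi>)) * entry \<xi> x)"

lemma finite_box: "finite (box n)"
proof -
  have "box n \<subseteq> (\<Union>k\<in>{0..n} \<times> {0..n}. paths_at \<Lambda> u k)"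
    by (auto simp: box_def paths_at_def rng_eq)
  then show ?thesis by (rule finite_subset) (simp add: finite_paths_at)
qed

lemma positive_approx: "positive_functional A (approx n)"
  unfolding approx_def[abs_def]
  by (rule positive_functional_sum)
    (simp_all add: positive_entry box_weight_def trunc_geom_nonneg ratio_bounds)

lemma card_paths_at_extending:
  assumes \<mu>: "\<mu> \<in> paths \<Lambda>"
  shows "card {\<xi> \<in> paths_at \<Lambda> u k. \<xi> \<in> pcomp \<Lambda> \<mu> ` paths \<Lambda>} =
    (if deg \<Lambda> \<mu> \<le> k then number (k - deg \<Lambda> \<mu>) else 0)"
proof (cases "deg \<Lambda> \<mu> \<le> k")
  case True
  then have k: "deg \<Lambda> \<mu> + (k - deg \<Lambda> \<mu>) = k" by (auto simp: prod_eq_iff less_eq_prod_def)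
  have "{\<xi> \<in> paths_at \<Lambda> u k. \<xi> \<in> pcomp \<Lambda> \<mu> ` paths \<Lambda>} = pcomp \<Lambda> \<mu> ` paths_at \<Lambda> u (k - deg \<Lambda> \<mu>)"
  proof (intro equalityI subsetI)
    fix \<xi> assume "\<xi> \<in> {\<xi> \<in> paths_at \<Lambda> u k. \<xi> \<in> pcomp \<Lambda> \<mu> ` paths \<Lambda>}"
    then obtain \<zeta> where z: "\<zeta> \<in> paths \<Lambda>" "\<xi> = pcomp \<Lambda> \<mu> \<zeta>" "deg \<Lambda> (pcomp \<Lambda> \<mu> \<zeta>) = k"
      by (auto simp: paths_at_def)
    then have "deg \<Lambda> \<mu> + deg \<Lambda> \<zeta> = k" using \<mu> by (simp add: deg_pcomp src_eq rng_eq)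
    then have "deg \<Lambda> \<zeta> = k - deg \<Lambda> \<mu>" by (metis add_diff_cancel_left')
    with z show "\<xi> \<in> pcomp \<Lambda> \<mu> ` paths_at \<Lambda> u (k - deg \<Lambda> \<mu>)" by (auto simp: paths_at_def rng_eq)
  next
    fix \<xi> assume "\<xi> \<in> pcomp \<Lambda> \<mu> ` paths_at \<Lambda> u (k - deg \<Lambda> \<mu>)"
    then show "\<xi> \<in> {\<xi> \<in> paths_at \<Lambda> u k. \<xi> \<in> pcomp \<Lambda> \<mu> ` paths \<Lambda>}"
      using \<mu> k by (auto simp: paths_at_def pcomp_closed deg_pcomp rng_eq src_eq)
  qed
  then show ?thesis using True card_extensions[OF \<mu>] by simp
next
  case False
  have "\<xi> \<notin> pcomp \<Lambda> \<mu> ` paths \<Lambda>" if "\<xi> \<in> paths_at \<Lambda> u k" for \<xi>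
  proof
    assume "\<xi> \<in> pcomp \<Lambda> \<mu> ` paths \<Lambda>"
    then obtain \<zeta> where z: "\<zeta> \<in> paths \<Lambda>" "\<xi> = pcomp \<Lambda> \<mu> \<zeta>" by auto
    then have "deg \<Lambda> \<xi> = deg \<Lambda> \<mu> + deg \<Lambda> \<zeta>"
      using deg_pcomp[OF \<mu> z(1)] \<mu> by (simp add: src_eq rng_eq)
    then have "k = deg \<Lambda> \<mu> + deg \<Lambda> \<zeta>" using that by (simp add: paths_at_def)
    then show False using False by (simp add: less_eq_prod_def)
  qed
  then have "{\<xi> \<in> paths_at \<Lambda> u k. \<xi> \<in> pcomp \<Lambda> \<mu> ` paths \<Lambda>} = {}" by auto
  with False show ?thesis by (simp only: card.empty if_False)
qed

text \<open>
  Among the paths of a given degree \<open>k \<ge> d(\<mu>)\<close>, the proportion of those beginning with \<open>\<mu>\<close> is the inverse of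
  the number of paths of degree \<open>d(\<mu>)\<close>. The probability of \<open>k \<ge> d(\<mu>) = (i, j)\<close> is a product of tails,
  \<open>ratio1\<^sup>i ratio2\<^sup>j\<close>, and dividing it by that number leaves \<open>exp(-r\<cdot>d(\<mu>))\<close>.
\<close>

lemma approx_gen:
  assumes p: "\<mu> \<in> paths \<Lambda>" "\<nu> \<in> paths \<Lambda>" and n: "deg \<Lambda> \<mu> \<le> (n, n)"
  shows "approx n (gen \<mu> \<nu>) = (if \<mu> = \<nu> then exp (- of_real (weight \<Lambda> (r1, r2) \<mu>)) else 0)"
proof (cases "\<mu> = \<nu>")
  case False
  then show ?thesis
    using p by (simp add: approx_def box_def entry_gen)
next
  case True
  obtain i j where d: "deg \<Lambda> \<mu> = (i, j)" by (cases "deg \<Lambda> \<mu>")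
  then have ij: "i \<le> n" "j \<le> n" using n by auto
  let ?E = "pcomp \<Lambda> \<mu> ` paths \<Lambda>"
  let ?D = "{0..n} \<times> {0..n}"
  define g where "g \<xi> = (if \<xi> \<in> ?E then box_weight n (deg \<Lambda> \<xi>) else 0)" for \<xi>
  have "approx n (gen \<mu> \<nu>) = (\<Sum>\<xi>\<in>box n. complex_of_real (g \<xi>))"
    unfolding approx_def using True p by (intro sum.cong) (auto simp: box_def entry_gen g_def)
  also have "\<dots> = complex_of_real (\<Sum>k\<in>?D. \<Sum>\<xi>\<in>{\<xi> \<in> box n. deg \<Lambda> \<xi> = k}. g \<xi>)"
    by (subst sum.group) (use finite_box[of n] in \<open>auto simp: box_def\<close>)
  also have "(\<Sum>k\<in>?D. \<Sum>\<xi>\<in>{\<xi> \<in> box n. deg \<Lambda> \<xi> = k}. g \<xi>) =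
      (\<Sum>k\<in>?D. if (i, j) \<le> k
        then trunc_geom ratio1 n (fst k) * trunc_geom ratio2 n (snd k) / number (i, j) else 0)"
  proof (rule sum.cong[OF refl])
    fix k assume k: "k \<in> ?D"
    have "{\<xi> \<in> box n. deg \<Lambda> \<xi> = k} = paths_at \<Lambda> u k"
      using k by (auto simp: box_def paths_at_def rng_eq)
    then have "(\<Sum>\<xi>\<in>{\<xi> \<in> box n. deg \<Lambda> \<xi> = k}. g \<xi>) =
        (\<Sum>\<xi>\<in>paths_at \<Lambda> u k. if \<xi> \<in> ?E then box_weight n k else 0)"
      by (auto simp: g_def paths_at_def intro!: sum.cong)
    also have "\<dots> = (\<Sum>\<xi>\<in>{\<xi> \<in> paths_at \<Lambda> u k. \<xi> \<in> ?E}. box_weight n k)"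
      by (rule sum.inter_filter[symmetric, OF finite_paths_at])
    also have "\<dots> = card {\<xi> \<in> paths_at \<Lambda> u k. \<xi> \<in> ?E} * box_weight n k"
      by simp
    also have "\<dots> = (if (i, j) \<le> k
        then trunc_geom ratio1 n (fst k) * trunc_geom ratio2 n (snd k) / number (i, j) else 0)"
    proof (cases "(i, j) \<le> k")
      case le: True
      then have "(i, j) + (k - (i, j)) = k" by (auto simp: prod_eq_iff less_eq_prod_def)
      then have "number k = number (i, j) * number (k - (i, j))"
        using card_paths_at_add[of "(i, j)" "k - (i, j)"] by simp
      then show ?thesis
        using le number_pos[of "k - (i, j)"] number_pos[of "(i, j)"]
        unfolding card_paths_at_extending[OF p(1)] d box_weight_def by simp
    qed (simp add: card_paths_at_extending[OF p(1)] d)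
    finally show "(\<Sum>\<xi>\<in>{\<xi> \<in> box n. deg \<Lambda> \<xi> = k}. g \<xi>) = (if (i, j) \<le> k
        then trunc_geom ratio1 n (fst k) * trunc_geom ratio2 n (snd k) / number (i, j) else 0)" .
  qed
  also have "\<dots> = (\<Sum>k\<in>{i..n} \<times> {j..n}. trunc_geom ratio1 n (fst k) * trunc_geom ratio2 n (snd k) / number (i, j))"
    by (intro sum.mono_neutral_cong_right) (auto split: if_splits)
  also have "\<dots> = (\<Sum>k\<in>{i..n}. trunc_geom ratio1 n k) * (\<Sum>k\<in>{j..n}. trunc_geom ratio2 n k) / number (i, j)"
    by (simp add: sum_product sum.cartesian_product sum_divide_distrib case_prod_beta)
  also have "\<dots> = ratio1 ^ i * ratio2 ^ j / number (i, j)"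
    using ij by (simp add: sum_trunc_geom)
  also have "\<dots> = exp (- r1) ^ i * exp (- r2) ^ j"
    using number_pos[of e1] number_pos[of e2]
    by (simp add: card_paths_at[of i j] ratio1_def ratio2_def power_mult_distrib)
  also have "\<dots> = exp (- weight \<Lambda> (r1, r2) \<mu>)"
    by (simp add: weight_def d exp_add exp_of_nat_mult[symmetric] mult.commute exp_diff exp_minus field_simps)
  finally show ?thesis using True by (simp add: exp_of_real[symmetric])
qed

text \<open>
  On each spanning element the states \<open>approx n\<close> are eventually constant, so they converge everywhere, and
  positivity passes to the limit.
\<close>

theorem exists_critical_state:
  obtains f where "cstar_state A f"
    and "\<And>\<mu> \<nu>. \<lbrakk>\<mu> \<in> paths \<Lambda>; \<nu> \<in> paths \<Lambda>\<rbrakk> \<Longrightarrow>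
      f (gen \<mu> \<nu>) = (if \<mu> = \<nu> then exp (- of_real (weight \<Lambda> (r1, r2) \<mu>)) else 0)"
proof -
  have up: "u \<in> paths \<Lambda>" "u \<in> vertices \<Lambda>" using one_vertex by (auto simp: vertices_def)
  have "unit = t u" using up by (simp add: unit_def one_vertex)
  then have unit: "unit = gen u u" using gen_src[of u] vertex_rng_src[OF up(2)] up by simp
  have approx_unit: "approx n unit = 1" for n
    using up by (simp add: unit approx_gen vertices_def weight_def less_eq_prod_def)
  have bdd: "bounded_functional A 1 (approx n)" for n
    using positive_functional_bounded[OF positive_approx, of n] by (simp add: approx_unit)
  have lim_gen: "(\<lambda>n. approx n (gen \<mu> \<nu>)) \<longlonglongrightarrow>
      (if \<mu> = \<nu> then exp (- of_real (weight \<Lambda> (r1, r2) \<mu>)) else 0)"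
    if "\<mu> \<in> paths \<Lambda>" "\<nu> \<in> paths \<Lambda>" for \<mu> \<nu>
  proof (rule tendsto_eventually)
    show "\<forall>\<^sub>F n in sequentially. approx n (gen \<mu> \<nu>) =
        (if \<mu> = \<nu> then exp (- of_real (weight \<Lambda> (r1, r2) \<mu>)) else 0)"
      using eventually_ge_at_top[of "max (fst (deg \<Lambda> \<mu>)) (snd (deg \<Lambda> \<mu>))"]
      by eventually_elim (intro approx_gen that; auto simp: less_eq_prod_def)
  qed
  have "convergent_on_gens approx"
    unfolding convergent_on_gens_def using bdd lim_gen by (auto simp: convergent_def)
  then have conv: "convergent (\<lambda>n. approx n x)" if "x \<in> carrier A" for x
    using convergent_on_gens_convergent that by blast
  define f where "f = restrict (\<lambda>x. lim (\<lambda>n. approx n x)) (carrier A)"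
  have lim: "(\<lambda>n. approx n x) \<longlonglongrightarrow> f x" if "x \<in> carrier A" for x
    using conv[OF that] that by (simp add: f_def convergent_LIMSEQ_iff)
  have lin: "linear_functional A (approx n)" for n
    using bdd by (simp add: bounded_functional_def)
  have "f (x \<oplus> y) = f x + f y" if "x \<in> carrier A" "y \<in> carrier A" for x y
  proof (rule LIMSEQ_unique[OF lim])
    show "(\<lambda>n. approx n (x \<oplus> y)) \<longlonglongrightarrow> f x + f y"
      unfolding linear_functional_add[OF lin that] by (intro tendsto_add lim that)
  qed (use that in simp)
  moreover have "f (c \<odot> x) = c * f x" if "x \<in> carrier A" for c x
  proof (rule LIMSEQ_unique[OF lim])
    show "(\<lambda>n. approx n (c \<odot> x)) \<longlonglongrightarrow> c * f x"
      unfolding linear_functional_smult[OF lin that] by (intro tendsto_mult tendsto_const lim that)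
  qed (use that in simp)
  moreover have "f (invol A x \<otimes> x) \<in> \<real>\<^sub>\<ge>\<^sub>0" if "x \<in> carrier A" for x
  proof (rule Lim_in_closed_set)
    show "closed (\<real>\<^sub>\<ge>\<^sub>0 :: complex set)" by simp
    show "\<forall>\<^sub>F n in sequentially. approx n (invol A x \<otimes> x) \<in> \<real>\<^sub>\<ge>\<^sub>0"
      using positive_approx that by (simp add: positive_functional_def)
    show "(\<lambda>n. approx n (invol A x \<otimes> x)) \<longlonglongrightarrow> f (invol A x \<otimes> x)" using that by (intro lim) simp
  qed simp
  ultimately have "positive_functional A f"
    by (simp add: positive_functional_def linear_functional_def)
  moreover have "f unit = 1"
    using lim[OF unit_closed] by (simp add: approx_unit LIMSEQ_const_iff)
  ultimately have "cstar_state A f" by (rule cstar_stateI) (simp add: f_def extensional_def)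
  moreover have "f (gen \<mu> \<nu>) = (if \<mu> = \<nu> then exp (- of_real (weight \<Lambda> (r1, r2) \<mu>)) else 0)"
    if "\<mu> \<in> paths \<Lambda>" "\<nu> \<in> paths \<Lambda>" for \<mu> \<nu>
    using that by (intro LIMSEQ_unique[OF lim lim_gen]) auto
  ultimately show thesis by (rule that)
qed

end

section \<open>Uniqueness of the KMS state\<close>

theorem theorem4p3:
  fixes a1 a2 b1 b2 d1 d2 :: nat
    and \<Lambda> :: "'p pregraph" and u v w :: 'p
    and r1 r2 :: real
    and A :: "'a cstar" and t :: "'p \<Rightarrow> 'a" and \<alpha> :: "real \<Rightarrow> 'a \<Rightarrow> 'a"
    and B :: "'b cstar" and T :: "'p \<Rightarrow> 'b" and \<gamma> :: "real \<Rightarrow> 'b \<Rightarrow> 'b"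
    and q :: "'a \<Rightarrow> 'b"
  assumes pos: "a1 > 0" "a2 > 0" "b1 > 0" "b2 > 0" "d1 > 0" "d2 > 0"
    and graph: "two_graph \<Lambda>"
    and verts: "vertices \<Lambda> = {u, v, w}" "u \<noteq> v" "u \<noteq> w" "v \<noteq> w"
    and edges_uu: "card (paths_between \<Lambda> u e1 u) = d1" "card (paths_between \<Lambda> u e2 u) = d2"
    and edges_uv: "card (paths_between \<Lambda> u e1 v) = a1" "card (paths_between \<Lambda> u e2 v) = a2"
    and edges_uw: "card (paths_between \<Lambda> u e1 w) = b1"
    and edges_vw: "card (paths_between \<Lambda> v e2 w) = b2"
    and no_other_e1: "\<And>x y. (x, y) \<notin> {(u, u), (u, v), (u, w)} \<Longrightarrow> paths_between \<Lambda> x e1 y = {}"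
    and no_other_e2: "\<And>x y. (x, y) \<notin> {(u, u), (u, v), (v, w)} \<Longrightarrow> paths_between \<Lambda> x e2 y = {}"
    and r_pos: "r1 > 0" "r2 > 0"
    and r_ge: "r1 \<ge> ln (real d1)" "r2 \<ge> ln (real d2)"
    and r_crit: "r1 = ln (real d1) \<or> r2 = ln (real d2)"
    and r_indep: "rationally_independent r1 r2"
    and toeplitz_A: "toeplitz_algebra \<Lambda> A t"
    and dynamics_A: "toeplitz_dynamics \<Lambda> A t (r1, r2) \<alpha>"
    and toeplitz_B: "toeplitz_algebra (graph_minus \<Lambda> {v, w}) B T"
    and dynamics_B: "toeplitz_dynamics (graph_minus \<Lambda> {v, w}) B T (r1, r2) \<gamma>"
    and quotient: "toeplitz_quotient_map \<Lambda> {v, w} A t B T q"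
  shows "(\<exists>!\<phi>. kms_state B \<gamma> 1 \<phi>) \<and>
    (\<forall>\<phi>. kms_state B \<gamma> 1 \<phi> \<longrightarrow>
      (\<forall>\<psi>. kms_state A \<alpha> 1 \<psi> \<longleftrightarrow> \<psi> = compose (carrier A) \<phi> q))"
proof -
  let ?L = "graph_minus \<Lambda> {v, w}"
  interpret G: two_graph \<Lambda> by (rule graph)
  have fin_between: "finite (paths_between \<Lambda> x e1 y)" "finite (paths_between \<Lambda> x e2 y)" for x y
  proof -
    show "finite (paths_between \<Lambda> x e1 y)"
      using no_other_e1[of x y] pos edges_uu edges_uv edges_uw
      by (cases "(x, y) \<in> {(u, u), (u, v), (u, w)}") (auto intro: card_ge_0_finite)
    show "finite (paths_between \<Lambda> x e2 y)"
      using no_other_e2[of x y] pos edges_uu edges_uv edges_vw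
      by (cases "(x, y) \<in> {(u, u), (u, v), (v, w)}") (auto intro: card_ge_0_finite)
  qed
  have cover: "paths_at \<Lambda> x n = (\<Union>y\<in>vertices \<Lambda>. paths_between \<Lambda> x n y)" for x n
    using G.src_in_vertices by (auto simp: paths_between_def paths_at_def)
  have fin: "finite (paths_at \<Lambda> x e1)" "finite (paths_at \<Lambda> x e2)" for x
    using fin_between unfolding cover by (auto simp: verts)
  have fgA: "finite_two_graph \<Lambda>"
    by unfold_locales (use fin verts in simp_all)
  have from_u: "rng \<Lambda> \<xi> = u" if "\<xi> \<in> paths \<Lambda>" "src \<Lambda> \<xi> = u" for \<xi>
    using no_other_e1 no_other_e2 verts that by (intro G.rng_eq_if_src_eq) auto
  have pathsB: "paths ?L = {\<xi> \<in> paths \<Lambda>. src \<Lambda> \<xi> = u}"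
    using G.src_in_vertices verts by (auto simp: graph_minus_def)
  have selB: "rng ?L = rng \<Lambda>" "src ?L = src \<Lambda>" "pcomp ?L = pcomp \<Lambda>" "deg ?L = deg \<Lambda>"
    by (simp_all add: graph_minus_def)
  have graphB: "two_graph ?L"
  proof (rule G.two_graph_graph_minus)
    fix \<xi> assume "\<xi> \<in> paths \<Lambda>" "src \<Lambda> \<xi> \<notin> {v, w}"
    then have "src \<Lambda> \<xi> = u" using G.src_in_vertices verts by auto
    then show "rng \<Lambda> \<xi> \<notin> {v, w}" using from_u[OF \<open>\<xi> \<in> paths \<Lambda>\<close>] verts by simp
  qed
  have at_B: "paths_at ?L u n = paths_between \<Lambda> u n u" for n
    by (auto simp: paths_at_def paths_between_def selB pathsB)
  have vertsB: "vertices ?L = {u}"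
  proof -
    have "u \<in> vertices \<Lambda>" using verts by simp
    then have "src \<Lambda> u = u" "u \<in> paths \<Lambda>" "deg \<Lambda> u = 0"
      using G.vertex_rng_src(2) by (auto simp: vertices_def)
    moreover have "z = u" if "z \<in> paths \<Lambda>" "deg \<Lambda> z = 0" "src \<Lambda> z = u" for z
      using G.deg_zero_eq_src[OF that(1,2)] that(3) by simp
    ultimately show ?thesis by (auto simp: vertices_def selB pathsB)
  qed
  have finB: "finite (paths_at ?L x e1)" "finite (paths_at ?L x e2)" for x
  proof -
    have "paths_at ?L x n \<subseteq> paths_at \<Lambda> x n" for n by (auto simp: paths_at_def selB pathsB)
    then show "finite (paths_at ?L x e1)" "finite (paths_at ?L x e2)"
      using fin by (meson finite_subset)+
  qed
  interpret A: toeplitz_system \<Lambda> A t "(r1, r2)" \<alpha>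
    using fgA toeplitz_A dynamics_A
    by (intro toeplitz_system.intro toeplitz.intro toeplitz_axioms.intro toeplitz_system_axioms.intro)
      (auto simp: toeplitz_algebra_def)
  have fgB: "finite_two_graph ?L"
    using graphB finB vertsB by (intro finite_two_graph.intro finite_two_graph_axioms.intro) auto
  interpret B: toeplitz_system ?L B T "(r1, r2)" \<gamma>
    using fgB toeplitz_B dynamics_B
    by (intro toeplitz_system.intro toeplitz.intro toeplitz_axioms.intro toeplitz_system_axioms.intro)
      (auto simp: toeplitz_algebra_def)
  have "\<exists>h. star_hom B op_algebra h \<and> (\<forall>\<xi>\<in>paths ?L. h (T \<xi>) = B.rep \<xi>)"
    using toeplitz_B cstar_algebra_op_algebra B.toeplitz_family_rep by (simp add: toeplitz_algebra_def)
  then obtain h where h: "star_hom B op_algebra h" "\<And>\<xi>. \<xi> \<in> paths ?L \<Longrightarrow> h (T \<xi>) = B.rep \<xi>" by blast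
  have edges_B: "card (paths_at ?L u e1) = d1" "card (paths_at ?L u e2) = d2"
    by (simp_all only: at_B edges_uu)
  interpret B: one_vertex_toeplitz ?L B T u h r1 r2
    by unfold_locales (simp_all only: vertsB edges_B pos r_ge h)
  have weightB: "weight ?L (r1, r2) = weight \<Lambda> (r1, r2)"
    by (auto simp: weight_def selB)
  have indep: "rationally_independent (fst (r1, r2)) (snd (r1, r2))" using r_indep by simp

  have value_B: "\<phi> (B.gen \<mu> \<nu>) = (if \<mu> = \<nu> then exp (- of_real (weight \<Lambda> (r1, r2) \<mu>)) else 0)"
    if \<phi>: "kms_state B \<gamma> 1 \<phi>" and p: "\<mu> \<in> paths ?L" "\<nu> \<in> paths ?L" for \<phi> \<mu> \<nu>
  proof -
    have "\<phi> (T u) = 1" using B.kms_state_vertices_sum[OF \<phi>] by (simp add: vertsB)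
    then show ?thesis
      using B.kms_state_gen[OF \<phi> indep p] unfolding B.src_eq[OF p(1)] weightB by simp
  qed
  obtain \<phi>0 where state: "cstar_state B \<phi>0" and diag: "\<And>\<mu> \<nu>. \<lbrakk>\<mu> \<in> paths ?L; \<nu> \<in> paths ?L\<rbrakk> \<Longrightarrow>
      \<phi>0 (B.gen \<mu> \<nu>) = (if \<mu> = \<nu> then exp (- of_real (weight ?L (r1, r2) \<mu>)) else 0)"
    using B.exists_critical_state by blast
  interpret B0: diagonal_functional ?L B T "(r1, r2)" \<gamma> \<phi>0 "\<lambda>_. 1"
    using diag B.cstar_state_positive[OF state] by unfold_locales auto
  have kms0: "kms_state B \<gamma> 1 \<phi>0" by (rule B0.kms_state[OF state])
  have unique_B: "\<phi> = \<phi>0" if \<phi>: "kms_state B \<gamma> 1 \<phi>" for \<phi>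
    using \<phi> state by (intro B.states_eqI) (auto simp: value_B kms0 kms_state_def[of B \<gamma> 1 \<phi>])

  define m where "m z = (if z = u then 1 else 0 :: complex)" for z
  have value_A: "\<psi> (A.gen \<mu> \<nu>) = (if \<mu> = \<nu> then exp (- of_real (weight \<Lambda> (r1, r2) \<mu>)) * m (src \<Lambda> \<mu>) else 0)"
    if \<psi>: "kms_state A \<alpha> 1 \<psi>" and p: "\<mu> \<in> paths \<Lambda>" "\<nu> \<in> paths \<Lambda>" for \<psi> \<mu> \<nu>
  proof -
    define x y z where "x = Re (\<psi> (t u))" and "y = Re (\<psi> (t v))" and "z = Re (\<psi> (t w))"
    have nn: "\<psi> (t s) = of_real (Re (\<psi> (t s)))" "0 \<le> Re (\<psi> (t s))" if "s \<in> vertices \<Lambda>" for s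
      using A.kms_state_vertex_nonneg[OF \<psi> that] by (auto simp: complex_nonneg_Reals_iff complex_eq_iff)
    have val: "\<psi> (t u) = of_real x" "\<psi> (t v) = of_real y" "\<psi> (t w) = of_real z" "0 \<le> x" "0 \<le> y" "0 \<le> z"
      using nn by (simp_all add: x_def y_def z_def verts)
    have sub: "exp (- (r1 * real (fst n) + r2 * real (snd n))) *
        (card (paths_between \<Lambda> s n u) * x + card (paths_between \<Lambda> s n v) * y + card (paths_between \<Lambda> s n w) * z)
        \<le> Re (\<psi> (t s))" if "s \<in> vertices \<Lambda>" for s n
      using A.kms_state_subinvariant[OF \<psi> indep that, of n] verts
      by (simp add: x_def y_def z_def add.assoc)
    have "exp (- r1) * (d1 * x + a1 * y + b1 * z) \<le> x"
      using sub[of u e1] verts edges_uu edges_uv edges_uw by (simp add: x_def)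
    moreover have "exp (- r2) * (d2 * x + a2 * y) \<le> x"
      using sub[of u e2] verts edges_uu edges_uv no_other_e2[of u w] by (simp add: x_def)
    moreover have vw: "exp (- r2) * (b2 * z) \<le> y"
      using sub[of v e2] verts edges_vw no_other_e2[of v u] no_other_e2[of v v] by (simp add: y_def)
    \<comment> \<open>At a critical \<open>r\<^sub>i\<close> the mass at \<open>u\<close> alone exhausts the inequality at \<open>u\<close>.\<close>
    ultimately have "y = 0"
    proof -
      have absorb: "c = 0" if "exp (- s) * (real d * x + c) \<le> x" "s = ln (real d)" "0 < d" "0 \<le> c" for s c d
      proof -
        have "exp (- s) * real d = 1" using that by (simp add: exp_minus)
        then have "exp (- s) * c \<le> 0" using that(1) by (simp add: distrib_left mult.assoc[symmetric])
        then show ?thesis using that(4) by (simp add: mult_le_0_iff)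
      qed
      from r_crit show ?thesis
      proof
        assume "r1 = ln (real d1)"
        then have "a1 * y + b1 * z = 0"
          using \<open>exp (- r1) * (d1 * x + a1 * y + b1 * z) \<le> x\<close> pos val
          by (intro absorb[of r1 d1]) (simp_all add: add.assoc)
        then show ?thesis using pos val by (simp add: add_nonneg_eq_0_iff)
      next
        assume "r2 = ln (real d2)"
        then have "a2 * y = 0"
          using \<open>exp (- r2) * (d2 * x + a2 * y) \<le> x\<close> pos val by (intro absorb[of r2 d2]) simp_all
        then show ?thesis using pos by simp
      qed
    qed
    moreover have "z = 0"
      using vw \<open>y = 0\<close> pos val by (simp add: mult_le_0_iff)
    moreover have "x + y + z = 1"
    proof -
      have "complex_of_real (x + y + z) = 1"
        using A.kms_state_vertices_sum[OF \<psi>] verts val by (simp add: add.assoc)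
      then show ?thesis by (simp only: of_real_eq_1_iff)
    qed
    ultimately have "\<psi> (t s) = m s" if "s \<in> vertices \<Lambda>" for s
      using that val by (auto simp: verts m_def)
    then show ?thesis
      using A.kms_state_gen[OF \<psi> indep p] G.src_in_vertices[OF p(1)] by (simp only:)
  qed

  define \<psi>0 where "\<psi>0 = compose (carrier A) \<phi>0 q"
  have q: "star_hom A B q" "\<And>\<mu>. \<mu> \<in> paths \<Lambda> \<Longrightarrow> q (t \<mu>) = (if src \<Lambda> \<mu> \<notin> {v, w} then T \<mu> else \<zero>\<^bsub>B\<^esub>)"
    using quotient by (auto simp: toeplitz_quotient_map_def)
  have \<psi>0_eq: "\<psi>0 x = \<phi>0 (q x)" if "x \<in> carrier A" for x
    using that by (simp add: \<psi>0_def compose_def)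
  have "positive_functional A (\<lambda>x. \<phi>0 (q x))"
    by (rule A.positive_functional_star_hom[OF B.cstar_state_positive[OF state] q(1)])
  then have pos0: "positive_functional A \<psi>0"
    by (simp add: positive_functional_def linear_functional_def \<psi>0_eq)
  have diag0: "\<psi>0 (A.gen \<mu> \<nu>) = (if \<mu> = \<nu> then exp (- of_real (weight \<Lambda> (r1, r2) \<mu>)) * m (src \<Lambda> \<mu>) else 0)"
    if p: "\<mu> \<in> paths \<Lambda>" "\<nu> \<in> paths \<Lambda>" and s: "src \<Lambda> \<mu> = src \<Lambda> \<nu>" for \<mu> \<nu>
  proof -
    have eq: "\<psi>0 (A.gen \<mu> \<nu>) = \<phi>0 (q (t \<mu>) \<otimes>\<^bsub>B\<^esub> invol B (q (t \<nu>)))"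
      using p q(1) by (simp add: \<psi>0_eq) (simp add: A.gen_def star_hom_def)
    show ?thesis
    proof (cases "src \<Lambda> \<mu> = u")
      case True
      then have "\<mu> \<in> paths ?L" "\<nu> \<in> paths ?L" using p s by (simp_all add: pathsB)
      moreover from this have "\<psi>0 (A.gen \<mu> \<nu>) = \<phi>0 (B.gen \<mu> \<nu>)"
        using eq p s True verts by (simp add: q(2) B.gen_def)
      ultimately show ?thesis using diag[of \<mu> \<nu>] True by (auto simp: weightB m_def)
    next
      case False
      then have "src \<Lambda> \<mu> \<in> {v, w}" using G.src_in_vertices[OF p(1)] verts by auto
      then have "\<psi>0 (A.gen \<mu> \<nu>) = 0"
        using eq p s B0.linear by (auto simp: q(2) B.linear_functional_zero)
      then show ?thesis using False by (auto simp: m_def)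
    qed
  qed
  have "\<psi>0 A.unit = 1"
  proof -
    have lin0: "linear_functional A \<psi>0" using pos0 by (simp add: positive_functional_def)
    have "\<psi>0 (t z) = m z" if z: "z \<in> vertices \<Lambda>" for z
    proof -
      have zp: "z \<in> paths \<Lambda>" "src \<Lambda> z = z" "deg \<Lambda> z = 0"
        using z G.vertex_rng_src[OF z] by (auto simp: vertices_def)
      then show ?thesis
        using diag0[of z z] A.gen_src[of z] by (simp add: weight_def)
    qed
    then have "(\<Sum>z\<in>vertices \<Lambda>. \<psi>0 (t z)) = 1" by (simp add: verts m_def)
    then show ?thesis
      using A.linear_functional_finsum[OF lin0 A.finite_vertices, of t]
      by (simp add: A.unit_def A.vertex_path Pi_iff)
  qed
  then have state0: "cstar_state A \<psi>0"
    by (rule A.cstar_stateI[OF pos0]) (simp add: \<psi>0_def)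
  interpret A0: diagonal_functional \<Lambda> A t "(r1, r2)" \<alpha> \<psi>0 m
    using pos0 diag0 by unfold_locales auto
  have kmsA: "kms_state A \<alpha> 1 \<psi>0" by (rule A0.kms_state[OF state0])
  have unique_A: "\<psi> = \<psi>0" if \<psi>: "kms_state A \<alpha> 1 \<psi>" for \<psi>
    using \<psi> state0 by (intro A.states_eqI) (auto simp: value_A kmsA kms_state_def[of A \<alpha> 1 \<psi>])
  show ?thesis
    using kms0 unique_B kmsA unique_A unfolding \<psi>0_def by blast
qed

end
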